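(* Let $\hat K_1\in\mathbb{R}^{m\times n}$ be any stabilizing control gain used both as the initial gain and in the behavior policy of the O-LSPI algorithm, and assume that $\mathbb{E}_\pi[\tilde z\tilde z^T]$ is invertible, where $z=[x^T,u^T,1]^T$. Then for any $\epsilon>0$ there exist $T_0\in\mathbb{Z}_+$ and $M_0\in\mathbb{Z}_+$ such that for any $T\ge T_0$ and $M\ge M_0$, almost surely, $$\limsup_{N\to\infty}\Vert\tilde P_N-P^*\Vert_F<\epsilon$$ and $\hat K_i$ is stabilizing for all $i=1,\dots,N$, where $\hat K_i$ are the gains generated by the O-LSPI algorithm with parameters $N,T,M$, and $\tilde P_N$ is the unique solution $P\in\mathbb{S}^n$ of $(A-B\hat K_N)^TP(A-B\hat K_N)-P+S+\hat K_N^TR\hat K_N=0$.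
   Context: $\mathbb{Z}_+$ denotes the nonnegative integers, $\mathbb{S}^n$ the real symmetric $n\times n$ matrices, $\Vert\cdot\Vert_F$ the Frobenius norm, $Z^\dagger$ the Moore–Penrose inverse. For $Y\in\mathbb{S}^m$ with entries $y_{ij}$, $\mathrm{svec}(Y)=[y_{11},\sqrt2y_{12},\dots,\sqrt2y_{1m},y_{22},\sqrt2y_{23},\dots,\sqrt2y_{m-1,m},y_{mm}]^T\in\mathbb{R}^{m(m+1)/2}$; for a vector $v$, $\tilde v=\mathrm{svec}(vv^T)$. System: $x_{k+1}=Ax_k+Bu_k+Cw_k$, $x_0=x_{ini}$, with $A\in\mathbb{R}^{n\times n}$, $B\in\mathbb{R}^{n\times m}$, $C\in\mathbb{R}^{n\times q}$, $w_k$ i.i.d. $\mathcal{N}(0,I_q)$, $(A,B)$ controllable. $S\in\mathbb{S}^n$ and $R\in\mathbb{S}^m$ are positive definite; $c(x,u)=x^TSx+u^TRu$. A gain $K\in\mathbb{R}^{m\times n}$ is stabilizing if $A-BK$ has spectral radius $<1$. $P^*$ is the unique positive definite solution of $A^TPA-P-A^TPB(R+B^TPB)^{-1}B^TPA+S=0$. Behavior policy: $u_k=-\hat K_1x_k+v_k$ with $v_k$ i.i.d. $\mathcal{N}(0,\sigma_u^2I_m)$, independent of $(w_k)$, $\sigma_u\ge0$; $\pi$ is the unique invariant distribution of the pair $[x^T,u^T]^T$ under this policy. With $z_k=[x_k^T,u_k^T,1]^T$ computed along this trajectory, set $$\Phi_M=\frac1M\sum_{k=0}^{M-1}\tilde z_k\tilde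 z_k^T,\quad \Psi_M=\frac1M\sum_{k=0}^{M-1}\tilde z_k\tilde x_{k+1}^T,\quad \Xi_M=\frac1M\sum_{k=0}^{M-1}\tilde z_kc(x_k,u_k).$$ For $Q\in\mathbb{S}^{n+m}$ and $K\in\mathbb{R}^{m\times n}$, $\mathcal{H}(Q,K)=[I_n,-K^T]\,Q\,[I_n,-K^T]^T$; for $F\in\mathbb{S}^{n+m+1}$, $\mathcal{H}(F,0)$ denotes the upper-left $(n+m)\times(n+m)$ block of $F$. For $Q\in\mathbb{S}^{n+m}$, $[Q]_{uu}$ is the lower-right $m\times m$ block and $[Q]_{ux}$ the lower-left $m\times n$ block. O-LSPI algorithm (input $\hat K_1,N,T,M,\sigma_u^2$): with the same $\Phi_M,\Psi_M,\Xi_M$ for all iterations, for $i=1,\dots,N-1$: set $\hat P_{i,0}=0$; for $j=0,\dots,T-1$ let $\hat F_{i,j}\in\mathbb{S}^{n+m+1}$ be defined by $\mathrm{svec}(\hat F_{i,j})=\Phi_M^\dagger\Psi_M\,\mathrm{svec}(\hat P_{i,j})+\Phi_M^\dagger\Xi_M$, $\hat Q_{i,j}=\mathcal{H}(\hat F_{i,j},0)$, $\hat P_{i,j+1}=\mathcal{H}(\hat Q_{i,j},\hat K_i)$; then let $\mathrm{svec}(\hat F_{i,T})=\Phi_M^\dagger\Psi_M\,\mathrm{svec}(\hat P_{i,T})+\Phi_M^\dagger\Xi_M$, $\hat Q_{i,T}=\mathcal{H}(\hat F_{i,T},0)$ and $\hat K_{i+1}=[\hat Q_{i,T}]_{uu}^{-1}[\hat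 Q_{i,T}]_{ux}$. Return $\hat K_N$.
   Formalization: The threshold M_0 may depend on the noise realization (almost surely there exists M_0, valid for all T≥T_0 and M≥M_0), while T_0 is deterministic; with a deterministic M_0 the claim fails, since for each fixed M the noisy data give a non-stabilizing gain with positive probability. *)

theory Defs
  imports "HOL-Probability.Probability" "HOL-Library.Uprod"
begin

section \<open>Matrices\<close>

definition sym_mat :: "real^'k^'k \<Rightarrow> bool"
  where "sym_mat Y \<longleftrightarrow> transpose Y = Y"

definition pos_def :: "real^'k^'k \<Rightarrow> bool"
  where "pos_def Y \<longleftrightarrow> sym_mat Y \<and> (\<forall>x. x \<noteq> 0 \<longrightarrow> x \<bullet> (Y *v x) > 0)"

text \<open>
  The multiplication and power that come with the type class structure of vectors are componentwise,
  hence a separate matrix power.  The norm on \<open>real^'c^'r\<close> is the Frobenius norm.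
\<close>

primrec matpow :: "real^'k^'k \<Rightarrow> nat \<Rightarrow> real^'k^'k" where
  "matpow X 0 = mat 1"
| "matpow X (Suc k) = X ** matpow X k"

definition spectral_radius :: "real^'k^'k \<Rightarrow> real" where
  "spectral_radius X =
     Max {cmod c | c. \<exists>x. x \<noteq> 0 \<and> (\<chi> i j. complex_of_real (X $ i $ j)) *v x = c *s x}"

definition pinv :: "real^'c^'r \<Rightarrow> real^'r^'c" where
  "pinv Z = (THE X. Z ** X ** Z = Z \<and> X ** Z ** X = X \<and> sym_mat (Z ** X) \<and> sym_mat (X ** Z))"

definition outer :: "real^'r \<Rightarrow> real^'c \<Rightarrow> real^'c^'r"
  where "outer a b = (\<chi> i j. a $ i * b $ j)"

definition vappend :: "real^'a \<Rightarrow> real^'b \<Rightarrow> real^('a::finite + 'b::finite)"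
  where "vappend x y = (\<chi> i. case i of Inl a \<Rightarrow> x $ a | Inr b \<Rightarrow> y $ b)"

definition hcat :: "real^'a^'r \<Rightarrow> real^'b^'r \<Rightarrow> real^('a::finite + 'b::finite)^'r"
  where "hcat X Y = (\<chi> i. vappend (X $ i) (Y $ i))"

definition block_ul :: "real^('a::finite + 'b::finite)^('a::finite + 'b::finite) \<Rightarrow> real^'a^'a"
  where "block_ul Q = (\<chi> i j. Q $ Inl i $ Inl j)"

definition block_ll :: "real^('a::finite + 'b::finite)^('a::finite + 'b::finite) \<Rightarrow> real^'a^'b"
  where "block_ll Q = (\<chi> i j. Q $ Inr i $ Inl j)"

definition block_lr :: "real^('a::finite + 'b::finite)^('a::finite + 'b::finite) \<Rightarrow> real^'b^'b"
  where "block_lr Q = (\<chi> i j. Q $ Inr i $ Inr j)"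


section \<open>Symmetric vectorization\<close>

instance uprod :: (finite) finite
  by standard simp

text \<open>
  The coordinates of \<open>svec Y\<close> are indexed by unordered pairs of indices rather than by an enumeration
  of the upper triangle; by \<open>card_UNIV_uprod\<close> there are \<open>m * (m + 1) div 2\<close> of them when the index
  type has \<open>m\<close> elements.  For symmetric \<open>Y\<close> the chosen representative of the pair is irrelevant, see
  \<open>svec_Upair\<close>.
\<close>

definition svec :: "real^'k^'k \<Rightarrow> real^('k::finite uprod)" where
  "svec Y = (\<chi> p. let (i, j) = (SOME ij. Upair (fst ij) (snd ij) = p)
                  in (if i = j then Y $ i $ i else sqrt 2 * Y $ i $ j))"

lemma svec_Upair:
  assumes "sym_mat Y"
  shows "svec Y $ Upair i j = (if i = j then Y $ i $ i else sqrt 2 * Y $ i $ j)"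
proof -
  define ij where "ij = (SOME ij. Upair (fst ij) (snd ij) = Upair i j)"
  have "Upair (fst ij) (snd ij) = Upair i j"
    unfolding ij_def by (rule someI [where x = "(i, j)"]) simp
  then consider "fst ij = i" "snd ij = j" | "fst ij = j" "snd ij = i"
    by auto
  moreover have "Y $ j $ i = Y $ i $ j"
    by (subst assms [unfolded sym_mat_def, symmetric]) (simp add: transpose_def)
  moreover have "svec Y $ Upair i j =
      (if fst ij = snd ij then Y $ fst ij $ fst ij else sqrt 2 * Y $ fst ij $ snd ij)"
    by (simp only: svec_def vec_lambda_beta ij_def Let_def case_prod_unfold)
  ultimately show ?thesis
    by cases simp_all
qed

definition smat :: "real^('k::finite uprod) \<Rightarrow> real^'k^'k"
  where "smat s = (THE F. sym_mat F \<and> svec F = s)"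

lemma smat_eq:
  "smat s = (\<chi> i j. if i = j then s $ Upair i i else s $ Upair i j / sqrt 2)" (is "_ = ?F")
  unfolding smat_def
proof (rule the_equality)
  have swap: "s $ Upair j i = s $ Upair i j" for i j
    by (rule arg_cong [where f = "($) s"]) simp
  have "transpose ?F $ i $ j = ?F $ i $ j" for i j
    using swap [of j i] by (cases "i = j") (simp_all add: transpose_def)
  then have sym: "sym_mat ?F"
    unfolding sym_mat_def vec_eq_iff by blast
  have "svec ?F $ p = s $ p" for p
    by (cases p) (simp add: svec_Upair [OF sym])
  with sym show "sym_mat ?F \<and> svec ?F = s"
    by (simp add: vec_eq_iff)
next
  fix F assume "sym_mat F \<and> svec F = s"
  then have "sym_mat F" and "s = svec F"
    by simp_all
  then show "F = ?F"
    by (simp add: vec_eq_iff svec_Upair)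
qed

definition vtilde :: "real^'k \<Rightarrow> real^('k::finite uprod)"
  where "vtilde x = svec (outer x x)"


section \<open>The linear quadratic control problem\<close>

text \<open>The matrix \<open>[B, A B, \<dots>, A\<^sup>n\<^sup>-\<^sup>1 B]\<close> has rank \<open>n\<close>.\<close>

definition controllable :: "real^'n^'n \<Rightarrow> real^'m^'n \<Rightarrow> bool" where
  "controllable A B \<longleftrightarrow>
     dim (\<Union>k<CARD('n). columns (matpow A k ** B)) = CARD('n)"

definition stage_cost :: "real^'n^'n \<Rightarrow> real^'m^'m \<Rightarrow> real^'n \<Rightarrow> real^'m \<Rightarrow> real"
  where "stage_cost S R x u = x \<bullet> (S *v x) + u \<bullet> (R *v u)"

definition stabilizing :: "real^'n^'n \<Rightarrow> real^'m^'n \<Rightarrow> real^'n^'m \<Rightarrow> bool"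
  where "stabilizing A B K \<longleftrightarrow> spectral_radius (A - B ** K) < 1"

definition opt_cost ::
  "real^'n^'n \<Rightarrow> real^'m^'n \<Rightarrow> real^'n^'n \<Rightarrow> real^'m^'m \<Rightarrow> real^'n^'n" where
  "opt_cost A B S R = (THE P. pos_def P \<and>
     transpose A ** P ** A - P
       - transpose A ** P ** B ** matrix_inv (R + transpose B ** P ** B) ** transpose B ** P ** A
       + S = 0)"

definition policy_cost ::
  "real^'n^'n \<Rightarrow> real^'m^'n \<Rightarrow> real^'n^'n \<Rightarrow> real^'m^'m \<Rightarrow> real^'n^'m \<Rightarrow> real^'n^'n" where
  "policy_cost A B S R K = (THE P. sym_mat P \<and>
     transpose (A - B ** K) ** P ** (A - B ** K) - P + S + transpose K ** R ** K = 0)"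


section \<open>Noise, trajectory and invariant distribution\<close>

text \<open>
  The distribution \<open>N(0, \<sigma>\<^sup>2 I)\<close>, as the law of \<open>\<sigma>\<close> times a standard normal vector; for \<open>\<sigma> = 0\<close> it is
  the point mass at the origin.
\<close>

definition gauss_vec :: "real \<Rightarrow> (real^'k) measure" where
  "gauss_vec \<sigma> =
     distr (density lborel (\<lambda>x. ennreal (\<Prod>i\<in>UNIV. std_normal_density (x $ i)))) borel
       (\<lambda>x. \<sigma> *\<^sub>R x)"

definition iid_gauss :: "'w measure \<Rightarrow> real \<Rightarrow> (nat \<Rightarrow> 'w \<Rightarrow> real^'k) \<Rightarrow> bool" where
  "iid_gauss \<Omega> \<sigma> X \<longleftrightarrow>
     prob_space.indep_vars \<Omega> (\<lambda>_. borel) X UNIV \<and> (\<forall>k. distr \<Omega> borel (X k) = gauss_vec \<sigma>)"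

text \<open>
  Independence of the sigma-algebras generated by the two sequences; \<open>indep_var\<close> itself would force
  both of them to take values in the same type.
\<close>

definition indep_processes ::
  "'w measure \<Rightarrow> (nat \<Rightarrow> 'w \<Rightarrow> real^'k) \<Rightarrow> (nat \<Rightarrow> 'w \<Rightarrow> real^'l) \<Rightarrow> bool" where
  "indep_processes \<Omega> X Y \<longleftrightarrow>
     prob_space.indep_set \<Omega>
       (sets (vimage_algebra (space \<Omega>) (\<lambda>\<omega> k. X k \<omega>) (\<Pi>\<^sub>M k\<in>UNIV. borel)))
       (sets (vimage_algebra (space \<Omega>) (\<lambda>\<omega> k. Y k \<omega>) (\<Pi>\<^sub>M k\<in>UNIV. borel)))"

text \<open>In the following, \<open>w\<close> and \<open>v\<close> are one realization of the two noise sequences.\<close>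

primrec state ::
  "real^'n^'n \<Rightarrow> real^'m^'n \<Rightarrow> real^'q^'n \<Rightarrow> real^'n^'m \<Rightarrow> real^'n
    \<Rightarrow> (nat \<Rightarrow> real^'q) \<Rightarrow> (nat \<Rightarrow> real^'m) \<Rightarrow> nat \<Rightarrow> real^'n" where
  "state A B C K\<^sub>1 xini w v 0 = xini"
| "state A B C K\<^sub>1 xini w v (Suc k) =
     (let x = state A B C K\<^sub>1 xini w v k; u = - (K\<^sub>1 *v x) + v k in A *v x + B *v u + C *v w k)"

definition input ::
  "real^'n^'n \<Rightarrow> real^'m^'n \<Rightarrow> real^'q^'n \<Rightarrow> real^'n^'m \<Rightarrow> real^'n
    \<Rightarrow> (nat \<Rightarrow> real^'q) \<Rightarrow> (nat \<Rightarrow> real^'m) \<Rightarrow> nat \<Rightarrow> real^'m" where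
  "input A B C K\<^sub>1 xini w v k = - (K\<^sub>1 *v state A B C K\<^sub>1 xini w v k) + v k"

definition zvec :: "real^'n \<Rightarrow> real^'m \<Rightarrow> real^(('n::finite + 'm::finite) + 1)"
  where "zvec x u = vappend (vappend x u) (vec 1)"

text \<open>
  \<open>\<pi>\<close> is preserved by one closed-loop step
  \<open>(x, u) \<mapsto> (A x + B u + C w, - K\<^sub>1 (A x + B u + C w) + v)\<close> with fresh noise \<open>w\<close> and \<open>v\<close>.
\<close>

definition invariant_dist ::
  "real^'n^'n \<Rightarrow> real^'m^'n \<Rightarrow> real^'q^'n \<Rightarrow> real^'n^'m \<Rightarrow> real
    \<Rightarrow> ((real^'n) \<times> (real^'m)) measure \<Rightarrow> bool" where
  "invariant_dist A B C K\<^sub>1 \<sigma> \<pi> \<longleftrightarrow>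
     prob_space \<pi> \<and> sets \<pi> = sets borel \<and>
     distr (\<pi> \<Otimes>\<^sub>M (gauss_vec 1 \<Otimes>\<^sub>M gauss_vec \<sigma>)) borel
       (\<lambda>((x, u), (w, v)). let x' = A *v x + B *v u + C *v w in (x', - (K\<^sub>1 *v x') + v)) = \<pi>"

definition second_moment ::
  "((real^'n) \<times> (real^'m)) measure
    \<Rightarrow> real^((('n::finite + 'm::finite) + 1) uprod)^((('n::finite + 'm::finite) + 1) uprod)" where
  "second_moment \<pi> =
     (\<integral>(x, u). outer (vtilde (zvec x u)) (vtilde (zvec x u)) \<partial>\<pi>)"


section \<open>Optimistic least-squares policy iteration\<close>

text \<open>\<open>x\<close> and \<open>u\<close> are the recorded state and input sequences.\<close>

definition Phi_data ::
  "(nat \<Rightarrow> real^'n) \<Rightarrow> (nat \<Rightarrow> real^'m) \<Rightarrow> nat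
    \<Rightarrow> real^((('n::finite + 'm::finite) + 1) uprod)^((('n::finite + 'm::finite) + 1) uprod)" where
  "Phi_data x u M =
     (1 / real M) *\<^sub>R (\<Sum>k<M. outer (vtilde (zvec (x k) (u k))) (vtilde (zvec (x k) (u k))))"

definition Psi_data ::
  "(nat \<Rightarrow> real^'n) \<Rightarrow> (nat \<Rightarrow> real^'m) \<Rightarrow> nat
    \<Rightarrow> real^('n::finite uprod)^((('n::finite + 'm::finite) + 1) uprod)" where
  "Psi_data x u M =
     (1 / real M) *\<^sub>R (\<Sum>k<M. outer (vtilde (zvec (x k) (u k))) (vtilde (x (Suc k))))"

definition Xi_data ::
  "real^'n^'n \<Rightarrow> real^'m^'m \<Rightarrow> (nat \<Rightarrow> real^'n) \<Rightarrow> (nat \<Rightarrow> real^'m) \<Rightarrow> nat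
    \<Rightarrow> real^((('n::finite + 'm::finite) + 1) uprod)" where
  "Xi_data S R x u M =
     (1 / real M) *\<^sub>R (\<Sum>k<M. stage_cost S R (x k) (u k) *\<^sub>R vtilde (zvec (x k) (u k)))"

definition Hop :: "real^('n::finite + 'm::finite)^('n::finite + 'm::finite) \<Rightarrow> real^'n^'m \<Rightarrow> real^'n^'n" where
  "Hop Q K = hcat (mat 1) (- transpose K) ** Q ** transpose (hcat (mat 1) (- transpose K))"

definition Fhat ::
  "real^((('n::finite + 'm::finite) + 1) uprod)^((('n::finite + 'm::finite) + 1) uprod)
    \<Rightarrow> real^('n::finite uprod)^((('n::finite + 'm::finite) + 1) uprod) \<Rightarrow> real^((('n::finite + 'm::finite) + 1) uprod)
    \<Rightarrow> real^'n^'n \<Rightarrow> real^(('n::finite + 'm::finite) + 1)^(('n::finite + 'm::finite) + 1)" where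
  "Fhat \<Phi> \<Psi> \<Xi> P = smat ((pinv \<Phi> ** \<Psi>) *v svec P + pinv \<Phi> *v \<Xi>)"

definition Qhat ::
  "real^((('n::finite + 'm::finite) + 1) uprod)^((('n::finite + 'm::finite) + 1) uprod)
    \<Rightarrow> real^('n::finite uprod)^((('n::finite + 'm::finite) + 1) uprod) \<Rightarrow> real^((('n::finite + 'm::finite) + 1) uprod)
    \<Rightarrow> real^'n^'n \<Rightarrow> real^('n::finite + 'm::finite)^('n::finite + 'm::finite)" where
  "Qhat \<Phi> \<Psi> \<Xi> P = block_ul (Fhat \<Phi> \<Psi> \<Xi> P)"

primrec Phat ::
  "real^((('n::finite + 'm::finite) + 1) uprod)^((('n::finite + 'm::finite) + 1) uprod)
    \<Rightarrow> real^('n::finite uprod)^((('n::finite + 'm::finite) + 1) uprod) \<Rightarrow> real^((('n::finite + 'm::finite) + 1) uprod)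
    \<Rightarrow> real^'n^'m \<Rightarrow> nat \<Rightarrow> real^'n^'n" where
  "Phat \<Phi> \<Psi> \<Xi> K 0 = 0"
| "Phat \<Phi> \<Psi> \<Xi> K (Suc j) = Hop (Qhat \<Phi> \<Psi> \<Xi> (Phat \<Phi> \<Psi> \<Xi> K j)) K"

definition improve ::
  "real^((('n::finite + 'm::finite) + 1) uprod)^((('n::finite + 'm::finite) + 1) uprod)
    \<Rightarrow> real^('n::finite uprod)^((('n::finite + 'm::finite) + 1) uprod) \<Rightarrow> real^((('n::finite + 'm::finite) + 1) uprod)
    \<Rightarrow> nat \<Rightarrow> real^'n^'m \<Rightarrow> real^'n^'m" where
  "improve \<Phi> \<Psi> \<Xi> T K =
     (let Q = Qhat \<Phi> \<Psi> \<Xi> (Phat \<Phi> \<Psi> \<Xi> K T) in matrix_inv (block_lr Q) ** block_ll Q)"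

text \<open>
  The \<open>i\<close>-th gain for \<open>i \<ge> 1\<close>; index \<open>0\<close> is not used.  The total number of iterations
  only determines how many of these gains are computed.
\<close>

definition Khat ::
  "real^((('n::finite + 'm::finite) + 1) uprod)^((('n::finite + 'm::finite) + 1) uprod)
    \<Rightarrow> real^('n::finite uprod)^((('n::finite + 'm::finite) + 1) uprod) \<Rightarrow> real^((('n::finite + 'm::finite) + 1) uprod)
    \<Rightarrow> nat \<Rightarrow> real^'n^'m \<Rightarrow> nat \<Rightarrow> real^'n^'m" where
  "Khat \<Phi> \<Psi> \<Xi> T K\<^sub>1 i = (improve \<Phi> \<Psi> \<Xi> T ^^ (i - 1)) K\<^sub>1"

definition olspi_gain ::
  "real^'n^'n \<Rightarrow> real^'m^'n \<Rightarrow> real^'q^'n \<Rightarrow> real^'n^'n \<Rightarrow> real^'m^'m \<Rightarrow> real^'n^'m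
    \<Rightarrow> real^'n \<Rightarrow> (nat \<Rightarrow> real^'q) \<Rightarrow> (nat \<Rightarrow> real^'m) \<Rightarrow> nat \<Rightarrow> nat \<Rightarrow> nat \<Rightarrow> real^'n^'m" where
  "olspi_gain A B C S R K\<^sub>1 xini w v T M i =
     (let x = state A B C K\<^sub>1 xini w v; u = input A B C K\<^sub>1 xini w v
      in Khat (Phi_data x u M) (Psi_data x u M) (Xi_data S R x u M) T K\<^sub>1 i)"

end

theory Submission
  imports Defs "HOL-Computational_Algebra.Fundamental_Theorem_Algebra"
begin

text \<open>
  A symmetric matrix \<open>P\<close> stands for the cost-to-go \<open>x \<bullet> P x\<close>, and its Q-function is
  \<open>J P x u = (A x + B u) \<bullet> P (A x + B u) + x \<bullet> S x + u \<bullet> R u\<close>.  Fix a realization of the data.  The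
  Q-function plus a constant is a quadratic form in \<open>(x, u, 1)\<close>, hence linear in the regressor, and the
  regression target \<open>x' \<bullet> P x' + c(x, u)\<close> differs from it only by terms that have mean zero given
  \<open>(x, u)\<close>.  So once the Gram matrix \<open>\<Phi>\<close> is well conditioned, the Q-function fitted to \<open>P\<close> is off by at
  most \<open>\<delta> \<cdot> norm P \<cdot> (|x|\<^sup>2 + |u|\<^sup>2)\<close>, where \<open>\<delta>\<close> does not depend on \<open>P\<close> and tends to 0 with growing \<open>M\<close>
  (\<open>Qhat_accurate\<close>).  This property, called \<open>accurate\<close>, separates the proof into two parts.

  Control.  Let \<open>P\<^sup>*\<close> be the Riccati solution with optimal gain \<open>K\<^sup>*\<close>, and let \<open>K\<close> be a stabilizing gain
  with \<open>P\<^sub>K \<le> \<tau> P\<^sup>*\<close> as quadratic forms.  All forms involved are dominated by the running cost, with constants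
  that depend only on a bound for \<open>\<tau>\<close>; so errors can be measured relative to \<open>P\<^sub>K\<close> or to the running cost.
  The evaluation sweeps started at 0 contract towards \<open>P\<^sub>K\<close> (\<open>evaluation_accuracy\<close>).  Hence for large
  \<open>T\<close> and small \<open>\<delta>\<close> the new gain \<open>K'\<close> minimizes the Q-function of \<open>P\<^sub>K\<close> up to a factor close to 1.  Comparing
  its action with that of \<open>K\<^sup>*\<close> gives \<open>P\<^sub>K\<^sub>' \<le> (1 + \<nu>) (1 + \<theta> (\<tau> - 1)) P\<^sup>*\<close>, where \<open>\<theta> < 1\<close> is the
  contraction factor of the optimal closed loop and \<open>\<nu>\<close> is as small as desired (\<open>improvement\<close>).  So
  \<open>\<tau> - 1\<close> contracts up to an error of order \<open>\<nu>\<close>: the sublevel set is never left, all gains are stabilizing, and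
  the limit superior is of order \<open>\<nu>\<close> (\<open>robust_policy_iteration\<close>).  Both \<open>T\<^sub>0\<close> and \<open>\<delta>\<close> are fixed by the
  first sublevel set, so they do not depend on the realization; only the \<open>M\<^sub>0\<close> from which on the data are
  \<open>\<delta>\<close>-accurate does.

  Probability.  It remains to show that \<open>\<Phi>\<close> converges to the invertible second moment and that the averages of
  the mean-zero terms vanish.  Both are time averages of polynomials of degree four along the closed loop.  The
  closed loop forgets its past geometrically, so up to a small error such a polynomial is a function of the last
  \<open>m\<close> noise values; for these, terms more than \<open>m\<close> steps apart are independent, and a second moment bound along
  the squares yields the strong law (\<open>averages_tendsto\<close>).  The limit is the mean under the invariant
  distribution.  Gaussian noise has the eighth moments that are needed, and the fourth moments of \<open>\<pi>\<close> are finite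
  because its second moment matrix is invertible, hence not the default value 0 of a divergent integral.
\<close>

section \<open>Powers of a matrix whose eigenvalues lie in the open unit disc\<close>

lemma norm_vector_scalar_mult: "norm (c *s x) = cmod c * norm (x :: complex^'n)"
  by (simp add: norm_vec_def norm_mult L2_set_right_distrib)

lemma linear_recurrence_tendsto_zero:
  fixes a b :: "nat \<Rightarrow> real"
  assumes a: "\<And>k. 0 \<le> a k" and r: "0 \<le> r" "r < 1" and step: "\<And>k. a (Suc k) \<le> r * a k + b k"
    and b: "b \<longlonglongrightarrow> 0"
  shows "a \<longlonglongrightarrow> 0"
proof (rule LIMSEQ_I)
  fix e :: real assume e: "e > 0"
  have "e * (1 - r) / 2 > 0" using e r by simp
  from LIMSEQ_D [OF b this] obtain N where N: "\<And>k. k \<ge> N \<Longrightarrow> norm (b k) < e * (1 - r) / 2" by auto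
  have bound: "a (N + j) \<le> r ^ j * a N + e / 2" for j
  proof (induction j)
    case (Suc j)
    have "a (N + Suc j) \<le> r * a (N + j) + e * (1 - r) / 2"
      using step [of "N + j"] N [of "N + j"] by (simp add: abs_less_iff)
    also have "\<dots> \<le> r * (r ^ j * a N + e / 2) + e * (1 - r) / 2"
      using Suc r by (intro add_right_mono mult_left_mono) auto
    also have "\<dots> = r ^ Suc j * a N + e / 2" by (simp add: field_simps)
    finally show ?case .
  qed (use e in simp)
  have "(\<lambda>j. r ^ j * a N) \<longlonglongrightarrow> 0 * a N"
    using r by (intro tendsto_mult LIMSEQ_power_zero) auto
  from LIMSEQ_D [OF this, of "e/2"] e obtain J where J: "\<And>j. j \<ge> J \<Longrightarrow> \<bar>r ^ j * a N\<bar> < e / 2" by auto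
  show "\<exists>no. \<forall>n\<ge>no. norm (a n - 0) < e"
  proof (intro exI allI impI)
    fix n assume n: "n \<ge> N + J"
    have "a (N + (n - N)) \<le> r ^ (n - N) * a N + e / 2" by (rule bound)
    moreover have "\<bar>r ^ (n - N) * a N\<bar> < e / 2" using n by (intro J) auto
    ultimately show "norm (a n - 0) < e" using n a [of n] by (simp add: abs_less_iff)
  qed
qed

text \<open>
  The vector \<open>p(Z) v\<close>.  Fixing the vector lets all of the argument below run in a finite-dimensional space of
  vectors, without a ring of matrices in which \<open>p\<close> could be evaluated.
\<close>

definition poly_act :: "complex^'n^'n \<Rightarrow> complex poly \<Rightarrow> complex^'n \<Rightarrow> complex^'n" where
  "poly_act Z p v = (\<Sum>i\<le>degree p. coeff p i *s (((*v) Z ^^ i) v))"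

lemma poly_act_eq:
  assumes "degree p \<le> n" shows "poly_act Z p v = (\<Sum>i\<le>n. coeff p i *s (((*v) Z ^^ i) v))"
  unfolding poly_act_def using assms
  by (intro sum.mono_neutral_left) (auto simp: coeff_eq_0)

lemma poly_act_pCons: "poly_act Z (pCons a p) v = a *s v + poly_act Z p (Z *v v)"
proof -
  have "poly_act Z (pCons a p) v = (\<Sum>i\<le>Suc (degree p). coeff (pCons a p) i *s (((*v) Z ^^ i) v))"
    by (rule poly_act_eq) (simp add: degree_pCons_le)
  also have "\<dots> = a *s v + poly_act Z p (Z *v v)"
    unfolding sum.atMost_Suc_shift poly_act_def by (simp add: funpow_swap1)
  finally show ?thesis .
qed

lemma poly_act_add: "poly_act Z (p + q) v = poly_act Z p v + poly_act Z q v"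
  using degree_add_le_max [of p q]
  by (simp add: poly_act_eq [where n = "max (degree p) (degree q)"] vector_sadd_rdistrib sum.distrib)

lemma poly_act_smult: "poly_act Z (smult c p) v = c *s poly_act Z p v"
  by (simp add: poly_act_eq [where n = "degree p"] degree_smult_le vec.scale_sum_right)

lemma funpow_matrix_linear:
  fixes Z :: "complex^'n^'n"
  shows "((*v) Z ^^ i) (v - c *s w) = ((*v) Z ^^ i) v - c *s ((*v) Z ^^ i) w"
proof (induction i)
  case (Suc i)
  have "((*v) Z ^^ Suc i) (v - c *s w) = Z *v (((*v) Z ^^ i) v - c *s ((*v) Z ^^ i) w)"
    using Suc by simp
  then show ?case by (simp only: vec.diff vec.scale funpow.simps o_def)
qed simp

lemma poly_act_diff: "poly_act Z p (v - c *s w) = poly_act Z p v - c *s poly_act Z p w"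
  unfolding poly_act_def funpow_matrix_linear vec.scale_right_diff_distrib sum_subtractf
      vec.scale_sum_right vec.scale_scale by (simp add: mult.commute)

lemma poly_act_mult_vec: "poly_act Z p (Z *v v) = Z *v poly_act Z p v"
  unfolding poly_act_def vec.sum vec.scale
  by (simp add: funpow_swap1)

lemma poly_act_root: "poly_act Z ([:- c, 1:] * q) v = poly_act Z q (Z *v v - c *s v)"
proof -
  have "poly_act Z ([:- c, 1:] * q) v = poly_act Z (smult (- c) q + pCons 0 q) v" by simp
  also have "\<dots> = - c *s poly_act Z q v + poly_act Z q (Z *v v)"
    by (simp only: poly_act_add poly_act_smult poly_act_pCons) simp
  finally show ?thesis unfolding poly_act_diff by simp
qed

lemma poly_act_root': "poly_act Z ([:- c, 1:] * q) v = Z *v poly_act Z q v - c *s poly_act Z q v"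
  by (simp only: poly_act_root poly_act_diff poly_act_mult_vec)

text \<open>
  The \<open>n + 1\<close> vectors \<open>v, Z v, \<dots>, Z\<^sup>n v\<close> are linearly dependent or not even distinct; either way the coefficients
  of a relation between them are those of \<open>p\<close>.
\<close>

lemma ex_annihilating_poly:
  fixes Z :: "complex^'n^'n"
  obtains p where "p \<noteq> 0" "poly_act Z p v = 0"
proof -
  define w where "w i = ((*v) Z ^^ i) v" for i
  define n where "n = CARD('n)"
  show thesis
  proof (cases "inj_on w {..n}")
    case False
    then obtain i j where ij: "i \<noteq> j" "w i = w j" by (auto simp: inj_on_def)
    define p where "p = monom (1::complex) i - monom 1 j"
    have "coeff p i = 1" using ij by (simp add: p_def)
    then have p: "p \<noteq> 0" by auto
    have deg: "degree p \<le> max i j" unfolding p_def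
      by (rule degree_diff_le_max [THEN order_trans]) (auto intro: degree_monom_le [THEN order_trans])
    have "poly_act Z p v = (\<Sum>k\<le>max i j. (if k = i then w i else 0) - (if k = j then w j else 0))"
      unfolding poly_act_eq [OF deg] by (intro sum.cong) (auto simp: p_def w_def)
    also have "\<dots> = 0" unfolding sum_subtractf using ij by (simp add: sum.delta')
    finally show ?thesis using that p by blast
  next
    case True
    have "vec.dependent (w ` {..n})"
    proof (rule vec.dependent_biggerset_general)
      show "vec.dim (w ` {..n}) < card (w ` {..n})" if "finite (w ` {..n})"
        using dim_subset_UNIV_cart_gen [of "w ` {..n}"] True
        by (simp add: card_image n_def)
    qed
    then obtain u where u: "\<exists>x\<in>w ` {..n}. u x \<noteq> 0" "(\<Sum>x\<in>w ` {..n}. u x *s x) = 0"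
      by (auto simp: vec.dependent_finite)
    define p where "p = (\<Sum>i\<le>n. monom (u (w i)) i)"
    have c: "coeff p i = (if i \<le> n then u (w i) else 0)" for i
      by (simp add: p_def coeff_sum)
    have deg: "degree p \<le> n" by (rule degree_le) (simp add: c)
    have "p \<noteq> 0" using u(1) c by (metis atMost_iff coeff_0 imageE)
    moreover have "poly_act Z p v = (\<Sum>i\<le>n. u (w i) *s w i)"
      unfolding poly_act_eq [OF deg] by (simp add: c w_def)
    moreover have "\<dots> = 0" using u(2) True by (simp add: sum.reindex)
    ultimately show ?thesis using that by metis
  qed
qed

lemma poly_induct_roots [consumes 1, case_names const root]:
  fixes p :: "complex poly"
  assumes "p \<noteq> 0" and "\<And>a. a \<noteq> 0 \<Longrightarrow> P [:a:]" and "\<And>c q. q \<noteq> 0 \<Longrightarrow> P q \<Longrightarrow> P ([:- c, 1:] * q)"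
  shows "P p"
  using assms(1)
proof (induction "degree p" arbitrary: p)
  case 0
  then show ?case using assms(2) by (metis degree_eq_zeroE pCons_eq_0_iff)
next
  case (Suc n)
  then have "\<not> constant (poly p)" by (simp add: constant_degree)
  then obtain c where "poly p c = 0" using fundamental_theorem_of_algebra by blast
  then obtain q where q: "p = [:- c, 1:] * q" by (auto simp: poly_eq_0_iff_dvd dvd_def)
  with Suc.prems have "q \<noteq> 0" by auto
  then have "degree p = degree [:- c, 1:] + degree q"
    unfolding q by (intro degree_mult_eq) simp_all
  with Suc.hyps(2) have "degree q = n" by simp
  with Suc.hyps(1) \<open>q \<noteq> 0\<close> show ?case unfolding q by (intro assms(3)) auto
qed

text \<open>
  Induction on the linear factors of a polynomial with \<open>p(Z) v = 0\<close>.  If a root \<open>c\<close> lies in the open unit disc, the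
  orbit of \<open>v\<close> solves a recurrence with factor \<open>c\<close> whose inhomogeneity is the orbit of \<open>(Z - c) v\<close>, which
  decays by the induction hypothesis.  Any other root is no eigenvalue, so its factor can be cancelled.
\<close>

lemma powers_tendsto_zero_if_eigenvalues:
  fixes Z :: "complex^'n^'n"
  assumes ev: "\<And>c x. x \<noteq> 0 \<Longrightarrow> Z *v x = c *s x \<Longrightarrow> cmod c < 1"
  shows "(\<lambda>k. ((*v) Z ^^ k) v) \<longlonglongrightarrow> 0"
proof -
  obtain p where p: "p \<noteq> 0" "poly_act Z p v = 0" by (rule ex_annihilating_poly)
  have "\<forall>v. poly_act Z p v = 0 \<longrightarrow> (\<lambda>k. norm (((*v) Z ^^ k) v)) \<longlonglongrightarrow> 0"
    using p(1)
  proof (induction p rule: poly_induct_roots)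
    case (const a)
    have "poly_act Z [:a:] v = a *s v" for v by (simp add: poly_act_def)
    moreover have "((*v) Z ^^ k) 0 = 0" for k by (induction k) simp_all
    ultimately show ?case using const by simp
  next
    case (root c q)
    show ?case
    proof (intro allI impI)
      fix v assume v: "poly_act Z ([:- c, 1:] * q) v = 0"
      show "(\<lambda>k. norm (((*v) Z ^^ k) v)) \<longlonglongrightarrow> 0"
      proof (cases "cmod c < 1")
        case True
        define u where "u = Z *v v - c *s v"
        have "poly_act Z q u = 0" using v by (simp only: poly_act_root u_def)
        with root have u: "(\<lambda>k. norm (((*v) Z ^^ k) u)) \<longlonglongrightarrow> 0" by blast
        show ?thesis
        proof (rule linear_recurrence_tendsto_zero [OF _ norm_ge_zero True _ u])
          fix k
          have "((*v) Z ^^ k) u = ((*v) Z ^^ k) (Z *v v) - c *s ((*v) Z ^^ k) v"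
            unfolding u_def by (rule funpow_matrix_linear)
          then have "((*v) Z ^^ Suc k) v = c *s ((*v) Z ^^ k) v + ((*v) Z ^^ k) u"
            by (simp add: funpow_swap1)
          then show "norm (((*v) Z ^^ Suc k) v) \<le> cmod c * norm (((*v) Z ^^ k) v) + norm (((*v) Z ^^ k) u)"
            by (metis norm_triangle_ineq norm_vector_scalar_mult)
        qed simp
      next
        case False
        \<comment> \<open>A nonzero value would be an eigenvector for the eigenvalue \<open>c\<close> outside the
          disc.\<close>
        have "Z *v poly_act Z q v = c *s poly_act Z q v" using v unfolding poly_act_root' by simp
        with False ev have "poly_act Z q v = 0" by blast
        with root show ?thesis by blast
      qed
    qed
  qed
  with p(2) show ?thesis by (auto simp: tendsto_norm_zero_iff)
qed

text \<open>
  Without eigenvalues every linear factor of an annihilating polynomial of a nonzero vector could be cancelled.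
\<close>

lemma ex_eigenvector:
  fixes Z :: "complex^'n^'n"
  shows "\<exists>c x. x \<noteq> 0 \<and> Z *v x = c *s x"
proof (rule ccontr)
  assume none: "\<not> ?thesis"
  obtain p where p: "p \<noteq> 0" "poly_act Z p (vec 1) = 0" by (rule ex_annihilating_poly)
  have "\<forall>v. poly_act Z p v = 0 \<longrightarrow> v = 0"
    using p(1)
  proof (induction p rule: poly_induct_roots)
    case (const a)
    then show ?case by (simp add: poly_act_def)
  next
    case (root c q)
    show ?case
    proof (intro allI impI)
      fix v assume "poly_act Z ([:- c, 1:] * q) v = 0"
      then have "Z *v poly_act Z q v = c *s poly_act Z q v" unfolding poly_act_root' by simp
      with none have "poly_act Z q v = 0" by blast
      with root show "v = 0" by blast
    qed
  qed
  with p(2) have "(vec 1 :: complex^'n) = 0" by blast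
  then show False by (simp add: vec_eq_iff)
qed

text \<open>
  Pairing with an eigenvector \<open>x\<close> of \<open>Z\<close> turns the action of the transpose into multiplication by the eigenvalue.
  Hence the eigenvalue is a root of an annihilating polynomial, for the transpose, of any basis vector
  \<open>axis i 1\<close> with \<open>x $ i \<noteq> 0\<close>.
\<close>

lemma finite_eigenvalues:
  fixes Z :: "complex^'n^'n"
  shows "finite {c. \<exists>x. x \<noteq> 0 \<and> Z *v x = c *s x}"
proof -
  define T where "T = transpose Z"
  have "\<exists>p. p \<noteq> 0 \<and> poly_act T p (axis i 1) = 0" for i
    by (rule ex_annihilating_poly [of T "axis i 1"]) blast
  then obtain p where p: "\<And>i. p i \<noteq> 0 \<and> poly_act T (p i) (axis i 1) = 0" by metis
  have "\<exists>i. poly (p i) c = 0" if x: "x \<noteq> 0" "Z *v x = c *s x" for c x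
  proof -
    define b where "b y = (\<Sum>j\<in>UNIV. x $ j * y $ j)" for y :: "complex^'n"
    have b_T: "b (T *v y) = c * b y" for y
    proof -
      have "b (T *v y) = (\<Sum>j\<in>UNIV. \<Sum>k\<in>UNIV. x $ j * (Z $ k $ j * y $ k))"
        by (simp only: T_def b_def matrix_vector_mult_def transpose_def sum_distrib_left vec_lambda_beta)
      also have "\<dots> = (\<Sum>k\<in>UNIV. (Z *v x) $ k * y $ k)"
        by (subst sum.swap) (simp only: matrix_vector_mult_def sum_distrib_left vec_lambda_beta mult_ac)
      finally show ?thesis by (simp add: x(2) b_def sum_distrib_left mult_ac)
    qed
    have pow: "b (((*v) T ^^ k) y) = c ^ k * b y" for k y
      by (induction k) (simp_all add: b_T)
    have b_sum: "b (\<Sum>i\<in>I. f i) = (\<Sum>i\<in>I. b (f i))" for I and f :: "nat \<Rightarrow> _"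
      unfolding b_def sum_component sum_distrib_left by (rule sum.swap)
    have b_smult: "b (a *s y) = a * b y" for a y
      by (simp add: b_def sum_distrib_left mult_ac)
    have act: "b (poly_act T q y) = poly q c * b y" for q y
      by (simp add: poly_act_def b_sum b_smult pow poly_altdef sum_distrib_left mult_ac)
    from x obtain i where i: "x $ i \<noteq> 0" by (auto simp: vec_eq_iff)
    have "b (axis i 1) = x $ i" by (simp add: b_def axis_def if_distrib cong: if_cong)
    moreover have "b 0 = 0" by (simp add: b_def)
    ultimately have "poly (p i) c * x $ i = 0" using act [of "p i" "axis i 1"] p by simp
    with i show ?thesis by auto
  qed
  then have "{c. \<exists>x. x \<noteq> 0 \<and> Z *v x = c *s x} \<subseteq> (\<Union>i. {c. poly (p i) c = 0})" by blast
  moreover have "finite (\<Union>i. {c. poly (p i) c = 0})" using p by (simp add: poly_roots_finite)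
  ultimately show ?thesis by (rule finite_subset)
qed

abbreviation cmat :: "real^'k^'k \<Rightarrow> complex^'k^'k" where
  "cmat X \<equiv> (\<chi> i j. complex_of_real (X $ i $ j))"

text \<open>
  The maximum in \<open>spectral_radius\<close> means what it should only because the set of eigenvalues is finite and nonempty.
\<close>

lemma spectral_radius_less_one_iff:
  "spectral_radius X < 1 \<longleftrightarrow> (\<forall>c x. x \<noteq> 0 \<longrightarrow> cmat X *v x = c *s x \<longrightarrow> cmod c < 1)"
proof -
  define E where "E = {c. \<exists>x. x \<noteq> 0 \<and> cmat X *v x = c *s x}"
  have "spectral_radius X = Max (cmod ` E)"
    unfolding spectral_radius_def E_def by (rule arg_cong [where f = Max]) auto
  moreover have "finite E" unfolding E_def by (rule finite_eigenvalues)
  moreover have "E \<noteq> {}" using ex_eigenvector [of "cmat X"] by (simp add: E_def)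
  ultimately have "spectral_radius X < 1 \<longleftrightarrow> (\<forall>r\<in>cmod ` E. r < 1)"
    by (metis (lifting) Max_less_iff finite_imageI image_is_empty)
  also have "\<dots> \<longleftrightarrow> (\<forall>c\<in>E. cmod c < 1)" by simp
  finally show ?thesis unfolding E_def by blast
qed

lemma spectral_radius_less_one_imp_powers:
  fixes X :: "real^'n^'n"
  assumes "spectral_radius X < 1"
  shows "(\<lambda>k. ((*v) X ^^ k) v) \<longlonglongrightarrow> 0"
proof -
  define e where "e v = (\<chi> i. complex_of_real (v $ i))" for v :: "real^'n"
  have eX: "e (X *v v) = cmat X *v e v" for v
    by (simp add: e_def vec_eq_iff matrix_vector_mult_def)
  have pow: "((*v) (cmat X) ^^ k) (e v) = e (((*v) X ^^ k) v)" for k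
    by (induction k) (simp_all add: eX)
  have "(\<lambda>k. ((*v) (cmat X) ^^ k) (e v)) \<longlonglongrightarrow> 0"
    using assms unfolding spectral_radius_less_one_iff
    by (intro powers_tendsto_zero_if_eigenvalues) blast
  then have "(\<lambda>k. e (((*v) X ^^ k) v) $ i) \<longlonglongrightarrow> 0 $ i" for i
    unfolding pow by (rule tendsto_vec_nth)
  then have "(\<lambda>k. Re (e (((*v) X ^^ k) v) $ i)) \<longlonglongrightarrow> Re 0" for i
    by (intro tendsto_Re) simp
  then show ?thesis by (intro vec_tendstoI) (simp add: e_def)
qed

section \<open>Quadratic forms\<close>

text \<open>
  Riccati and Lyapunov equations are handled pointwise through this quadratic form, which avoids rearranging
  products of matrices; for symmetric matrices nothing is lost by \<open>qf_eqI\<close>.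
\<close>

definition qf :: "real^'k^'k \<Rightarrow> real^'k \<Rightarrow> real" where
  "qf P x = x \<bullet> (P *v x)"

lemma sym_mat_inner: "sym_mat P \<Longrightarrow> x \<bullet> (P *v y) = y \<bullet> (P *v x)"
  by (metis sym_mat_def dot_lmul_matrix inner_commute transpose_matrix_vector)

lemma qf_add: "sym_mat P \<Longrightarrow> qf P (x + y) = qf P x + 2 * (x \<bullet> (P *v y)) + qf P y"
  using sym_mat_inner [of P x y]
  by (simp add: qf_def matrix_vector_right_distrib inner_add_left inner_add_right)

text \<open>
  For an eigenvector \<open>a + i b\<close> with eigenvalue \<open>c\<close>, the real and imaginary parts satisfy
  \<open>W(X a) + W(X b) = |c|\<^sup>2 (W(a) + W(b))\<close>, while the left-hand side is smaller than \<open>W(a) + W(b)\<close>.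
\<close>

lemma spectral_radius_less_one_if_lyapunov:
  fixes X W :: "real^'n^'n"
  assumes W: "\<And>x. 0 \<le> qf W x" and dec: "\<And>x. x \<noteq> 0 \<Longrightarrow> qf W (X *v x) < qf W x"
    and sym: "sym_mat W"
  shows "spectral_radius X < 1"
  unfolding spectral_radius_less_one_iff
proof (intro allI impI)
  fix c and z :: "complex^'n"
  assume z: "z \<noteq> 0" "cmat X *v z = c *s z"
  define a where "a = (\<chi> i. Re (z $ i))"
  define b where "b = (\<chi> i. Im (z $ i))"
  have Xa: "X *v a = Re c *\<^sub>R a - Im c *\<^sub>R b"
    unfolding vec_eq_iff
  proof
    fix i have "(\<Sum>j\<in>UNIV. complex_of_real (X $ i $ j) * z $ j) = c * z $ i"
      using z(2) unfolding vec_eq_iff matrix_vector_mult_def by simp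
    from arg_cong [OF this, of Re] show "(X *v a) $ i = (Re c *\<^sub>R a - Im c *\<^sub>R b) $ i"
      by (simp add: matrix_vector_mult_def a_def b_def)
  qed
  have Xb: "X *v b = Re c *\<^sub>R b + Im c *\<^sub>R a"
    unfolding vec_eq_iff
  proof
    fix i have "(\<Sum>j\<in>UNIV. complex_of_real (X $ i $ j) * z $ j) = c * z $ i"
      using z(2) unfolding vec_eq_iff matrix_vector_mult_def by simp
    from arg_cong [OF this, of Im] show "(X *v b) $ i = (Re c *\<^sub>R b + Im c *\<^sub>R a) $ i"
      by (simp add: matrix_vector_mult_def a_def b_def)
  qed
  have "qf W (X *v a) + qf W (X *v b) = ((Re c)\<^sup>2 + (Im c)\<^sup>2) * (qf W a + qf W b)"
    unfolding Xa Xb qf_def using sym_mat_inner [OF sym, of a b]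
    by (simp add: matrix_vector_right_distrib matrix_vector_mult_diff_distrib matrix_vector_mult_scaleR
        inner_add_left inner_add_right inner_diff_left inner_diff_right algebra_simps power2_eq_square)
  then have eq: "qf W (X *v a) + qf W (X *v b) = (cmod c)\<^sup>2 * (qf W a + qf W b)"
    by (simp add: cmod_power2)
  have "a \<noteq> 0 \<or> b \<noteq> 0" using z(1) by (auto simp: a_def b_def vec_eq_iff complex_eq_iff)
  moreover have "qf W (X *v x) \<le> qf W x" for x
    using dec [of x] by (cases "x = 0") (auto simp: less_imp_le)
  ultimately have "qf W (X *v a) + qf W (X *v b) < qf W a + qf W b"
    using dec by (meson add_less_le_mono add_le_less_mono)
  with eq have "(cmod c)\<^sup>2 * (qf W a + qf W b) < 1 * (qf W a + qf W b)" by simp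
  with W [of a] W [of b] have "(cmod c)\<^sup>2 < 1" by (meson add_nonneg_nonneg mult_less_cancel_right not_less)
  then show "cmod c < 1" using abs_square_less_1 [of "cmod c"] by simp
qed

lemma qf_simps:
  "qf (P + Q) x = qf P x + qf Q x" "qf (P - Q) x = qf P x - qf Q x" "qf 0 x = 0"
  "qf (c *\<^sub>R P) x = c * qf P x"
  by (simp_all add: qf_def matrix_vector_mult_add_rdistrib matrix_vector_mult_diff_rdistrib
      inner_add_right inner_diff_right scaleR_matrix_vector_assoc [symmetric])

lemma qf_zero_right [simp]: "qf P 0 = 0"
  by (simp add: qf_def)

lemma qf_minus_right [simp]: "qf P (- x) = qf P x"
  using matrix_vector_mult_scaleR [of P "-1" x] by (simp add: qf_def)

lemma qf_scaleR_right: "qf P (c *\<^sub>R x) = c\<^sup>2 * qf P x"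
  by (simp add: qf_def matrix_vector_mult_scaleR power2_eq_square)

lemma inner_transpose: "x \<bullet> (transpose F *v y) = (F *v x) \<bullet> (y :: real^'m)"
  by (metis dot_lmul_matrix inner_commute transpose_matrix_vector)

lemma qf_congruence: "qf (transpose F ** P ** F) x = qf P (F *v x)"
  by (simp add: qf_def matrix_vector_mul_assoc [symmetric] inner_transpose del: transpose_matrix_vector)

lemma sym_mat_simps:
  "sym_mat (0 :: real^'k^'k)" "sym_mat (mat 1 :: real^'k^'k)"
  "sym_mat P \<Longrightarrow> sym_mat Q \<Longrightarrow> sym_mat (P + Q)" "sym_mat P \<Longrightarrow> sym_mat Q \<Longrightarrow> sym_mat (P - Q)"
  "sym_mat P \<Longrightarrow> sym_mat (c *\<^sub>R P)" "sym_mat P \<Longrightarrow> sym_mat (transpose F ** P ** F)"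
  by (simp_all add: sym_mat_def transpose_scalar matrix_transpose_mul matrix_mul_assoc transpose_mat)
     (simp_all add: transpose_def vec_eq_iff)

lemma matrix_entry_inner: "axis i 1 \<bullet> (P *v axis j 1) = P $ i $ j" for P :: "real^'n^'m"
  by (simp add: matrix_vector_mult_basis inner_axis' column_def)

lemma matrix_entry_qf:
  assumes "sym_mat P"
  shows "P $ i $ j = (qf P (axis i 1 + axis j 1) - qf P (axis i 1) - qf P (axis j 1)) / 2"
  using qf_add [OF assms, of "axis i 1" "axis j 1"] by (simp add: matrix_entry_inner)

lemma qf_eqI:
  assumes "sym_mat P" "sym_mat Q" "\<And>x. qf P x = qf Q x"
  shows "P = Q"
  unfolding vec_eq_iff using matrix_entry_qf assms by metis

lemma norm_matrix_vector_le: "norm (P *v x) \<le> norm P * norm x" for P :: "real^'n^'m"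
proof -
  have "norm (P *v x) = L2_set (\<lambda>i. \<bar>P $ i \<bullet> x\<bar>) UNIV"
    by (simp add: norm_vec_def matrix_mult_dot)
  also have "\<dots> \<le> L2_set (\<lambda>i. norm (P $ i) * norm x) UNIV"
    by (intro L2_set_mono) (auto simp: Cauchy_Schwarz_ineq2)
  also have "\<dots> = norm P * norm x"
    by (simp add: norm_vec_def [of P] L2_set_left_distrib)
  finally show ?thesis .
qed

lemma abs_qf_le: "\<bar>qf P x\<bar> \<le> norm P * (x \<bullet> x)"
proof -
  have "\<bar>qf P x\<bar> \<le> norm x * norm (P *v x)" unfolding qf_def by (rule Cauchy_Schwarz_ineq2)
  also have "\<dots> \<le> norm x * (norm P * norm x)"
    by (intro mult_left_mono norm_matrix_vector_le) simp
  finally show ?thesis by (simp add: dot_square_norm power2_eq_square mult_ac)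
qed

text \<open>
  By polarization every entry is at most \<open>3 t\<close> in absolute value.
\<close>

lemma norm_le_qf:
  fixes P :: "real^'n^'n"
  assumes "sym_mat P" and t: "\<And>x. \<bar>qf P x\<bar> \<le> t * (x \<bullet> x)"
  shows "norm P \<le> 3 * (real CARD('n))\<^sup>2 * t"
proof -
  have entry: "\<bar>P $ i $ j\<bar> \<le> 3 * t" for i j
  proof -
    let ?e = "\<lambda>i. axis i 1 :: real^'n"
    have 1: "?e i \<bullet> ?e i = 1" for i by (simp add: inner_axis)
    have "\<bar>qf P (?e i)\<bar> \<le> t" "\<bar>qf P (?e j)\<bar> \<le> t" using t [of "?e i"] t [of "?e j"] by (simp_all add: 1)
    moreover have "\<bar>qf P (?e i + ?e j)\<bar> \<le> t * (2 + 2 * (?e i \<bullet> ?e j))"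
      using t [of "?e i + ?e j"] by (simp add: inner_add_left inner_add_right 1 inner_commute algebra_simps)
    moreover have "0 \<le> t" using t [of "?e i"] by (simp add: 1)
    moreover have "?e i \<bullet> ?e j \<le> 1" using norm_cauchy_schwarz [of "?e i" "?e j"] by simp
    ultimately show ?thesis
      using matrix_entry_qf [OF assms(1), of i j] mult_left_mono [of "?e i \<bullet> ?e j" 1 t]
      by (simp add: algebra_simps)
  qed
  have "norm P \<le> (\<Sum>i\<in>UNIV. norm (P $ i))" unfolding norm_vec_def [of P]
    by (rule L2_set_le_sum) simp
  also have "\<dots> \<le> (\<Sum>i::'n\<in>UNIV. \<Sum>j::'n\<in>UNIV. 3 * t)"
    by (intro sum_mono order_trans [OF norm_le_l1_cart] entry)
  finally show ?thesis by (simp add: power2_eq_square)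
qed

lemma pos_def_imp_sym: "pos_def P \<Longrightarrow> sym_mat P"
  by (simp add: pos_def_def)

lemma pos_def_qf_pos: "pos_def P \<Longrightarrow> x \<noteq> 0 \<Longrightarrow> 0 < qf P x"
  by (simp add: pos_def_def qf_def)

lemma pos_def_qf_nonneg: "pos_def P \<Longrightarrow> 0 \<le> qf P x"
  using pos_def_qf_pos [of P x] by (cases "x = 0") auto

lemma continuous_qf: "continuous_on T (qf P)"
  unfolding qf_def by (intro continuous_intros)

lemma pos_def_coercive:
  fixes P :: "real^'n^'n"
  assumes "pos_def P"
  obtains s where "0 < s" "\<And>x. s * (x \<bullet> x) \<le> qf P x"
proof -
  let ?S = "sphere 0 1 :: (real^'n) set"
  have "axis undefined 1 \<in> ?S" by simp
  then have "?S \<noteq> {}" by blast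
  then obtain y where y: "y \<in> ?S" "\<And>z. z \<in> ?S \<Longrightarrow> qf P y \<le> qf P z"
    using continuous_attains_inf [OF compact_sphere _ continuous_qf] by blast
  show thesis
  proof
    show "0 < qf P y" using y(1) by (intro pos_def_qf_pos [OF assms]) auto
    fix x :: "real^'n"
    show "qf P y * (x \<bullet> x) \<le> qf P x"
    proof (cases "x = 0")
      case False
      then have "qf P y \<le> qf P ((1 / norm x) *\<^sub>R x)" by (intro y(2)) simp
      with False show ?thesis
        by (simp add: qf_scaleR_right dot_square_norm field_simps)
    qed simp
  qed
qed

lemma pos_def_invertible:
  assumes "pos_def P" shows "invertible P"
proof -
  have "x = 0" if "P *v x = 0" for x
    using pos_def_qf_pos [OF assms, of x] that by (auto simp: qf_def)
  then show ?thesis by (simp add: invertible_left_inverse matrix_left_invertible_ker)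
qed

lemma transpose_plus: "transpose (P + Q) = transpose P + transpose Q"
  by (simp add: transpose_def vec_eq_iff)

lemma transpose_minus: "transpose (P - Q) = transpose P - transpose Q"
  by (simp add: transpose_def vec_eq_iff)

lemma matrix_add_rdistrib': "(A + B) ** C = A ** C + B ** (C :: real^'a^'b)"
  by (vector matrix_matrix_mult_def sum.distrib distrib_right)

lemma matrix_inv_inverse:
  assumes "invertible P"
  shows "P ** matrix_inv P = mat 1" "matrix_inv P ** P = mat 1"
  using someI_ex [OF assms [unfolded invertible_def]] by (simp_all add: matrix_inv_def)

lemma bounded_linear_qf: "bounded_linear (\<lambda>P. qf P x)"
  unfolding linear_conv_bounded_linear [symmetric] by (rule linearI) (simp_all add: qf_simps)

lemma abs_inner_self_add_le: "(x + y) \<bullet> (x + y) \<le> 2 * (x \<bullet> x) + 2 * (y \<bullet> y)"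
  for x :: "'a::real_inner"
  using inner_ge_zero [of "x - y"]
  by (simp add: inner_add_left inner_add_right inner_diff_left inner_diff_right inner_commute)

lemma inner_matrix_vector_self_le: "(A *v x) \<bullet> (A *v x) \<le> (norm A)\<^sup>2 * (x \<bullet> x)"
  for A :: "real^'n^'m"
  using power_mono [OF norm_matrix_vector_le [of A x] norm_ge_zero, of 2]
  by (simp add: power_mult_distrib dot_square_norm)

lemma sym_mat_nth:
  assumes "sym_mat Q" shows "Q $ i $ j = Q $ j $ i"
proof -
  have "transpose Q $ i $ j = Q $ i $ j" using assms by (simp add: sym_mat_def)
  then show ?thesis by (simp add: transpose_def)
qed

section \<open>Lyapunov equations and policy costs\<close>

text \<open>
  Equivalent to a spectral radius below 1 by \<open>stabilizing_iff\<close>, and the form in which stability is used.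
\<close>

definition decaying :: "real^'n^'n \<Rightarrow> bool" where
  "decaying F \<longleftrightarrow> (\<forall>v. (\<lambda>k. ((*v) F ^^ k) v) \<longlonglongrightarrow> 0)"

text \<open>
  Along the orbit of \<open>x\<close> the form decreases, and it tends to 0.  The comparisons with policy costs
  below rest on this.
\<close>

lemma superharmonic_qf_nonneg:
  assumes "decaying F" and "\<And>x. qf D (F *v x) \<le> qf D x"
  shows "0 \<le> qf D x"
proof (rule LIMSEQ_le_const2)
  have "(\<lambda>k. ((*v) F ^^ k) x) \<longlonglongrightarrow> 0" using assms(1) by (simp add: decaying_def)
  then have "(\<lambda>k. qf D (((*v) F ^^ k) x)) \<longlonglongrightarrow> 0 \<bullet> (D *v 0)"
    unfolding qf_def by (intro tendsto_intros bounded_linear.tendsto [OF matrix_vector_mul_bounded_linear])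
  then show "(\<lambda>k. qf D (((*v) F ^^ k) x)) \<longlonglongrightarrow> 0" by simp
  have "qf D (((*v) F ^^ k) x) \<le> qf D x" for k
    by (induction k) (use assms(2) order_trans in \<open>auto\<close>)
  then show "\<exists>N. \<forall>n\<ge>N. qf D (((*v) F ^^ n) x) \<le> qf D x" by blast
qed

lemma lyapunov_comparison:
  assumes "decaying F" and "\<And>x. qf P x = qf P (F *v x) + c x" and "\<And>x. qf X (F *v x) + c x \<le> qf X x"
  shows "qf P x \<le> qf X x"
proof -
  have "qf (X - P) (F *v x) \<le> qf (X - P) x" for x
    using assms(2) [of x] assms(3) [of x] unfolding qf_simps by linarith
  with assms(1) have "0 \<le> qf (X - P) x" by (rule superharmonic_qf_nonneg)
  then show ?thesis by (simp add: qf_simps)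
qed

text \<open>
  The linear map \<open>P \<mapsto> P - F\<^sup>T P F\<close> is injective, since \<open>P = F\<^sup>T P F\<close> can be iterated and \<open>F\<^sup>k\<close> tends to 0; in
  finite dimension it is then surjective.  This avoids summing the series \<open>\<Sum>k. (F\<^sup>k)\<^sup>T Q F\<^sup>k\<close>.
\<close>

lemma lyapunov_solution:
  fixes F Q :: "real^'n^'n"
  assumes F: "decaying F" and Q: "sym_mat Q"
  shows "\<exists>P. sym_mat P \<and> (\<forall>x. qf P x = qf P (F *v x) + qf Q x)"
proof -
  let ?L = "\<lambda>P. P - transpose F ** P ** F"
  have lin: "linear ?L"
    by (rule linearI) (simp_all add: matrix_add_ldistrib matrix_add_rdistrib' scaleR_right_diff_distrib
        scalar_matrix_assoc matrix_scalar_ac)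
  have "inj ?L"
  proof (subst linear_injective_0 [OF lin], intro allI impI)
    fix P assume "?L P = 0"
    then have P: "P = transpose F ** P ** F" by simp
    have step: "x \<bullet> (P *v y) = (F *v x) \<bullet> (P *v (F *v y))" for x y
      by (subst P) (simp add: matrix_vector_mul_assoc [symmetric] inner_transpose del: transpose_matrix_vector)
    have pow: "x \<bullet> (P *v y) = ((*v) F ^^ k) x \<bullet> (P *v (((*v) F ^^ k) y))" for x y k
    proof (induction k)
      case (Suc k)
      then show ?case using step [of "((*v) F ^^ k) x" "((*v) F ^^ k) y"] by simp
    qed simp
    have "x \<bullet> (P *v y) = 0" for x y
    proof -
      have "(\<lambda>k. ((*v) F ^^ k) x \<bullet> (P *v (((*v) F ^^ k) y))) \<longlonglongrightarrow> 0 \<bullet> (P *v 0)"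
        using F unfolding decaying_def
        by (intro tendsto_intros bounded_linear.tendsto [OF matrix_vector_mul_bounded_linear]) auto
      then have "(\<lambda>k. x \<bullet> (P *v y)) \<longlonglongrightarrow> 0" by (simp add: pow [symmetric])
      then show ?thesis by (simp add: LIMSEQ_const_iff)
    qed
    then show "P = 0" by (metis (no_types) matrix_entry_inner vec_eq_iff zero_index)
  qed
  with lin have "surj ?L" by (rule linear_inj_imp_surj)
  from surjD [OF this, of Q] obtain P where P: "?L P = Q" by auto
  have "?L (transpose P) = transpose (?L P)"
    by (simp add: transpose_minus matrix_transpose_mul matrix_mul_assoc)
  also have "\<dots> = ?L P" using P Q by (simp add: sym_mat_def)
  finally have "transpose P = P" using \<open>inj ?L\<close> by (rule injD [rotated])
  moreover have "qf P x = qf P (F *v x) + qf Q x" for x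
    unfolding P [symmetric] by (simp only: qf_simps qf_congruence)
  ultimately show ?thesis by (auto simp: sym_mat_def)
qed

lemma stabilizing_iff: "stabilizing A B K \<longleftrightarrow> decaying (A - B ** K)"
proof
  assume "stabilizing A B K" then show "decaying (A - B ** K)"
    by (simp add: stabilizing_def decaying_def spectral_radius_less_one_imp_powers)
next
  assume d: "decaying (A - B ** K)"
  from lyapunov_solution [OF d, of "mat 1"] obtain P where
    P: "sym_mat P" "\<And>x. qf P x = qf P ((A - B ** K) *v x) + qf (mat 1) x"
    using sym_mat_simps(2) by blast
  have one: "qf (mat 1) x = x \<bullet> x" for x by (simp add: qf_def)
  show "stabilizing A B K" unfolding stabilizing_def
  proof (rule spectral_radius_less_one_if_lyapunov [OF _ _ P(1)])
    have "qf P ((A - B ** K) *v x) \<le> qf P x" for x using P(2) [of x] one [of x] inner_ge_zero [of x] by linarith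
    then show "0 \<le> qf P x" for x by (rule superharmonic_qf_nonneg [OF d])
    show "qf P ((A - B ** K) *v x) < qf P x" if "x \<noteq> 0" for x
      using P(2) [of x] one [of x] that inner_gt_zero_iff [of x] by linarith
  qed
qed

lemma feedback_eq:
  fixes A :: "real^'n^'n" and B :: "real^'m^'n"
  shows "A *v x + B *v (- (K *v x)) = (A - B ** K) *v x"
proof -
  have "B *v (- (K *v x)) = - (B *v (K *v x))"
    using matrix_vector_mult_diff_distrib [of B 0 "K *v x"] by simp
  then show ?thesis
    by (simp add: matrix_vector_mult_diff_rdistrib matrix_vector_mul_assoc)
qed

lemma qf_diff: "sym_mat P \<Longrightarrow> qf P (x - y) = qf P x - 2 * (x \<bullet> (P *v y)) + qf P y"
  using qf_add [of P x "- y"] matrix_vector_mult_diff_distrib [of P 0 y] by simp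

lemma policy_cost_characterization:
  assumes "sym_mat S" "sym_mat R" "decaying (A - B ** K)"
  shows "sym_mat (policy_cost A B S R K)"
    and "qf (policy_cost A B S R K) x =
      qf (policy_cost A B S R K) ((A - B ** K) *v x) + (qf S x + qf R (K *v x))"
proof -
  let ?F = "A - B ** K"
  let ?E = "\<lambda>P. transpose ?F ** P ** ?F - P + S + transpose K ** R ** K"
  have eq: "?E P = 0 \<longleftrightarrow> (\<forall>x. qf P x = qf P (?F *v x) + (qf S x + qf R (K *v x)))" if P: "sym_mat P" for P
  proof -
    have "?E P = 0 \<longleftrightarrow> (\<forall>x. qf (?E P) x = qf 0 x)"
      using qf_eqI [of "?E P" 0] assms P by (auto simp: sym_mat_simps)
    moreover have "qf (?E P) x = qf 0 x \<longleftrightarrow> qf P x = qf P (?F *v x) + (qf S x + qf R (K *v x))" for x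
      unfolding qf_simps qf_congruence by linarith
    ultimately show ?thesis by simp
  qed
  obtain P where P: "sym_mat P" "\<And>x. qf P x = qf P (?F *v x) + qf (S + transpose K ** R ** K) x"
    using lyapunov_solution [OF assms(3) sym_mat_simps(3) [OF assms(1) sym_mat_simps(6) [OF assms(2)]]] by blast
  have "policy_cost A B S R K = P" unfolding policy_cost_def
  proof (rule the_equality)
    have "qf P x = qf P (?F *v x) + (qf S x + qf R (K *v x))" for x
      using P(2) [of x] by (simp only: qf_simps qf_congruence)
    then show "sym_mat P \<and> ?E P = 0" using eq [OF P(1)] P(1) by blast
    fix P' assume "sym_mat P' \<and> ?E P' = 0"
    then have P': "sym_mat P'" "\<And>x. qf P' x = qf P' (?F *v x) + qf (S + transpose K ** R ** K) x"
      using eq [of P'] unfolding qf_simps qf_congruence by blast+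
    show "P' = P"
    proof (rule qf_eqI [OF P'(1) P(1)])
      show "qf P' x = qf P x" for x
        using lyapunov_comparison [OF assms(3) P(2) eq_refl [OF P'(2) [symmetric]]]
          lyapunov_comparison [OF assms(3) P'(2) eq_refl [OF P(2) [symmetric]]]
        by (rule order.antisym [rotated])
    qed
  qed
  note pc = this
  show "sym_mat (policy_cost A B S R K)" unfolding pc by (rule P(1))
  show "qf (policy_cost A B S R K) x =
      qf (policy_cost A B S R K) ((A - B ** K) *v x) + (qf S x + qf R (K *v x))"
    unfolding pc using P(2) [of x] unfolding qf_simps qf_congruence .
qed

section \<open>The Riccati equation\<close>

locale lq_problem =
  fixes A :: "real^'n^'n" and B :: "real^'m^'n" and S :: "real^'n^'n" and R :: "real^'m^'m"
  assumes S: "pos_def S" and R: "pos_def R"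
begin

definition cost :: "real^'n \<Rightarrow> real^'m \<Rightarrow> real" where
  "cost x u = qf S x + qf R u"

text \<open>
  The Q-function of the cost-to-go \<open>P\<close>.
\<close>

definition J :: "real^'n^'n \<Rightarrow> real^'n \<Rightarrow> real^'m \<Rightarrow> real" where
  "J P x u = qf P (A *v x + B *v u) + cost x u"

abbreviation Pc :: "real^'n^'m \<Rightarrow> real^'n^'n" where
  "Pc K \<equiv> policy_cost A B S R K"

lemma cost_nonneg: "0 \<le> cost x u"
  using pos_def_qf_nonneg [OF S] pos_def_qf_nonneg [OF R] by (simp add: cost_def add_nonneg_nonneg)

lemma cost_ge_S: "qf S x \<le> cost x u"
  using pos_def_qf_nonneg [OF R] by (simp add: cost_def)

lemma J_mono: "(\<And>x. qf P x \<le> qf Q x) \<Longrightarrow> J P x u \<le> J Q x u"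
  by (simp add: J_def)

lemma J_ge_cost: "(\<And>x. 0 \<le> qf P x) \<Longrightarrow> cost x u \<le> J P x u"
  by (simp add: J_def)

lemma J_feedback: "J P x (- (K *v x)) = qf P ((A - B ** K) *v x) + cost x (- (K *v x))"
  by (simp only: J_def feedback_eq)

lemma Pc_sym: "stabilizing A B K \<Longrightarrow> sym_mat (Pc K)"
  using S R by (simp add: policy_cost_characterization(1) pos_def_imp_sym stabilizing_iff)

lemma Pc_eq:
  assumes "stabilizing A B K"
  shows "qf (Pc K) x = J (Pc K) x (- (K *v x))"
proof -
  have c: "cost x (- (K *v x)) = qf S x + qf R (K *v x)" unfolding cost_def qf_minus_right ..
  have "decaying (A - B ** K)" using assms unfolding stabilizing_iff .
  then show ?thesis unfolding J_feedback c
    by (rule policy_cost_characterization(2) [OF pos_def_imp_sym [OF S] pos_def_imp_sym [OF R]])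
qed

lemma Pc_le:
  assumes "stabilizing A B K" "\<And>x. J X x (- (K *v x)) \<le> qf X x"
  shows "qf (Pc K) x \<le> qf X x"
proof (rule lyapunov_comparison)
  show "decaying (A - B ** K)" using assms(1) by (simp add: stabilizing_iff)
  show "qf (Pc K) x = qf (Pc K) ((A - B ** K) *v x) + cost x (- (K *v x))" for x
    using Pc_eq [OF assms(1), of x] unfolding J_feedback .
  show "qf X ((A - B ** K) *v x) + cost x (- (K *v x)) \<le> qf X x" for x
    using assms(2) [of x] unfolding J_feedback .
qed

lemma Pc_ge:
  assumes "stabilizing A B K" "\<And>x. qf X x \<le> J X x (- (K *v x))"
  shows "qf X x \<le> qf (Pc K) x"
proof -
  have "0 \<le> qf (Pc K - X) x"
  proof (rule superharmonic_qf_nonneg)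
    show "decaying (A - B ** K)" using assms(1) by (simp add: stabilizing_iff)
    show "qf (Pc K - X) ((A - B ** K) *v x) \<le> qf (Pc K - X) x" for x
      using assms(2) [of x] Pc_eq [OF assms(1), of x] unfolding J_feedback qf_simps by linarith
  qed
  then show ?thesis by (simp add: qf_simps)
qed

lemma Pc_nonneg: "stabilizing A B K \<Longrightarrow> 0 \<le> qf (Pc K) x"
  using Pc_ge [of K 0 x] by (simp add: J_def qf_simps cost_nonneg)

text \<open>
  Positive definiteness of \<open>S\<close> makes the decrease of \<open>X\<close> along the closed loop strict.
\<close>

lemma stabilizing_if_lyapunov:
  assumes sym: "sym_mat X" and nonneg: "\<And>x. 0 \<le> qf X x" and le: "\<And>x. J X x (- (K *v x)) \<le> qf X x"
  shows "stabilizing A B K"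
  unfolding stabilizing_def
proof (rule spectral_radius_less_one_if_lyapunov [OF nonneg _ sym])
  fix x :: "real^'n" assume "x \<noteq> 0"
  then have "0 < cost x (- (K *v x))" using pos_def_qf_pos [OF S] cost_ge_S by (metis order_less_le_trans)
  with le [of x] show "qf X ((A - B ** K) *v x) < qf X x" unfolding J_feedback by simp
qed

definition Mu :: "real^'n^'n \<Rightarrow> real^'m^'m" where
  "Mu P = R + transpose B ** P ** B"

definition Gain :: "real^'n^'n \<Rightarrow> real^'n^'m" where
  "Gain P = matrix_inv (Mu P) ** transpose B ** P ** A"

definition Ric :: "real^'n^'n \<Rightarrow> real^'n^'n" where
  "Ric P = transpose A ** P ** A
       - transpose A ** P ** B ** matrix_inv (Mu P) ** transpose B ** P ** A + S"

context
  fixes P :: "real^'n^'n"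
  assumes P: "sym_mat P" "\<And>x. 0 \<le> qf P x"
begin

lemma Mu_pos_def: "pos_def (Mu P)"
  unfolding pos_def_def
proof (intro conjI allI impI)
  show "sym_mat (Mu P)" using P pos_def_imp_sym [OF R] by (simp add: Mu_def sym_mat_simps)
  fix x :: "real^'m" assume "x \<noteq> 0"
  then show "0 < x \<bullet> (Mu P *v x)"
    using pos_def_qf_pos [OF R, of x] P(2) [of "B *v x"]
    by (simp flip: qf_def) (simp add: Mu_def qf_simps qf_congruence)
qed

lemma Mu_inverse: "Mu P *v (matrix_inv (Mu P) *v y) = y"
  using matrix_inv_inverse(1) [OF pos_def_invertible [OF Mu_pos_def]] by (simp add: matrix_vector_mul_assoc)

lemma sym_matrix_inv_Mu: "transpose (matrix_inv (Mu P)) = matrix_inv (Mu P)"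
proof -
  have "Mu P ** matrix_inv (Mu P) = mat 1" "matrix_inv (Mu P) ** Mu P = mat 1"
    using matrix_inv_inverse [OF pos_def_invertible [OF Mu_pos_def]] by auto
  moreover have "transpose (Mu P) = Mu P" using Mu_pos_def by (simp add: pos_def_def sym_mat_def)
  ultimately have "transpose (matrix_inv (Mu P)) ** Mu P = mat 1"
    by (metis matrix_transpose_mul transpose_mat)
  then show ?thesis
    using \<open>Mu P ** matrix_inv (Mu P) = mat 1\<close> by (metis matrix_mul_assoc matrix_mul_lid matrix_mul_rid)
qed

lemma Ric_sym: "sym_mat (Ric P)"
proof -
  have "transpose P = P" "transpose S = S" using P(1) pos_def_imp_sym [OF S] by (simp_all add: sym_mat_def)
  then show ?thesis unfolding Ric_def sym_mat_def
    by (simp add: transpose_minus transpose_plus matrix_transpose_mul sym_matrix_inv_Mu matrix_mul_assoc)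
qed

text \<open>
  Completing the square in \<open>u\<close>: the minimizer of the Q-function is \<open>- Gain P x\<close> and the minimal value is the right-hand
  side of the Riccati equation.
\<close>

lemma J_complete_square: "J P x u = qf (Ric P) x + qf (Mu P) (u + Gain P *v x)"
proof -
  define b where "b = transpose B *v (P *v (A *v x))"
  define y where "y = matrix_inv (Mu P) *v b"
  have y: "Gain P *v x = y"
    by (simp add: Gain_def y_def b_def matrix_vector_mul_assoc matrix_mul_assoc)
  have My: "Mu P *v y = b" by (simp add: y_def Mu_inverse)
  have ub: "(A *v x) \<bullet> (P *v (B *v u)) = u \<bullet> b" for u
    using sym_mat_inner [OF P(1)] by (simp add: b_def inner_transpose del: transpose_matrix_vector)
  have Ry: "qf (Ric P) x = qf P (A *v x) - y \<bullet> b + qf S x"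
  proof -
    have "qf (transpose A ** P ** B ** matrix_inv (Mu P) ** transpose B ** P ** A) x
        = x \<bullet> (transpose A *v (P *v (B *v y)))"
      by (simp add: qf_def y_def b_def matrix_vector_mul_assoc matrix_mul_assoc)
    also have "\<dots> = y \<bullet> b" using ub [of y] by (simp add: inner_transpose del: transpose_matrix_vector)
    finally show ?thesis by (simp add: Ric_def qf_simps qf_congruence)
  qed
  have sM: "sym_mat (Mu P)" using Mu_pos_def by (rule pos_def_imp_sym)
  have "qf (Mu P) (u + y) = qf (Mu P) u + 2 * (u \<bullet> b) + y \<bullet> b"
    by (simp add: qf_add [OF sM] My) (simp add: qf_def My)
  moreover have "qf (Mu P) u = qf R u + qf P (B *v u)"
    by (simp add: Mu_def qf_simps qf_congruence)
  moreover have "qf P (A *v x + B *v u) = qf P (A *v x) + 2 * (u \<bullet> b) + qf P (B *v u)"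
    by (simp add: qf_add [OF P(1)] ub)
  ultimately show ?thesis by (simp add: J_def cost_def y Ry)
qed

lemma Ric_le_J: "qf (Ric P) x \<le> J P x u"
  using pos_def_qf_nonneg [OF Mu_pos_def] by (simp add: J_complete_square)

lemma Ric_eq_J: "qf (Ric P) x = J P x (- (Gain P *v x))"
  by (simp add: J_complete_square)

lemma Ric_nonneg: "0 \<le> qf (Ric P) x"
  using J_ge_cost [OF P(2)] cost_nonneg order_trans unfolding Ric_eq_J by blast

end

lemma Ric_mono:
  assumes "sym_mat P" "\<And>x. 0 \<le> qf P x" "sym_mat Q" "\<And>x. 0 \<le> qf Q x" "\<And>x. qf P x \<le> qf Q x"
  shows "qf (Ric P) x \<le> qf (Ric Q) x"
  using Ric_le_J [OF assms(1,2)] Ric_eq_J [OF assms(3,4)] J_mono [OF assms(5)] by (metis order_trans)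

text \<open>
  Value iteration from 0 increases and stays below the cost of the given stabilizing gain.  The limit is a fixed
  point: one inequality follows from monotonicity, and the other because the minimizing inputs stay
  bounded, so that replacing the iterate by the limit changes the minimal value by little.
\<close>

lemma riccati_exists:
  assumes K: "stabilizing A B K"
  shows "\<exists>P. pos_def P \<and> Ric P = P"
proof -
  define p where "p k = (Ric ^^ k) 0" for k
  have p0: "p 0 = 0" and pSuc: "p (Suc k) = Ric (p k)" for k by (simp_all add: p_def)
  have sym: "sym_mat (p k)" and nonneg: "0 \<le> qf (p k) x" for k x
  proof -
    have "sym_mat (p k) \<and> (\<forall>x. 0 \<le> qf (p k) x)"
    proof (induction k)
      case 0 then show ?case by (simp add: p0 qf_simps sym_mat_simps)
    next
      case (Suc k) then show ?case unfolding pSuc by (blast intro: Ric_sym Ric_nonneg)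
    qed
    then show "sym_mat (p k)" "0 \<le> qf (p k) x" by auto
  qed
  have mono: "qf (p k) x \<le> qf (p (Suc k)) x" for k x
  proof (induction k arbitrary: x)
    case 0 show ?case using nonneg [of "Suc 0" x] by (simp add: p0 qf_simps)
  next
    case (Suc k) show ?case 
      using Ric_mono [OF sym [of k] nonneg [of k] sym [of "Suc k"] nonneg [of "Suc k"] Suc]
      by (simp only: pSuc)
  qed
  have bdd: "qf (p k) x \<le> qf (Pc K) x" for k x
  proof (induction k arbitrary: x)
    case 0 show ?case using Pc_nonneg [OF K] by (simp add: p0 qf_simps)
  next
    case (Suc k)
    have "qf (p (Suc k)) x \<le> J (p k) x (- (K *v x))" unfolding pSuc by (rule Ric_le_J [OF sym nonneg])
    also have "\<dots> \<le> J (Pc K) x (- (K *v x))" by (rule J_mono) (rule Suc)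
    also have "\<dots> = qf (Pc K) x" by (rule Pc_eq [OF K, symmetric])
    finally show ?case .
  qed
  have conv: "convergent (\<lambda>k. qf (p k) x)" for x
  proof -
    have "incseq (\<lambda>k. qf (p k) x)" using mono by (intro incseq_SucI) 
    then show ?thesis using bdd by (meson convergentI incseq_convergent)
  qed
  then have q_lim: "(\<lambda>k. qf (p k) x) \<longlonglongrightarrow> lim (\<lambda>k. qf (p k) x)" for x
    by (simp add: convergent_LIMSEQ_iff)
  have "convergent (\<lambda>k. p k $ i $ j)" for i j
    unfolding matrix_entry_qf [OF sym]
    by (rule convergentI [OF tendsto_divide [OF tendsto_diff [OF tendsto_diff [OF q_lim q_lim] q_lim] tendsto_const]]) simp
  then have lims: "(\<lambda>k. p k $ i $ j) \<longlonglongrightarrow> lim (\<lambda>k. p k $ i $ j)" for i j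
    by (simp add: convergent_LIMSEQ_iff)
  define P where "P = (\<chi> i j. lim (\<lambda>k. p k $ i $ j))"
  have pP: "p \<longlonglongrightarrow> P"
    unfolding P_def by (intro vec_tendstoI) (simp add: lims)
  have "p k $ i $ j = p k $ j $ i" for i j k
    by (rule sym_mat_nth [OF sym])
  then have symP: "sym_mat P" by (simp add: sym_mat_def P_def transpose_def vec_eq_iff)
  have qP: "(\<lambda>k. qf (p k) x) \<longlonglongrightarrow> qf P x" for x
    by (rule bounded_linear.tendsto [OF bounded_linear_qf pP])
  have le: "qf (p k) x \<le> qf P x" for k x
    using incseq_le [OF incseq_SucI, of "\<lambda>k. qf (p k) x"] mono qP by blast
  have nP: "0 \<le> qf P x" for x using le nonneg order_trans by blast
  have "qf (Ric P) x = qf P x" for x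
  proof (rule order.antisym)
    show "qf P x \<le> qf (Ric P) x"
    proof (rule LIMSEQ_le_const2 [OF LIMSEQ_Suc [OF qP]])
      show "\<exists>N. \<forall>n\<ge>N. qf (p (Suc n)) x \<le> qf (Ric P) x"
        unfolding pSuc using Ric_mono [OF sym nonneg symP nP le] by blast
    qed
    obtain s where s: "0 < s" "\<And>u. s * (u \<bullet> u) \<le> qf R u" using pos_def_coercive [OF R] by blast
    define D where "D = 2 * ((A *v x) \<bullet> (A *v x)) + 2 * ((norm B)\<^sup>2 * (qf P x / s))"
    have "qf (Ric P) x \<le> qf P x + norm (P - p k) * D" for k
    proof -
      define u where "u = - (Gain (p k) *v x)"
      have Ju: "J (p k) x u = qf (p (Suc k)) x" unfolding u_def pSuc by (rule Ric_eq_J [OF sym nonneg, symmetric])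
      have "s * (u \<bullet> u) \<le> J (p k) x u"
        using s(2) [of u] pos_def_qf_nonneg [OF S, of x] J_ge_cost [OF nonneg [where k = k], of x u] by (simp add: cost_def)
      also have "\<dots> \<le> qf P x" unfolding Ju by (rule le)
      finally have "u \<bullet> u \<le> qf P x / s" using s(1) by (simp add: field_simps)
      then have "(B *v u) \<bullet> (B *v u) \<le> (norm B)\<^sup>2 * (qf P x / s)"
        using inner_matrix_vector_self_le [of B u] by (meson mult_left_mono order_trans zero_le_power2)
      then have D: "(A *v x + B *v u) \<bullet> (A *v x + B *v u) \<le> D"
        unfolding D_def using abs_inner_self_add_le [of "A *v x" "B *v u"] by linarith
      have "qf (Ric P) x \<le> J P x u" by (rule Ric_le_J [OF symP nP])
      also have "\<dots> = J (p k) x u + qf (P - p k) (A *v x + B *v u)" by (simp add: J_def qf_simps)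
      also have "\<dots> \<le> qf P x + norm (P - p k) * D"
        unfolding Ju using abs_qf_le [of "P - p k" "A *v x + B *v u"] le [of "Suc k" x]
          mult_left_mono [OF D, of "norm (P - p k)"] by simp
      finally show ?thesis .
    qed
    moreover have "(\<lambda>k. qf P x + norm (P - p k) * D) \<longlonglongrightarrow> qf P x + norm (P - P) * D"
      by (intro tendsto_intros pP)
    ultimately show "qf (Ric P) x \<le> qf P x" by (intro LIMSEQ_le_const [of _ "qf P x"]) auto
  qed
  then have ric: "Ric P = P" by (intro qf_eqI Ric_sym symP nP)
  have "0 < qf P x" if "x \<noteq> 0" for x
    using pos_def_qf_pos [OF S that] cost_ge_S [of x] J_ge_cost [OF nP, of x] Ric_eq_J [OF symP nP, of x]
    unfolding ric by (metis order_less_le_trans order_trans)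
  with symP have "pos_def P" by (simp add: pos_def_def qf_def)
  with ric show ?thesis by blast
qed

context
  fixes P :: "real^'n^'n"
  assumes P: "pos_def P" "Ric P = P"
begin

lemma riccati_bellman: "J P x (- (Gain P *v x)) = qf P x"
  using Ric_eq_J [OF pos_def_imp_sym [OF P(1)] pos_def_qf_nonneg [OF P(1)], of x] by (simp add: P(2))

lemma riccati_le_J: "qf P x \<le> J P x u"
  using Ric_le_J [OF pos_def_imp_sym [OF P(1)] pos_def_qf_nonneg [OF P(1)], of x] by (simp add: P(2))

lemma riccati_gain_stabilizing: "stabilizing A B (Gain P)"
  by (rule stabilizing_if_lyapunov [OF pos_def_imp_sym [OF P(1)] pos_def_qf_nonneg [OF P(1)]])
     (simp add: riccati_bellman)

lemma Pc_riccati_gain_le: "qf (Pc (Gain P)) x \<le> qf P x"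
  by (rule Pc_le [OF riccati_gain_stabilizing]) (simp add: riccati_bellman)

lemma riccati_le_Pc: "stabilizing A B K \<Longrightarrow> qf P x \<le> qf (Pc K) x"
  by (rule Pc_ge) (simp_all add: riccati_le_J)

end

text \<open>
  A Riccati solution is at most the cost of every stabilizing gain, in particular that of the gain of another
  solution.  By symmetry the solution is unique.
\<close>

lemma riccati_le:
  assumes "pos_def P" "Ric P = P" "pos_def Q" "Ric Q = Q"
  shows "qf P x \<le> qf Q x"
  using riccati_le_Pc [OF assms(1,2) riccati_gain_stabilizing [OF assms(3,4)]]
    Pc_riccati_gain_le [OF assms(3,4)] by (rule order_trans)

lemma opt_cost_riccati:
  assumes "stabilizing A B K"
  shows "pos_def (opt_cost A B S R)" "Ric (opt_cost A B S R) = opt_cost A B S R"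
proof -
  obtain P where P: "pos_def P" "Ric P = P" using riccati_exists [OF assms] by blast
  have eq: "transpose A ** X ** A - X
       - transpose A ** X ** B ** matrix_inv (R + transpose B ** X ** B) ** transpose B ** X ** A
       + S = 0 \<longleftrightarrow> Ric X = X" for X
    unfolding Ric_def Mu_def by (auto simp: algebra_simps)
  have "opt_cost A B S R = P" unfolding opt_cost_def eq
  proof (rule the_equality)
    fix X assume X: "pos_def X \<and> Ric X = X"
    show "X = P"
      by (rule qf_eqI) (use P X riccati_le order.antisym in \<open>auto simp: pos_def_imp_sym intro!: order.antisym\<close>)
  qed (use P in blast)
  with P show "pos_def (opt_cost A B S R)" "Ric (opt_cost A B S R) = opt_cost A B S R" by simp_all
qed

end

section \<open>Block matrices and greedy gains\<close>

lemma sum_UNIV_Plus: "(\<Sum>i\<in>UNIV. f i) = (\<Sum>a\<in>UNIV. f (Inl a)) + (\<Sum>b\<in>UNIV. f (Inr b))"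
  for f :: "'a::finite + 'b::finite \<Rightarrow> 'c::comm_monoid_add"
  unfolding UNIV_Plus_UNIV [symmetric] by (subst sum.Plus) (simp_all add: o_def)

lemma vappend_simps [simp]: "vappend x y $ Inl a = x $ a" "vappend x y $ Inr b = y $ b"
  by (simp_all add: vappend_def)

lemma vappend_add: "vappend x y + vappend x' y' = vappend (x + x') (y + y')"
  unfolding vec_eq_iff by (auto simp: vappend_def split: sum.split)

lemma inner_vappend: "vappend x y \<bullet> vappend x' y' = x \<bullet> x' + y \<bullet> y'"
  by (simp add: inner_vec_def sum_UNIV_Plus)

lemma inner_vappend_zero_left:
  "vappend 0 d \<bullet> (Q *v vappend x u) = d \<bullet> (block_ll Q *v x + block_lr Q *v u)"
  by (simp add: inner_vec_def sum_UNIV_Plus matrix_vector_mult_def block_ll_def block_lr_def)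

lemma qf_Hop: "qf (Hop Q K) x = qf Q (vappend x (- (K *v x)))"
proof -
  have "transpose (hcat (mat 1) (- transpose K)) *v x = vappend x (- (K *v x))"
    unfolding vec_eq_iff
    by (auto simp: vappend_def hcat_def transpose_def matrix_vector_mult_def mat_def sum_negf
        if_distrib if_distribR split: sum.split cong: if_cong)
  then show ?thesis
    using qf_congruence [of "transpose (hcat (mat 1) (- transpose K))" Q x]
    by (simp add: Hop_def transpose_transpose)
qed

lemma sym_mat_Hop: "sym_mat Q \<Longrightarrow> sym_mat (Hop Q K)"
  using sym_mat_simps(6) [of Q "transpose (hcat (mat 1) (- transpose K))"]
  by (simp add: Hop_def transpose_transpose)

definition greedy :: "real^('n::finite + 'm::finite)^('n + 'm) \<Rightarrow> real^'n^'m" where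
  "greedy Q = matrix_inv (block_lr Q) ** block_ll Q"

text \<open>
  At the greedy input the gradient of \<open>qf Q\<close> in the direction of the input vanishes, and \<open>qf Q\<close> is convex there.
\<close>

lemma greedy_minimizes:
  assumes Q: "sym_mat Q" and pos: "\<And>u. u \<noteq> 0 \<Longrightarrow> 0 < qf Q (vappend 0 u)"
  shows "qf Q (vappend x (- (greedy Q *v x))) \<le> qf Q (vappend x u)"
proof -
  have lr: "qf Q (vappend 0 u) = qf (block_lr Q) u" for u
    by (simp add: qf_def inner_vappend_zero_left)
  have "block_lr Q $ i $ j = block_lr Q $ j $ i" for i j
    using sym_mat_nth [OF Q] by (simp add: block_lr_def)
  then have "sym_mat (block_lr Q)" by (simp add: sym_mat_def transpose_def vec_eq_iff)
  then have pd: "pos_def (block_lr Q)" using pos lr by (simp add: pos_def_def qf_def)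
  define v where "v = - (greedy Q *v x)"
  define d where "d = u - v"
  have "block_lr Q *v v = - (block_ll Q *v x)"
    using matrix_inv_inverse(1) [OF pos_def_invertible [OF pd]]
      matrix_vector_mult_diff_distrib [of "block_lr Q" 0 "greedy Q *v x"]
    by (simp add: v_def greedy_def matrix_vector_mul_assoc matrix_mul_assoc)
  then have "vappend 0 d \<bullet> (Q *v vappend x v) = 0" by (simp add: inner_vappend_zero_left)
  moreover have "vappend x u = vappend x v + vappend 0 d" by (simp add: vappend_add d_def)
  moreover have "0 \<le> qf Q (vappend 0 d)" unfolding lr by (rule pos_def_qf_nonneg [OF pd])
  ultimately show ?thesis
    unfolding v_def [symmetric]
    by (simp add: qf_add [OF Q] sym_mat_inner [OF Q, of "vappend x v"])
qed

section \<open>Policy iteration with an inaccurate Q-function\<close>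

context lq_problem
begin

text \<open>
  The only property of the estimated Q-functions that policy iteration needs: \<open>Qh P\<close> approximates the Q-function
  of \<open>P\<close>, with an error proportional to the size of \<open>P\<close>.
\<close>

definition accurate :: "real \<Rightarrow> (real^'n^'n \<Rightarrow> real^('n + 'm)^('n + 'm)) \<Rightarrow> bool" where
  "accurate \<delta> Qh \<longleftrightarrow> (\<forall>P. sym_mat P \<longrightarrow> sym_mat (Qh P) \<and>
     (\<forall>x u. \<bar>qf (Qh P) (vappend x u) - J P x u\<bar> \<le> \<delta> * norm P * (x \<bullet> x + u \<bullet> u)))"

text \<open>
  This is \<open>Phat\<close> with the least-squares fit replaced by an arbitrary estimate \<open>Qh\<close> of the Q-function.
\<close>

primrec evaluate :: "(real^'n^'n \<Rightarrow> real^('n + 'm)^('n + 'm)) \<Rightarrow> real^'n^'m \<Rightarrow> nat \<Rightarrow> real^'n^'n" where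
  "evaluate Qh K 0 = 0"
| "evaluate Qh K (Suc j) = Hop (Qh (evaluate Qh K j)) K"

lemma cost_coercive:
  obtains \<mu> where "0 < \<mu>" "\<And>x u. \<mu> * (x \<bullet> x + u \<bullet> u) \<le> cost x u"
proof -
  obtain s where s: "0 < s" "\<And>x. s * (x \<bullet> x) \<le> qf S x" using pos_def_coercive [OF S] by blast
  obtain r where r: "0 < r" "\<And>x. r * (x \<bullet> x) \<le> qf R x" using pos_def_coercive [OF R] by blast
  show thesis
  proof
    show "0 < min s r" using s r by simp
    fix x :: "real^'n" and u :: "real^'m"
    have "min s r * (x \<bullet> x) \<le> s * (x \<bullet> x)" "min s r * (u \<bullet> u) \<le> r * (u \<bullet> u)"
      by (intro mult_right_mono; simp)+
    then show "min s r * (x \<bullet> x + u \<bullet> u) \<le> cost x u"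
      unfolding cost_def distrib_left using s(2) [of x] r(2) [of u] by linarith
  qed
qed

context
  fixes Ps :: "real^'n^'n" and \<kappa> :: real
  assumes Ps: "pos_def Ps" "Ric Ps = Ps"
    and \<kappa>: "1 \<le> \<kappa>" "\<And>x. qf Ps x \<le> \<kappa> * qf S x"
begin

text \<open>
  Along the optimal closed loop the cost-to-go drops by the running cost, which is at least \<open>qf Ps x / \<kappa>\<close>.
\<close>

lemma optimal_gain_contraction:
  "qf Ps ((A - B ** Gain Ps) *v x) \<le> (1 - 1 / \<kappa>) * qf Ps x"
proof -
  have "qf Ps x = qf Ps ((A - B ** Gain Ps) *v x) + cost x (- (Gain Ps *v x))"
    using riccati_bellman [OF Ps, of x] unfolding J_feedback by simp
  moreover have "qf Ps x / \<kappa> \<le> cost x (- (Gain Ps *v x))"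
    using \<kappa>(2) [of x] \<kappa>(1) cost_ge_S [of x "- (Gain Ps *v x)"]
    by (simp add: field_simps) (meson mult_left_mono order_trans zero_le_one)
  moreover have "(1 - 1 / \<kappa>) * qf Ps x = qf Ps x - qf Ps x / \<kappa>" by (simp add: left_diff_distrib)
  ultimately show ?thesis by linarith
qed

text \<open>
  Measured relative to \<open>Pc K\<close>, one exact sweep shrinks the error by the factor \<open>q\<close>, because the running cost is at least
  \<open>qf (Pc K) x / (\<tau> * \<kappa>)\<close>, and the inaccuracy of \<open>Qh\<close> adds at most \<open>d\<close>.  Starting from the relative error 1 at
  \<open>evaluate Qh K 0 = 0\<close>, the error after \<open>j\<close> sweeps is at most \<open>q ^ j + \<tau> * \<kappa> * d\<close>.
\<close>

lemma evaluation_accuracy: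
  fixes L N \<mu> :: real
  assumes L: "0 \<le> L" "\<And>x u. qf Ps (A *v x + B *v u) \<le> L * cost x u"
    and N: "0 \<le> N" "\<And>P t. sym_mat P \<Longrightarrow> (\<And>x. \<bar>qf P x\<bar> \<le> t * qf Ps x) \<Longrightarrow> norm P \<le> N * t"
    and \<mu>: "0 < \<mu>" "\<And>x u. \<mu> * (x \<bullet> x + u \<bullet> u) \<le> cost x u"
    and K: "stabilizing A B K" and bd: "\<And>x. qf (Pc K) x \<le> \<tau> * qf Ps x" and \<tau>: "1 \<le> \<tau>"
    and Qh: "accurate \<delta> Qh" and \<delta>: "0 \<le> \<delta>"
    and d: "d = 3 * N * \<tau> * \<delta> / \<mu>" "\<tau> * \<kappa> * d \<le> 1"
  defines "q \<equiv> 1 - 1 / (\<tau> * \<kappa>)"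
  shows "sym_mat (evaluate Qh K T)"
    and "\<bar>qf (Qh (evaluate Qh K T)) (vappend x u) - J (Pc K) x u\<bar>
         \<le> ((q ^ T + \<tau> * \<kappa> * d) * \<tau> * L + d) * cost x u"
proof -
  let ?k = "\<tau> * \<kappa>"
  have k1: "1 \<le> ?k" using \<tau> \<kappa>(1) mult_mono [of 1 \<tau> 1 \<kappa>] by simp
  have q01: "0 \<le> q" "q \<le> 1" using k1 by (simp_all add: q_def)
  have dnn: "0 \<le> d" using d(1) N(1) \<tau> \<delta> \<mu>(1) by simp
  define e where "e j = q ^ j + ?k * d" for j
  have e2: "0 \<le> e j" "e j \<le> 2" for j
    using q01 power_le_one [of q j] zero_le_power [of q j] d(2) k1 dnn by (auto simp: e_def)
  have Pnn: "0 \<le> qf (Pc K) x" for x by (rule Pc_nonneg [OF K])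
  have Psnn: "0 \<le> qf Ps x" for x by (rule pos_def_qf_nonneg [OF Ps(1)])
  have Pk: "qf (Pc K) x \<le> ?k * cost x u" for x u
  proof -
    have "qf (Pc K) x \<le> \<tau> * (\<kappa> * qf S x)"
      using bd [of x] mult_left_mono [OF \<kappa>(2) [of x], of \<tau>] \<tau> by linarith
    also have "\<dots> \<le> ?k * cost x u"
      using mult_left_mono [OF cost_ge_S [of x u], of ?k] k1 by simp
    finally show ?thesis .
  qed
  have inv: "sym_mat (evaluate Qh K j) \<and> (\<forall>x. \<bar>qf (evaluate Qh K j) x - qf (Pc K) x\<bar> \<le> e j * qf (Pc K) x)"
    and err: "sym_mat (evaluate Qh K j) \<Longrightarrow> (\<forall>x. \<bar>qf (evaluate Qh K j) x - qf (Pc K) x\<bar> \<le> e j * qf (Pc K) x)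
      \<Longrightarrow> \<bar>qf (Qh (evaluate Qh K j)) (vappend x u) - J (evaluate Qh K j) x u\<bar> \<le> d * cost x u" for j x u
  proof -
    show err: "\<bar>qf (Qh (evaluate Qh K j)) (vappend x u) - J (evaluate Qh K j) x u\<bar> \<le> d * cost x u"
      if 1: "sym_mat (evaluate Qh K j)" and 2: "\<forall>x. \<bar>qf (evaluate Qh K j) x - qf (Pc K) x\<bar> \<le> e j * qf (Pc K) x"
      for j x u
    proof -
      let ?P = "evaluate Qh K j"
      have "\<bar>qf ?P x\<bar> \<le> 3 * \<tau> * qf Ps x" for x
      proof -
        have "\<bar>qf ?P x\<bar> \<le> e j * qf (Pc K) x + qf (Pc K) x" using 2 [rule_format, of x] Pnn [of x] by linarith
        also have "\<dots> \<le> 3 * qf (Pc K) x" using mult_right_mono [OF e2(2) Pnn [of x], of j] by linarith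
        also have "\<dots> \<le> 3 * \<tau> * qf Ps x" using bd [of x] by simp
        finally show ?thesis .
      qed
      then have nP: "norm ?P \<le> N * (3 * \<tau>)" by (rule N(2) [OF 1])
      have "\<bar>qf (Qh ?P) (vappend x u) - J ?P x u\<bar> \<le> \<delta> * norm ?P * (x \<bullet> x + u \<bullet> u)"
        using Qh 1 unfolding accurate_def by blast
      also have "\<dots> \<le> \<delta> * (N * (3 * \<tau>)) * (x \<bullet> x + u \<bullet> u)"
        using nP \<delta> by (intro mult_right_mono mult_left_mono) auto
      also have "\<dots> = d * (\<mu> * (x \<bullet> x + u \<bullet> u))" using \<mu>(1) by (simp add: d(1))
      also have "\<dots> \<le> d * cost x u" by (intro mult_left_mono \<mu> dnn)
      finally show ?thesis .
    qed
    show "sym_mat (evaluate Qh K j) \<and> (\<forall>x. \<bar>qf (evaluate Qh K j) x - qf (Pc K) x\<bar> \<le> e j * qf (Pc K) x)"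
    proof (induction j)
      case 0
      have "1 \<le> e 0" using k1 dnn by (simp add: e_def)
      from mult_right_mono [OF this Pnn] show ?case
        using Pnn by (simp add: sym_mat_simps qf_simps)
    next
      case (Suc j)
      let ?P = "evaluate Qh K j"
      show ?case
      proof (intro conjI allI)
        show "sym_mat (evaluate Qh K (Suc j))"
          using Suc Qh unfolding accurate_def by (simp add: sym_mat_Hop)
        fix x
        let ?u = "- (K *v x)"
        let ?y = "(A - B ** K) *v x"
        have "qf (evaluate Qh K (Suc j)) x = qf (Qh ?P) (vappend x ?u)" by (simp add: qf_Hop)
        moreover have "\<bar>qf (Qh ?P) (vappend x ?u) - J ?P x ?u\<bar> \<le> d * cost x ?u"
          using Suc by (intro err) auto
        moreover have "\<bar>J ?P x ?u - qf (Pc K) x\<bar> \<le> e j * qf (Pc K) ?y"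
          unfolding Pc_eq [OF K, of x] J_feedback using Suc by simp
        moreover have P: "qf (Pc K) x = qf (Pc K) ?y + cost x ?u"
          using Pc_eq [OF K, of x] unfolding J_feedback .
        moreover have c: "qf (Pc K) x / ?k \<le> cost x ?u" using Pk [of x ?u] k1 by (simp add: field_simps)
        have "d * cost x ?u \<le> d * qf (Pc K) x"
          using dnn P Pnn [of ?y] by (intro mult_left_mono) auto
        moreover have "e j * qf (Pc K) ?y \<le> e j * (q * qf (Pc K) x)"
        proof (intro mult_left_mono e2)
          have "q * qf (Pc K) x = qf (Pc K) x - qf (Pc K) x / ?k" by (simp add: q_def left_diff_distrib)
          with P c show "qf (Pc K) ?y \<le> q * qf (Pc K) x" by linarith
        qed
        moreover have "e j * q + d = e (Suc j)"
        proof -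
          have "?k \<noteq> 0" using k1 by linarith
          then have kq: "?k * q = ?k - 1" by (simp add: q_def right_diff_distrib)
          have "e j * q + d = q ^ Suc j + (?k * q) * d + d" by (simp add: e_def algebra_simps)
          then show ?thesis unfolding kq by (simp add: e_def algebra_simps)
        qed
        then have "e j * (q * qf (Pc K) x) + d * qf (Pc K) x = e (Suc j) * qf (Pc K) x"
          by (metis distrib_right mult.assoc)
        ultimately show "\<bar>qf (evaluate Qh K (Suc j)) x - qf (Pc K) x\<bar> \<le> e (Suc j) * qf (Pc K) x"
          by linarith
      qed
    qed
  qed
  let ?P = "evaluate Qh K T"
  let ?y = "A *v x + B *v u"
  show "sym_mat ?P" using inv by blast
  have "\<bar>qf (Qh ?P) (vappend x u) - J ?P x u\<bar> \<le> d * cost x u" using inv by (intro err) auto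
  moreover have "\<bar>J ?P x u - J (Pc K) x u\<bar> \<le> e T * qf (Pc K) ?y"
    using inv [of T] by (simp add: J_def)
  moreover have "e T * qf (Pc K) ?y \<le> e T * (\<tau> * (L * cost x u))"
    using bd [of ?y] mult_left_mono [OF L(2) [of x u], of \<tau>] \<tau> by (intro mult_left_mono e2) linarith
  ultimately show "\<bar>qf (Qh ?P) (vappend x u) - J (Pc K) x u\<bar> \<le> ((q ^ T + ?k * d) * \<tau> * L + d) * cost x u"
    unfolding e_def [symmetric] distrib_right by (simp add: mult_ac)
qed

text \<open>
  The greedy gain is optimal for the Q-function of \<open>Pc K\<close> up to the factor \<open>\<beta>\<close>.  Let \<open>V\<close> be the cost of one
  step with the greedy gain followed by \<open>K\<close>.  Comparison with the input of \<open>K\<close> gives \<open>V \<le> \<beta> * Pc K\<close>, so a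
  slightly larger multiple \<open>a * V\<close> is a Lyapunov function for the greedy gain and bounds its cost.  Comparison with
  the optimal input bounds \<open>V\<close> by \<open>\<beta> * (1 + (1 - 1 / \<kappa>) * (\<tau> - 1)) * Ps\<close>.
\<close>

lemma improvement:
  assumes K: "stabilizing A B K" and bd: "\<And>x. qf (Pc K) x \<le> \<tau> * qf Ps x" and \<tau>: "1 \<le> \<tau>" "\<tau> \<le> \<tau>0"
    and Q: "sym_mat Q" "\<And>x u. \<bar>qf Q (vappend x u) - J (Pc K) x u\<bar> \<le> \<zeta> * cost x u"
    and \<zeta>: "0 \<le> \<zeta>" "\<zeta> < 1" and \<beta>: "\<beta> = (1 + \<zeta>) / (1 - \<zeta>)"
    and a: "(\<beta> - 1) * (\<beta> * \<tau>0 * \<kappa>) < 1" "a = 1 / (1 - (\<beta> - 1) * (\<beta> * \<tau>0 * \<kappa>))"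
  shows "stabilizing A B (greedy Q)"
    and "qf (Pc (greedy Q)) x \<le> a * \<beta> * (1 + (1 - 1 / \<kappa>) * (\<tau> - 1)) * qf Ps x"
proof -
  define K' where "K' = greedy Q"
  define g where "g x = - (K' *v x)" for x
  let ?F = "A - B ** K'"
  let ?k = "\<beta> * \<tau>0 * \<kappa>"
  have \<beta>1: "1 \<le> \<beta>" using \<zeta> by (simp add: \<beta> field_simps)
  have k0: "0 \<le> ?k" using \<beta>1 \<tau> \<kappa>(1) by simp
  have "0 \<le> (\<beta> - 1) * ?k" by (rule mult_nonneg_nonneg) (use k0 \<beta>1 in auto)
  then have a1: "1 \<le> a" using a by (simp add: le_divide_eq)
  have Pnn: "0 \<le> qf (Pc K) x" for x by (rule Pc_nonneg [OF K])
  have Psnn: "0 \<le> qf Ps x" for x by (rule pos_def_qf_nonneg [OF Ps(1)])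
  have lower: "(1 - \<zeta>) * J (Pc K) x u \<le> qf Q (vappend x u)" for x u
    using Q(2) [of x u] mult_left_mono [OF J_ge_cost [OF Pnn, of x u] \<zeta>(1)] by (simp add: algebra_simps)
  have upper: "qf Q (vappend x u) \<le> (1 + \<zeta>) * J (Pc K) x u" for x u
    using Q(2) [of x u] mult_left_mono [OF J_ge_cost [OF Pnn, of x u] \<zeta>(1)] by (simp add: algebra_simps)
  have min: "J (Pc K) x (g x) \<le> \<beta> * J (Pc K) x u" for x u
  proof -
    have "qf Q (vappend x (g x)) \<le> qf Q (vappend x u)"
      unfolding g_def K'_def
    proof (rule greedy_minimizes [OF Q(1)])
      fix u :: "real^'m" assume "u \<noteq> 0"
      then have "0 < qf R u" by (rule pos_def_qf_pos [OF R])
      also have "\<dots> \<le> J (Pc K) 0 u" using J_ge_cost [OF Pnn, of 0 u] by (simp add: cost_def)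
      finally show "0 < qf Q (vappend 0 u)"
        using lower [of 0 u] \<zeta>(2) by (meson diff_gt_0_iff_gt mult_pos_pos order_less_le_trans)
    qed
    then have "(1 - \<zeta>) * J (Pc K) x (g x) \<le> (1 + \<zeta>) * J (Pc K) x u"
      using lower [of x "g x"] upper [of x u] by linarith
    then show ?thesis using \<zeta> by (simp add: \<beta> field_simps)
  qed
  define V where "V = transpose ?F ** Pc K ** ?F + S + transpose K' ** R ** K'"
  have V: "qf V x = J (Pc K) x (g x)" for x
    unfolding V_def g_def J_feedback by (simp add: qf_simps qf_congruence cost_def)
  have V': "qf V x = qf (Pc K) (?F *v x) + cost x (g x)" for x
    unfolding V g_def J_feedback ..
  have symV: "sym_mat V"
    unfolding V_def using Pc_sym [OF K] S R by (intro sym_mat_simps) (simp_all add: pos_def_imp_sym)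
  have Vnn: "0 \<le> qf V x" for x unfolding V' using Pnn cost_nonneg by (simp add: add_nonneg_nonneg)
  have V_P: "qf V x \<le> \<beta> * qf (Pc K) x" for x
    using min [of x "- (K *v x)"] unfolding V Pc_eq [OF K, of x] .
  have V_c: "qf V x \<le> ?k * cost x u" for x u
  proof -
    have "qf V x \<le> \<beta> * (\<tau> * qf Ps x)"
      using V_P [of x] mult_left_mono [OF bd [of x], of \<beta>] \<beta>1 by linarith
    also have "\<dots> \<le> \<beta> * (\<tau>0 * (\<kappa> * cost x u))"
    proof (intro mult_left_mono mult_mono)
      show "qf Ps x \<le> \<kappa> * cost x u"
        using \<kappa>(2) [of x] mult_left_mono [OF cost_ge_S [of x u], of \<kappa>] \<kappa>(1) by linarith
    qed (use \<beta>1 \<tau> Psnn in auto)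
    finally show ?thesis by (simp add: mult_ac)
  qed
  have V_Ps: "qf V x \<le> \<beta> * ((1 + (1 - 1 / \<kappa>) * (\<tau> - 1)) * qf Ps x)" for x
  proof -
    let ?G = "Gain Ps"
    let ?y = "(A - B ** ?G) *v x"
    have "qf V x \<le> \<beta> * J (Pc K) x (- (?G *v x))" unfolding V by (rule min)
    also have "\<dots> \<le> \<beta> * ((1 + (1 - 1 / \<kappa>) * (\<tau> - 1)) * qf Ps x)"
    proof (rule mult_left_mono)
      have "J (Pc K) x (- (?G *v x)) \<le> \<tau> * qf Ps ?y + cost x (- (?G *v x))"
        unfolding J_feedback using bd by simp
      also have "\<dots> = (\<tau> - 1) * qf Ps ?y + qf Ps x"
        using riccati_bellman [OF Ps, of x] unfolding J_feedback by (simp add: algebra_simps)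
      also have "\<dots> \<le> (\<tau> - 1) * ((1 - 1 / \<kappa>) * qf Ps x) + qf Ps x"
        using \<tau> by (intro add_right_mono mult_left_mono optimal_gain_contraction) auto
      finally show "J (Pc K) x (- (?G *v x)) \<le> (1 + (1 - 1 / \<kappa>) * (\<tau> - 1)) * qf Ps x"
        by (simp add: algebra_simps)
    qed (use \<beta>1 in simp)
    finally show ?thesis .
  qed
  \<comment> \<open>The factor \<open>a\<close> pays for the factor \<open>\<beta>\<close>: scaling up leaves
    the running cost unscaled, and the gain \<open>(a - 1) * cost\<close> exceeds the loss \<open>a * (\<beta> -
    1) * V\<close>, as \<open>V\<close> is bounded by the running cost.\<close>
  define X where "X = a *\<^sub>R V"
  have X: "J X x (- (K' *v x)) \<le> qf X x" for x
  proof -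
    let ?c = "cost x (g x)"
    have "qf V (?F *v x) \<le> \<beta> * (qf V x - ?c)" using V_P [of "?F *v x"] V' [of x] by simp
    then have "a * qf V (?F *v x) \<le> a * (\<beta> * (qf V x - ?c))" using a1 by (intro mult_left_mono) auto
    moreover have "a * (\<beta> - 1) * qf V x \<le> (a - 1) * ?c"
    proof -
      have "a * (\<beta> - 1) * qf V x \<le> a * (\<beta> - 1) * (?k * ?c)"
        using a1 \<beta>1 by (intro mult_left_mono V_c) auto
      also have "a * (\<beta> - 1) * ?k = a - 1" using a by (simp add: field_simps)
      then have "a * (\<beta> - 1) * (?k * ?c) = (a - 1) * ?c" by (metis mult.assoc)
      finally show ?thesis .
    qed
    moreover have "(a - 1) * ?c \<le> (a * \<beta> - 1) * ?c"
      using a1 \<beta>1 cost_nonneg by (intro mult_right_mono) (simp_all add: mult_le_cancel_left1)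
    ultimately show ?thesis
      unfolding J_feedback X_def qf_simps by (simp add: g_def algebra_simps)
  qed
  have symX: "sym_mat X" unfolding X_def by (intro sym_mat_simps symV)
  have Xnn: "0 \<le> qf X x" for x unfolding X_def qf_simps using a1 Vnn by simp
  show st: "stabilizing A B (greedy Q)"
    using stabilizing_if_lyapunov [OF symX Xnn X] unfolding K'_def .
  have "qf (Pc (greedy Q)) x \<le> qf X x" using Pc_le [OF st] X unfolding K'_def .
  also have "\<dots> \<le> a * (\<beta> * ((1 + (1 - 1 / \<kappa>) * (\<tau> - 1)) * qf Ps x))"
    unfolding X_def qf_simps using a1 by (intro mult_left_mono V_Ps) auto
  finally show "qf (Pc (greedy Q)) x \<le> a * \<beta> * (1 + (1 - 1 / \<kappa>) * (\<tau> - 1)) * qf Ps x"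
    by (simp add: mult_ac)
qed

end

definition improve_step :: "(real^'n^'n \<Rightarrow> real^('n + 'm)^('n + 'm)) \<Rightarrow> nat \<Rightarrow> real^'n^'m \<Rightarrow> real^'n^'m" where
  "improve_step Qh T K = greedy (Qh (evaluate Qh K T))"

text \<open>
  The invariant is \<open>Pc (K i) \<le> (1 + t i) * Ps\<close>, where \<open>t i\<close> solves \<open>t (i + 1) = \<nu> + \<theta>' * t i\<close>.  All constants are
  chosen for the largest value \<open>\<tau>\<close> that \<open>1 + t i\<close> can reach, so that one choice of \<open>T0\<close> and \<open>\<delta>\<close> serves all
  iterations.
\<close>

theorem robust_policy_iteration:
  assumes K1: "stabilizing A B K1" and \<epsilon>: "0 < \<epsilon>"
  shows "\<exists>T0. \<exists>\<delta>>0. \<forall>Qh. accurate \<delta> Qh \<longrightarrow> (\<forall>T\<ge>T0.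
           (\<forall>i. stabilizing A B ((improve_step Qh T ^^ i) K1)) \<and>
           (\<forall>\<^sub>F i in sequentially.
              norm (Pc ((improve_step Qh T ^^ i) K1) - opt_cost A B S R) \<le> \<epsilon> / 2))"
proof -
  define Ps where "Ps = opt_cost A B S R"
  have Ps: "pos_def Ps" "Ric Ps = Ps" unfolding Ps_def by (rule opt_cost_riccati [OF K1])+
  have symPs: "sym_mat Ps" by (rule pos_def_imp_sym [OF Ps(1)])
  have Psnn: "0 \<le> qf Ps x" for x by (rule pos_def_qf_nonneg [OF Ps(1)])
  obtain s where s: "0 < s" "\<And>x. s * (x \<bullet> x) \<le> qf S x" using pos_def_coercive [OF S] by blast
  obtain p where p: "0 < p" "\<And>x. p * (x \<bullet> x) \<le> qf Ps x" using pos_def_coercive [OF Ps(1)] by blast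
  obtain \<mu> where \<mu>: "0 < \<mu>" "\<And>x u. \<mu> * (x \<bullet> x + u \<bullet> u) \<le> cost x u" using cost_coercive by blast

  define \<kappa> where "\<kappa> = max 1 (norm Ps / s)"
  have \<kappa>: "1 \<le> \<kappa>" "\<And>x. qf Ps x \<le> \<kappa> * qf S x"
  proof -
    show "1 \<le> \<kappa>" by (simp add: \<kappa>_def)
    fix x
    have "qf Ps x \<le> norm Ps * (x \<bullet> x)" using abs_qf_le [of Ps x] by simp
    also have "\<dots> = (norm Ps / s) * (s * (x \<bullet> x))" using s(1) by simp
    also have "\<dots> \<le> \<kappa> * qf S x"
      using s by (intro mult_mono s(2)) (auto simp: \<kappa>_def)
    finally show "qf Ps x \<le> \<kappa> * qf S x" .
  qed
  define \<theta> where "\<theta> = 1 - 1 / \<kappa>"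
  have \<theta>: "0 \<le> \<theta>" "\<theta> < 1" using \<kappa>(1) by (simp_all add: \<theta>_def)
  define L where "L = norm Ps * (2 * ((norm A)\<^sup>2 + (norm B)\<^sup>2)) / \<mu>"
  have L: "0 \<le> L" "\<And>x u. qf Ps (A *v x + B *v u) \<le> L * cost x u"
  proof -
    show "0 \<le> L" using \<mu>(1) by (simp add: L_def)
    fix x :: "real^'n" and u :: "real^'m"
    have "(A *v x + B *v u) \<bullet> (A *v x + B *v u) \<le> 2 * ((norm A)\<^sup>2 * (x \<bullet> x)) + 2 * ((norm B)\<^sup>2 * (u \<bullet> u))"
      using abs_inner_self_add_le [of "A *v x" "B *v u"] inner_matrix_vector_self_le [of A x]
        inner_matrix_vector_self_le [of B u] by linarith
    also have "\<dots> \<le> 2 * ((norm A)\<^sup>2 + (norm B)\<^sup>2) * (x \<bullet> x + u \<bullet> u)"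
      by (simp add: algebra_simps)
    finally have "norm Ps * ((A *v x + B *v u) \<bullet> (A *v x + B *v u))
        \<le> norm Ps * (2 * ((norm A)\<^sup>2 + (norm B)\<^sup>2) * (x \<bullet> x + u \<bullet> u))"
      by (intro mult_left_mono) auto
    also have "\<dots> = L * (\<mu> * (x \<bullet> x + u \<bullet> u))" using \<mu>(1) by (simp add: L_def)
    also have "\<dots> \<le> L * cost x u" using \<open>0 \<le> L\<close> by (intro mult_left_mono \<mu>)
    finally show "qf Ps (A *v x + B *v u) \<le> L * cost x u"
      using abs_qf_le [of Ps "A *v x + B *v u"] by linarith
  qed
  \<comment> \<open>The summand 1 only keeps \<open>N\<close> away from 0, since \<open>\<delta>\<close> is defined below by a division by \<open>N\<close>.\<close>
  define N where "N = 3 * (real CARD('n))\<^sup>2 * norm Ps + 1"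
  have N0: "0 < N" unfolding N_def by (intro add_nonneg_pos) auto
  have N: "norm P \<le> N * t" if "sym_mat P" "\<And>x. \<bar>qf P x\<bar> \<le> t * qf Ps x" for P t
  proof -
    have "axis undefined 1 \<noteq> (0 :: real^'n)" by (simp add: axis_eq_0_iff)
    then have "0 < qf Ps (axis undefined 1)" by (rule pos_def_qf_pos [OF Ps(1)])
    then have t: "0 \<le> t"
      using that(2) [of "axis undefined 1"] by (meson abs_ge_zero order_trans zero_le_mult_iff not_less)
    have "\<bar>qf P x\<bar> \<le> (t * norm Ps) * (x \<bullet> x)" for x
      using that(2) [of x] mult_left_mono [OF order_trans [OF abs_ge_self abs_qf_le [of Ps x]] t]
      by (simp add: mult_ac)
    from norm_le_qf [OF that(1) this] show "norm P \<le> N * t" using t by (simp add: N_def algebra_simps)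
  qed

  define t0 where "t0 = norm (Pc K1) / p"
  have t0: "0 \<le> t0" using p by (simp add: t0_def)
  have start: "qf (Pc K1) x \<le> (1 + t0) * qf Ps x" for x
  proof -
    have "qf (Pc K1) x \<le> norm (Pc K1) * (x \<bullet> x)" using abs_qf_le [of "Pc K1" x] by simp
    also have "\<dots> = t0 * (p * (x \<bullet> x))" using p(1) by (simp add: t0_def)
    also have "\<dots> \<le> t0 * qf Ps x" by (intro mult_left_mono p t0)
    also have "\<dots> \<le> (1 + t0) * qf Ps x" using Psnn by (intro mult_right_mono) auto
    finally show ?thesis .
  qed
  define \<tau> where "\<tau> = t0 + 2"
  have \<tau>: "1 \<le> \<tau>" using t0 by (simp add: \<tau>_def)
  \<comment> \<open>Room between \<open>\<theta>\<close> and 1, to absorb the factor \<open>1 +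
    \<nu>\<close>.\<close>
  define \<theta>' where "\<theta>' = (1 + \<theta>) / 2"
  have \<theta>': "0 < \<theta>'" "\<theta>' < 1" "\<theta> < \<theta>'" using \<theta> by (simp_all add: \<theta>'_def)

  have "\<forall>\<^sub>F \<nu> in at_right 0. (1 + \<nu>) * \<theta> < \<theta>' \<and> \<nu> / (1 - \<theta>') < 1 \<and> N * (\<nu> / (1 - \<theta>')) < \<epsilon> / 4 \<and> 0 < \<nu>"
  proof (intro eventually_conj)
    have "((\<lambda>\<nu>. (1 + \<nu>) * \<theta>) \<longlongrightarrow> (1 + 0) * \<theta>) (at_right 0)" by (intro tendsto_intros)
    then show "\<forall>\<^sub>F \<nu> in at_right 0. (1 + \<nu>) * \<theta> < \<theta>'" by (rule order_tendstoD) (use \<theta>' in simp)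
    have l: "((\<lambda>\<nu>. \<nu> / (1 - \<theta>')) \<longlongrightarrow> 0 / (1 - \<theta>')) (at_right 0)"
      by (intro tendsto_intros) (use \<theta>' in simp)
    then show "\<forall>\<^sub>F \<nu> in at_right 0. \<nu> / (1 - \<theta>') < 1" by (rule order_tendstoD) simp
    have "((\<lambda>\<nu>. N * (\<nu> / (1 - \<theta>'))) \<longlongrightarrow> N * (0 / (1 - \<theta>'))) (at_right 0)"
      by (intro tendsto_mult tendsto_const l)
    then show "\<forall>\<^sub>F \<nu> in at_right 0. N * (\<nu> / (1 - \<theta>')) < \<epsilon> / 4"
      by (rule order_tendstoD) (use \<epsilon> in simp)
    show "\<forall>\<^sub>F \<nu> in at_right 0. 0 < (\<nu> :: real)" by (rule eventually_at_right_less)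
  qed
  from eventually_happens [OF this] obtain \<nu> where
    \<nu>: "(1 + \<nu>) * \<theta> < \<theta>'" "\<nu> / (1 - \<theta>') < 1" "N * (\<nu> / (1 - \<theta>')) < \<epsilon> / 4" "0 < \<nu>"
    by auto

  \<comment> \<open>The factors \<open>\<beta>\<close> and \<open>a\<close> of the improvement step, as
    functions of its accuracy; their product tends to 1.\<close>
  define b where "b z = (1 + z) / (1 - z)" for z :: real
  define a where "a z = 1 / (1 - (b z - 1) * (b z * \<tau> * \<kappa>))" for z
  have "\<forall>\<^sub>F z in at_right 0. z < 1 \<and> (b z - 1) * (b z * \<tau> * \<kappa>) < 1 \<and> a z * b z < 1 + \<nu> \<and> 0 < z"
  proof (intro eventually_conj)
    have b: "(b \<longlongrightarrow> (1 + 0) / (1 - 0)) (at_right 0)" unfolding b_def by (intro tendsto_intros) simp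
    have bb: "((\<lambda>z. (b z - 1) * (b z * \<tau> * \<kappa>)) \<longlongrightarrow> (1 - 1) * (1 * \<tau> * \<kappa>)) (at_right 0)"
      using b by (intro tendsto_intros) auto
    then show "\<forall>\<^sub>F z in at_right 0. (b z - 1) * (b z * \<tau> * \<kappa>) < 1" by (rule order_tendstoD) simp
    have "((\<lambda>z. a z * b z) \<longlongrightarrow> 1 / (1 - (1 - 1) * (1 * \<tau> * \<kappa>)) * ((1 + 0) / (1 - 0))) (at_right 0)"
      unfolding a_def by (intro tendsto_mult tendsto_divide tendsto_diff tendsto_const bb b) simp
    then show "\<forall>\<^sub>F z in at_right 0. a z * b z < 1 + \<nu>" by (rule order_tendstoD) (use \<nu> in simp)
    show "\<forall>\<^sub>F z in at_right 0. 0 < (z :: real)" by (rule eventually_at_right_less)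
    show "\<forall>\<^sub>F z in at_right 0. z < (1 :: real)"
      using eventually_at_right_real [of 0 "1::real"] by (rule eventually_mono) auto
  qed
  from eventually_happens [OF this] obtain \<zeta> where
    \<zeta>: "\<zeta> < 1" "(b \<zeta> - 1) * (b \<zeta> * \<tau> * \<kappa>) < 1" "a \<zeta> * b \<zeta> < 1 + \<nu>" "0 < \<zeta>"
    by auto

  define q where "q = 1 - 1 / (\<tau> * \<kappa>)"
  have tk: "1 \<le> \<tau> * \<kappa>" using \<tau> \<kappa>(1) mult_mono [of 1 \<tau> 1 \<kappa>] by simp
  have q: "0 \<le> q" "q < 1" using tk by (simp_all add: q_def)
  \<comment> \<open>The first bound keeps the evaluation error bounded, the second one makes its limit
    small.\<close>
  define d where "d = min (1 / (\<tau> * \<kappa>)) (\<zeta> / (2 * (\<tau> * \<kappa> * \<tau> * L + 1)))"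
  have tkL: "0 \<le> \<tau> * \<kappa> * \<tau> * L" using tk \<tau> L(1) by simp
  have d: "0 < d" "\<tau> * \<kappa> * d \<le> 1" "d * (\<tau> * \<kappa> * \<tau> * L + 1) \<le> \<zeta> / 2"
  proof -
    show "0 < d" using tk tkL \<zeta> by (simp add: d_def)
    have "d \<le> 1 / (\<tau> * \<kappa>)" by (simp add: d_def)
    from this tk show "\<tau> * \<kappa> * d \<le> 1"
      by (simp add: le_divide_eq mult_ac)
    have "d \<le> \<zeta> / (2 * (\<tau> * \<kappa> * \<tau> * L + 1))" by (simp add: d_def)
    moreover have "0 < 2 * (\<tau> * \<kappa> * \<tau> * L + 1)" using tkL by simp
    ultimately have "d * (2 * (\<tau> * \<kappa> * \<tau> * L + 1)) \<le> \<zeta>" by (simp only: pos_le_divide_eq)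
    then show "d * (\<tau> * \<kappa> * \<tau> * L + 1) \<le> \<zeta> / 2" by (simp add: algebra_simps)
  qed
  define \<delta> where "\<delta> = d * \<mu> / (3 * N * \<tau>)"
  have \<delta>: "0 < \<delta>" using d \<mu> N0 \<tau> by (simp add: \<delta>_def)
  have "(\<lambda>T. q ^ T * (\<tau> * L)) \<longlonglongrightarrow> 0 * (\<tau> * L)" using q by (intro tendsto_intros LIMSEQ_power_zero) auto
  then have "\<forall>\<^sub>F T in sequentially. q ^ T * (\<tau> * L) < \<zeta> / 2" by (rule order_tendstoD) (use \<zeta> in simp)
  then obtain T0 where T0: "\<And>T. T \<ge> T0 \<Longrightarrow> q ^ T * (\<tau> * L) < \<zeta> / 2" by (auto simp: eventually_sequentially)

  have step: "stabilizing A B (improve_step Qh T K) \<and>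
      (\<forall>x. qf (Pc (improve_step Qh T K)) x \<le> (1 + (\<nu> + \<theta>' * t)) * qf Ps x)"
    if Qh: "accurate \<delta> Qh" and T: "T0 \<le> T" and K: "stabilizing A B K"
      and t: "0 \<le> t" "1 + t \<le> \<tau>" and bd: "\<And>x. qf (Pc K) x \<le> (1 + t) * qf Ps x" for Qh T K t
  proof -
    have bd': "qf (Pc K) x \<le> \<tau> * qf Ps x" for x
      using bd [of x] mult_right_mono [OF t(2) Psnn [of x]] by linarith
    have \<delta>d: "d = 3 * N * \<tau> * \<delta> / \<mu>" using N0 \<tau> \<mu>(1) by (simp add: \<delta>_def)
    let ?Q = "Qh (evaluate Qh K T)"
    have symE: "sym_mat (evaluate Qh K T)"
      and acc: "\<bar>qf ?Q (vappend x u) - J (Pc K) x u\<bar> \<le> ((q ^ T + \<tau> * \<kappa> * d) * \<tau> * L + d) * cost x u" for x u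
      using evaluation_accuracy [OF Ps \<kappa> L less_imp_le [OF N0] N \<mu> K bd' \<tau> Qh less_imp_le [OF \<delta>] \<delta>d d(2)]
      unfolding q_def by blast+
    have symQ: "sym_mat ?Q" using Qh symE unfolding accurate_def by blast
    have "(q ^ T + \<tau> * \<kappa> * d) * \<tau> * L + d = q ^ T * (\<tau> * L) + d * (\<tau> * \<kappa> * \<tau> * L + 1)"
      by (simp add: algebra_simps)
    also have "\<dots> \<le> \<zeta>" using T0 [OF T] d(3) by linarith
    finally have "\<bar>qf ?Q (vappend x u) - J (Pc K) x u\<bar> \<le> \<zeta> * cost x u" for x u
      using acc [of x u] mult_right_mono [OF _ cost_nonneg, of _ \<zeta> x u] by (meson order_trans)
    note imp = improvement [OF Ps \<kappa> K bd _ t(2) symQ this less_imp_le [OF \<zeta>(4)] \<zeta>(1)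
        b_def [of \<zeta>] \<zeta>(2) a_def [of \<zeta>]]
    have "qf (Pc (greedy ?Q)) x \<le> (1 + (\<nu> + \<theta>' * t)) * qf Ps x" for x
    proof -
      have "a \<zeta> * b \<zeta> * (1 + (1 - 1 / \<kappa>) * (1 + t - 1)) \<le> (1 + \<nu>) * (1 + \<theta> * t)"
        using \<theta> t \<zeta>(3) \<nu>(4) unfolding \<theta>_def [symmetric] by (intro mult_mono) auto
      also have "\<dots> = 1 + \<nu> + ((1 + \<nu>) * \<theta>) * t" by (simp add: algebra_simps)
      also have "\<dots> \<le> 1 + (\<nu> + \<theta>' * t)" using \<nu>(1) t(1) mult_right_mono [of "(1 + \<nu>) * \<theta>" \<theta>' t] by simp
      finally have "a \<zeta> * b \<zeta> * (1 + (1 - 1 / \<kappa>) * (1 + t - 1)) * qf Ps x \<le> (1 + (\<nu> + \<theta>' * t)) * qf Ps x"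
        by (intro mult_right_mono Psnn)
      with imp(2) [of x] t(1) show ?thesis by simp
    qed
    with imp(1) t(1) show ?thesis unfolding improve_step_def by simp
  qed

  define t where "t i = \<theta>' ^ i * t0 + \<nu> / (1 - \<theta>')" for i
  have t_nonneg: "0 \<le> t i" for i using \<theta>' \<nu> t0 by (simp add: t_def)
  have t_le: "1 + t i \<le> \<tau>" for i
  proof -
    have "\<theta>' ^ i * t0 \<le> 1 * t0" using \<theta>' t0 by (intro mult_right_mono power_le_one) auto
    then show ?thesis using \<nu>(2) by (simp add: t_def \<tau>_def)
  qed
  have t_Suc: "\<nu> + \<theta>' * t i = t (Suc i)" for i
  proof -
    have "\<nu> + \<theta>' * (\<nu> / (1 - \<theta>')) = \<nu> / (1 - \<theta>')" using \<theta>' by (simp add: field_simps)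
    then show ?thesis by (simp add: t_def algebra_simps)
  qed
  show ?thesis
  proof (intro exI conjI allI impI)
    show "0 < \<delta>" by (rule \<delta>)
    fix Qh T assume Qh: "accurate \<delta> Qh" and T: "T0 \<le> T"
    define K where "K i = (improve_step Qh T ^^ i) K1" for i
    have inv: "stabilizing A B (K i) \<and> (\<forall>x. qf (Pc (K i)) x \<le> (1 + t i) * qf Ps x)" for i
    proof (induction i)
      case 0
      have "(1 + t0) * qf Ps x \<le> (1 + t 0) * qf Ps x" for x
        using \<theta>' \<nu> by (intro mult_right_mono Psnn) (simp add: t_def)
      with start K1 show ?case by (simp add: K_def) (meson order_trans)
    next
      case (Suc i)
      then show ?case using step [OF Qh T _ t_nonneg t_le, of "K i" i] by (simp add: K_def t_Suc)
    qed
    then show "stabilizing A B ((improve_step Qh T ^^ i) K1)" for i unfolding K_def by blast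
    have close: "norm (Pc (K i) - Ps) \<le> N * t i" for i
    proof (rule N)
      show "sym_mat (Pc (K i) - Ps)" using inv by (intro sym_mat_simps Pc_sym symPs) blast
      fix x
      have "qf Ps x \<le> qf (Pc (K i)) x" using inv by (intro riccati_le_Pc Ps) blast
      moreover have "qf (Pc (K i)) x \<le> (1 + t i) * qf Ps x" using inv by blast
      ultimately show "\<bar>qf (Pc (K i) - Ps) x\<bar> \<le> t i * qf Ps x"
        by (simp add: qf_simps algebra_simps)
    qed
    have "(\<lambda>i. N * t i) \<longlonglongrightarrow> N * (0 * t0 + \<nu> / (1 - \<theta>'))"
      unfolding t_def using \<theta>' by (intro tendsto_intros LIMSEQ_power_zero) auto
    moreover have "N * (0 * t0 + \<nu> / (1 - \<theta>')) < \<epsilon> / 2"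
      unfolding mult_zero_left add_0 using \<nu>(3) \<epsilon> by linarith
    ultimately have "\<forall>\<^sub>F i in sequentially. N * t i < \<epsilon> / 2" by (rule order_tendstoD)
    then show "\<forall>\<^sub>F i in sequentially.
        norm (Pc ((improve_step Qh T ^^ i) K1) - opt_cost A B S R) \<le> \<epsilon> / 2"
      unfolding K_def [symmetric] Ps_def [symmetric]
      by (rule eventually_mono) (meson close less_imp_le order_trans)
  qed
qed

end

section \<open>Least squares on quadratic data\<close>

lemma pinv_invertible:
  fixes Z :: "real^'k^'k"
  assumes "invertible Z" shows "pinv Z = matrix_inv Z"
  unfolding pinv_def
proof (rule the_equality)
  note inv = matrix_inv_inverse [OF assms]
  show "Z ** matrix_inv Z ** Z = Z \<and> matrix_inv Z ** Z ** matrix_inv Z = matrix_inv Z \<and>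
      sym_mat (Z ** matrix_inv Z) \<and> sym_mat (matrix_inv Z ** Z)"
    by (simp add: inv sym_mat_simps)
  fix X assume "Z ** X ** Z = Z \<and> X ** Z ** X = X \<and> sym_mat (Z ** X) \<and> sym_mat (X ** Z)"
  then have "matrix_inv Z ** (Z ** X ** Z) ** matrix_inv Z = matrix_inv Z ** Z ** matrix_inv Z" by simp
  then have "X ** Z ** matrix_inv Z = matrix_inv Z"
    by (simp only: matrix_mul_assoc inv matrix_mul_lid)
  then have "X ** (Z ** matrix_inv Z) = matrix_inv Z" by (simp only: matrix_mul_assoc)
  then show "X = matrix_inv Z" by (simp only: inv matrix_mul_rid)
qed

lemma sym_mat_outer: "sym_mat (outer z z)"
  by (simp add: sym_mat_def outer_def transpose_def vec_eq_iff mult.commute)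

lemma vtilde_Upair: "vtilde z $ Upair i j = (if i = j then z $ i * z $ i else sqrt 2 * (z $ i * z $ j))"
  unfolding vtilde_def svec_Upair [OF sym_mat_outer] by (simp add: outer_def)

lemma qf_sum: "qf P x = (\<Sum>i\<in>UNIV. \<Sum>j\<in>UNIV. P $ i $ j * (x $ i * x $ j))"
  by (simp add: qf_def inner_vec_def matrix_vector_mult_def sum_distrib_left mult_ac)

text \<open>
  The factors \<open>sqrt 2\<close> in \<open>svec\<close> are made for this: an unordered pair of distinct indices accounts for two equal
  terms of the double sum.
\<close>

lemma qf_smat: "qf (smat s) z = vtilde z \<bullet> s"
proof -
  define h where "h = (\<lambda>(i, j). smat s $ i $ j * (z $ i * z $ j))"
  have fibre: "(\<Sum>q\<in>{q \<in> UNIV. (case q of (i, j) \<Rightarrow> Upair i j) = p}. h q) = vtilde z $ p * s $ p" for p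
  proof (cases p)
    case (Upair i j)
    show ?thesis
    proof (cases "i = j")
      case True
      then have "{q \<in> UNIV. (case q of (i, j) \<Rightarrow> Upair i j) = p} = {(i, i)}" using Upair by auto
      with True show ?thesis by (simp add: h_def smat_eq Upair vtilde_Upair)
    next
      case False
      have "{q \<in> UNIV. (case q of (i, j) \<Rightarrow> Upair i j) = p} = {(i, j), (j, i)}" using Upair by auto
      moreover have "s $ Upair j i = s $ Upair i j" by (rule arg_cong [where f = "($) s"]) simp
      moreover have "2 / sqrt 2 = sqrt (2 :: real)" by (simp add: real_div_sqrt)
      ultimately show ?thesis using False
        by (simp add: h_def smat_eq Upair vtilde_Upair field_simps)
    qed
  qed
  have "qf (smat s) z = sum h UNIV"
    unfolding qf_sum h_def UNIV_Times_UNIV [symmetric] by (simp add: sum.cartesian_product)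
  also have "\<dots> = (\<Sum>p\<in>UNIV. \<Sum>q\<in>{q \<in> UNIV. (case q of (i, j) \<Rightarrow> Upair i j) = p}. h q)"
    by (rule sum.group [symmetric]) auto
  also have "\<dots> = vtilde z \<bullet> s" unfolding fibre by (simp add: inner_vec_def)
  finally show ?thesis .
qed

lemma sym_mat_smat: "sym_mat (smat s)"
proof -
  have "s $ Upair j i = s $ Upair i j" for i j by (rule arg_cong [where f = "($) s"]) simp
  then show ?thesis by (simp add: sym_mat_def smat_eq transpose_def vec_eq_iff)
qed

lemma smat_svec: "sym_mat F \<Longrightarrow> smat (svec F) = F"
  by (simp add: smat_eq svec_Upair vec_eq_iff)

lemma vtilde_inner_svec: "sym_mat F \<Longrightarrow> vtilde z \<bullet> svec F = qf F z"
  using qf_smat [of "svec F" z] by (simp add: smat_svec)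

lemma outer_mult_vec: "outer a b *v y = (b \<bullet> y) *\<^sub>R a"
  by (simp add: vec_eq_iff outer_def matrix_vector_mult_def inner_vec_def sum_distrib_left sum_distrib_right mult_ac)

lemma norm_vtilde: "norm (vtilde z) = z \<bullet> z"
proof -
  have "vtilde z \<bullet> vtilde z = qf (outer z z) z"
    unfolding vtilde_def [of z] using vtilde_inner_svec [OF sym_mat_outer] by (simp add: vtilde_def)
  also have "\<dots> = (z \<bullet> z)\<^sup>2" by (simp add: qf_def outer_mult_vec power2_eq_square)
  finally show ?thesis by (simp add: norm_eq_sqrt_inner)
qed

lemma qf_block_ul: "qf (block_ul F) y = qf F (vappend y 0)"
  by (simp add: qf_sum sum_UNIV_Plus block_ul_def)

lemma sym_mat_block_ul:
  assumes "sym_mat F" shows "sym_mat (block_ul F)"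
proof -
  have "F $ Inl j $ Inl i = F $ Inl i $ Inl j" for i j by (rule sym_mat_nth [OF assms])
  then show ?thesis by (simp add: sym_mat_def transpose_def vec_eq_iff block_ul_def)
qed

context lq_problem
begin

text \<open>
  So the model behind the least-squares fit is correctly specified; the constant \<open>t\<close> is carried by the last
  coordinate of the regressor.
\<close>

lemma ex_quadratic_model:
  assumes P: "sym_mat P"
  shows "\<exists>F :: real^(('n + 'm) + 1)^(('n + 'm) + 1). sym_mat F \<and>
     (\<forall>x u y. qf F (vappend (vappend x u) y) = J P x u + t * (y \<bullet> y))"
proof -
  define X where "X z = (\<chi> i. z $ Inl (Inl i))" for z :: "real^(('n + 'm) + 1)"
  define U where "U z = (\<chi> i. z $ Inl (Inr i))" for z :: "real^(('n + 'm) + 1)"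
  define Y where "Y z = (\<chi> i. z $ Inr i)" for z :: "real^(('n + 'm) + 1)"
  define Z where "Z z = A *v X z + B *v U z" for z
  have lX: "linear X" and lU: "linear U" and lY: "linear Y"
    by (rule linearI; simp add: X_def U_def Y_def vec_eq_iff)+
  have lZ: "linear Z" unfolding Z_def [abs_def]
    by (intro linear_compose_add linear_compose [OF lX, unfolded o_def] linear_compose [OF lU, unfolded o_def]
        matrix_vector_mul_linear)
  let ?c = "\<lambda>f Q. transpose (matrix f) ** Q ** matrix f"
  let ?F = "?c Z P + ?c X S + ?c U R + t *\<^sub>R ?c Y (mat 1)"
  have q: "qf (?c f Q) z = qf Q (f z)" if "linear f" for f Q z
    using fun_cong [OF matrix_vector_mul(2) [OF that], of z] by (simp add: qf_congruence)
  have "sym_mat ?F" using P S R by (intro sym_mat_simps) (simp_all add: pos_def_imp_sym)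
  moreover have "qf ?F (vappend (vappend x u) y) = J P x u + t * (y \<bullet> y)" for x u y
  proof -
    have "X (vappend (vappend x u) y) = x" "U (vappend (vappend x u) y) = u" "Y (vappend (vappend x u) y) = y"
      by (simp_all add: X_def U_def Y_def vec_eq_iff)
    moreover have "qf (mat 1) y = y \<bullet> y" by (simp add: qf_def)
    ultimately show ?thesis
      unfolding qf_simps q [OF lX] q [OF lU] q [OF lY] q [OF lZ] by (simp add: Z_def J_def cost_def)
  qed
  ultimately show ?thesis by blast
qed

text \<open>
  The deviation of \<open>x' x'\<^sup>T\<close> from its mean given the current state and input, entry by entry.  Working with
  entries makes the error linear in \<open>P\<close> and hence uniform in \<open>P\<close>.
\<close>

definition residual :: "real^'q^'n \<Rightarrow> (nat \<Rightarrow> real^'n) \<Rightarrow> (nat \<Rightarrow> real^'m) \<Rightarrow> 'n \<Rightarrow> 'n \<Rightarrow> nat \<Rightarrow> real" where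
  "residual C x u i j k = x (Suc k) $ i * x (Suc k) $ j
     - ((A *v x k + B *v u k) $ i * (A *v x k + B *v u k) $ j + (C ** transpose C) $ i $ j)"

definition mean_residual :: "real^'q^'n \<Rightarrow> (nat \<Rightarrow> real^'n) \<Rightarrow> (nat \<Rightarrow> real^'m) \<Rightarrow> 'n \<Rightarrow> 'n \<Rightarrow> nat
    \<Rightarrow> real^((('n + 'm) + 1) uprod)" where
  "mean_residual C x u i j M = (1 / real M) *\<^sub>R (\<Sum>k<M. residual C x u i j k *\<^sub>R vtilde (zvec (x k) (u k)))"

lemma mean_residual_entry:
  "mean_residual C x u i j M $ p = (\<Sum>k<M. residual C x u i j k * vtilde (zvec (x k) (u k)) $ p) / M"
  by (simp add: mean_residual_def)

text \<open>
  The fitted parameter minus the true one is the inverse Gram matrix applied to \<open>\<Sum>i j. P $ i $ j * mean_residual i j\<close>.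
\<close>

lemma Qhat_accurate:
  fixes C :: "real^'q^'n" and x :: "nat \<Rightarrow> real^'n" and u :: "nat \<Rightarrow> real^'m" and M :: nat
  defines "\<Phi> \<equiv> Phi_data x u M"
  assumes c: "0 < c" "\<And>y. c * norm y \<le> norm (\<Phi> *v y)"
    and \<delta>: "(\<Sum>i\<in>UNIV. \<Sum>j\<in>UNIV. norm (mean_residual C x u i j M)) \<le> c * \<delta>"
  shows "accurate \<delta> (Qhat \<Phi> (Psi_data x u M) (Xi_data S R x u M))"
  unfolding accurate_def
proof (intro allI impI conjI)
  fix P :: "real^'n^'n" assume P: "sym_mat P"
  let ?\<Psi> = "Psi_data x u M" and ?\<Xi> = "Xi_data S R x u M"
  show "sym_mat (Qhat \<Phi> ?\<Psi> ?\<Xi> P)"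
    by (simp add: Qhat_def Fhat_def sym_mat_block_ul sym_mat_smat)
  have "invertible \<Phi>"
  proof -
    have "y = 0" if "\<Phi> *v y = 0" for y using c(2) [of y] c(1) that by (simp add: mult_le_0_iff)
    then show ?thesis by (simp add: invertible_left_inverse matrix_left_invertible_ker)
  qed
  note inv = matrix_inv_inverse [OF this] and pinv = pinv_invertible [OF this]
  define t where "t = (\<Sum>i\<in>UNIV. \<Sum>j\<in>UNIV. P $ i $ j * (C ** transpose C) $ i $ j)"
  obtain F :: "real^(('n + 'm) + 1)^(('n + 'm) + 1)" where F: "sym_mat F"
    "\<And>x u y. qf F (vappend (vappend x u) y) = J P x u + t * (y \<bullet> y)"
    using ex_quadratic_model [OF P, of t] by blast
  define b where "b = (pinv \<Phi> ** ?\<Psi>) *v svec P + pinv \<Phi> *v ?\<Xi>"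
  define d where "d = b - svec F"
  let ?z = "\<lambda>k. vtilde (zvec (x k) (u k))"
  have \<Phi>d: "\<Phi> *v d = (\<Sum>i\<in>UNIV. \<Sum>j\<in>UNIV. P $ i $ j *\<^sub>R mean_residual C x u i j M)"
  proof -
    have scaled: "((1 / real M) *\<^sub>R (\<Sum>k<M. outer (?z k) (f k))) *v y = (1 / real M) *\<^sub>R (\<Sum>k<M. (f k \<bullet> y) *\<^sub>R ?z k)"
      for f :: "nat \<Rightarrow> real^'a::finite" and y
    proof -
      have "(\<Sum>k<M. outer (?z k) (f k)) *v y = (\<Sum>k<M. outer (?z k) (f k) *v y)"
        by (induction M) (simp_all add: matrix_vector_mult_add_rdistrib)
      then show ?thesis by (simp add: scaleR_matrix_vector_assoc [symmetric] outer_mult_vec)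
    qed
    have one: "(1 :: real^1) \<bullet> 1 = 1" by (simp add: inner_vec_def)
    have "\<Phi> *v b = ?\<Psi> *v svec P + ?\<Xi>"
      by (simp add: b_def pinv matrix_vector_right_distrib matrix_vector_mul_assoc matrix_mul_assoc inv)
    then have "\<Phi> *v d = ?\<Psi> *v svec P + ?\<Xi> - \<Phi> *v svec F"
      by (simp add: d_def matrix_vector_mult_diff_distrib)
    also have "\<dots> = (1 / real M) *\<^sub>R (\<Sum>k<M. (qf P (x (Suc k)) + stage_cost S R (x k) (u k) - (J P (x k) (u k) + t)) *\<^sub>R ?z k)"
      unfolding \<Phi>_def Phi_data_def Psi_data_def Xi_data_def scaled vtilde_inner_svec [OF P] vtilde_inner_svec [OF F(1)]
      by (simp add: zvec_def F(2) one scaleR_add_left scaleR_diff_left sum.distrib sum_subtractf scaleR_right_distrib scaleR_right_diff_distrib)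
    also have "\<dots> = (1 / real M) *\<^sub>R (\<Sum>k<M. (\<Sum>i\<in>UNIV. \<Sum>j\<in>UNIV. P $ i $ j * residual C x u i j k) *\<^sub>R ?z k)"
    proof (rule arg_cong [where f = "\<lambda>v. (1 / real M) *\<^sub>R v"], rule sum.cong [OF refl], rule arg_cong [where f = "\<lambda>r. r *\<^sub>R _"])
      fix k
      have "stage_cost S R (x k) (u k) = cost (x k) (u k)" by (simp add: stage_cost_def cost_def qf_def)
      then have "qf P (x (Suc k)) + stage_cost S R (x k) (u k) - (J P (x k) (u k) + t)
          = qf P (x (Suc k)) - (qf P (A *v x k + B *v u k) + t)" by (simp add: J_def)
      also have "\<dots> = (\<Sum>i\<in>UNIV. \<Sum>j\<in>UNIV. P $ i $ j * residual C x u i j k)"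
        unfolding qf_sum t_def sum.distrib [symmetric] sum_subtractf [symmetric] residual_def
        by (simp add: algebra_simps)
      finally show "qf P (x (Suc k)) + stage_cost S R (x k) (u k) - (J P (x k) (u k) + t)
          = (\<Sum>i\<in>UNIV. \<Sum>j\<in>UNIV. P $ i $ j * residual C x u i j k)" .
    qed
    also have "\<dots> = (\<Sum>i\<in>UNIV. \<Sum>j\<in>UNIV. P $ i $ j *\<^sub>R mean_residual C x u i j M)"
    proof -
      have "(\<Sum>k<M. (\<Sum>i\<in>UNIV. \<Sum>j\<in>UNIV. P $ i $ j * residual C x u i j k) *\<^sub>R ?z k)
          = (\<Sum>i\<in>UNIV. \<Sum>j\<in>UNIV. \<Sum>k<M. (P $ i $ j * residual C x u i j k) *\<^sub>R ?z k)"
        unfolding scaleR_sum_left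
        by (subst sum.swap, rule sum.cong [OF refl], rule sum.swap)
      then show ?thesis
        by (simp add: mean_residual_def scaleR_sum_right mult_ac)
    qed
    finally show ?thesis .
  qed
  have "norm (\<Phi> *v d) \<le> (\<Sum>i\<in>UNIV. \<Sum>j\<in>UNIV. norm P * norm (mean_residual C x u i j M))"
    unfolding \<Phi>d
  proof (intro order_trans [OF norm_sum] sum_mono)
    fix i j
    have "\<bar>P $ i $ j\<bar> \<le> norm P"
      using component_le_norm_cart [of "P $ i" j] Finite_Cartesian_Product.norm_nth_le [where x = P and i = i] by simp
    then show "norm (P $ i $ j *\<^sub>R mean_residual C x u i j M) \<le> norm P * norm (mean_residual C x u i j M)"
      by (simp add: mult_right_mono)
  qed
  also have "\<dots> = norm P * (\<Sum>i\<in>UNIV. \<Sum>j\<in>UNIV. norm (mean_residual C x u i j M))"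
    by (simp add: sum_distrib_left)
  also have "\<dots> \<le> norm P * (c * \<delta>)" by (intro mult_left_mono \<delta>) simp
  finally have "c * norm d \<le> c * (norm P * \<delta>)" using c(2) [of d] by (simp add: mult_ac)
  then have d: "norm d \<le> norm P * \<delta>" using c(1) by simp
  fix x' :: "real^'n" and u' :: "real^'m"
  let ?y = "vappend (vappend x' u') 0 :: real^(('n + 'm) + 1)"
  have "qf (Qhat \<Phi> ?\<Psi> ?\<Xi> P) (vappend x' u') = vtilde ?y \<bullet> b"
    by (simp add: Qhat_def Fhat_def qf_block_ul b_def qf_smat)
  also have "\<dots> = vtilde ?y \<bullet> svec F + vtilde ?y \<bullet> d" by (simp add: d_def inner_diff_right)
  also have "vtilde ?y \<bullet> svec F = J P x' u'" by (simp add: vtilde_inner_svec [OF F(1)] F(2))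
  finally have "\<bar>qf (Qhat \<Phi> ?\<Psi> ?\<Xi> P) (vappend x' u') - J P x' u'\<bar> = \<bar>vtilde ?y \<bullet> d\<bar>" by simp
  also have "\<dots> \<le> norm (vtilde ?y) * norm d" by (rule Cauchy_Schwarz_ineq2)
  also have "\<dots> \<le> (x' \<bullet> x' + u' \<bullet> u') * (norm P * \<delta>)"
    unfolding norm_vtilde using d by (simp add: inner_vappend mult_left_mono)
  finally show "\<bar>qf (Qhat \<Phi> ?\<Psi> ?\<Xi> P) (vappend x' u') - J P x' u'\<bar> \<le> \<delta> * norm P * (x' \<bullet> x' + u' \<bullet> u')"
    by (simp add: mult_ac)
qed

lemma Qhat_eventually_accurate:
  fixes C :: "real^'q^'n"
  assumes \<Phi>: "Phi_data x u \<longlonglongrightarrow> \<Phi>" "invertible \<Phi>"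
    and res: "\<And>i j. mean_residual C x u i j \<longlonglongrightarrow> 0" and \<delta>: "0 < \<delta>"
  shows "\<forall>\<^sub>F M in sequentially. accurate \<delta> (Qhat (Phi_data x u M) (Psi_data x u M) (Xi_data S R x u M))"
proof -
  define c where "c = 1 / (norm (matrix_inv \<Phi>) + 1)"
  have c0: "0 < c" by (simp add: c_def add_nonneg_pos)
  have c: "c * norm y \<le> norm (\<Phi> *v y)" for y
  proof -
    have "norm y = norm (matrix_inv \<Phi> *v (\<Phi> *v y))"
      by (simp add: matrix_vector_mul_assoc matrix_inv_inverse [OF \<Phi>(2)])
    also have "\<dots> \<le> norm (matrix_inv \<Phi>) * norm (\<Phi> *v y)" by (rule norm_matrix_vector_le)
    also have "\<dots> \<le> (norm (matrix_inv \<Phi>) + 1) * norm (\<Phi> *v y)" by (intro mult_right_mono) auto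
    finally show ?thesis by (simp add: c_def divide_le_eq add_nonneg_pos mult.commute)
  qed
  have "\<forall>\<^sub>F M in sequentially. dist (Phi_data x u M) \<Phi> < c / 2"
    using \<Phi>(1) c0 by (intro tendstoD) auto
  moreover have "(\<lambda>M. \<Sum>i\<in>UNIV. \<Sum>j\<in>UNIV. norm (mean_residual C x u i j M)) \<longlonglongrightarrow> (\<Sum>i::'n\<in>UNIV. \<Sum>j::'n\<in>UNIV. norm (0 :: real^((('n + 'm) + 1) uprod)))"
    by (intro tendsto_intros res)
  then have "\<forall>\<^sub>F M in sequentially. (\<Sum>i\<in>UNIV. \<Sum>j\<in>UNIV. norm (mean_residual C x u i j M)) < c / 2 * \<delta>"
    by (rule order_tendstoD) (use c0 \<delta> in simp)
  ultimately show ?thesis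
  proof eventually_elim
    case (elim M)
    show ?case
    proof (rule Qhat_accurate [where c = "c / 2" and C = C])
      fix y :: "real^((('n + 'm) + 1) uprod)"
      have "norm (Phi_data x u M - \<Phi>) * norm y \<le> c / 2 * norm y"
        using elim(1) by (intro mult_right_mono) (simp_all add: dist_norm)
      then have "norm ((Phi_data x u M - \<Phi>) *v y) \<le> c / 2 * norm y"
        using norm_matrix_vector_le [of "Phi_data x u M - \<Phi>" y] by linarith
      moreover have "norm (\<Phi> *v y) \<le> norm (Phi_data x u M *v y) + norm ((Phi_data x u M - \<Phi>) *v y)"
        using norm_triangle_ineq4 [of "Phi_data x u M *v y" "(Phi_data x u M - \<Phi>) *v y"]
        by (simp add: matrix_vector_mult_diff_rdistrib)
      ultimately show "c / 2 * norm y \<le> norm (Phi_data x u M *v y)" using c [of y] by linarith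
    qed (use c0 elim(2) in auto)
  qed
qed

lemma improve_eq_improve_step: "improve \<Phi> \<Psi> \<Xi> T = improve_step (Qhat \<Phi> \<Psi> \<Xi>) T"
proof
  fix K :: "real^'n^'m"
  have "Phat \<Phi> \<Psi> \<Xi> K j = evaluate (Qhat \<Phi> \<Psi> \<Xi>) K j" for j by (induction j) simp_all
  then show "improve \<Phi> \<Psi> \<Xi> T K = improve_step (Qhat \<Phi> \<Psi> \<Xi>) T K"
    by (simp add: improve_def improve_step_def greedy_def Let_def)
qed

end

section \<open>A strong law of large numbers for sequences with finite-range dependence\<close>

lemma ex_square_bracket: "\<exists>m::nat. m\<^sup>2 \<le> n \<and> n < (Suc m)\<^sup>2"
proof (induction n)
  case (Suc n)
  then obtain m where m: "m\<^sup>2 \<le> n" "n < (Suc m)\<^sup>2" by blast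
  show ?case
  proof (cases "Suc n < (Suc m)\<^sup>2")
    case True
    with m show ?thesis by (intro exI [of _ m]) auto
  next
    case False
    with m have "Suc n = (Suc m)\<^sup>2" by simp
    then show ?thesis by (intro exI [of _ "Suc m"]) (auto simp: power2_eq_square)
  qed
qed simp

lemma averages_tendsto_zero_along_squares:
  fixes z :: "nat \<Rightarrow> real"
  assumes U: "(\<lambda>n. ((\<Sum>k<(Suc n)\<^sup>2. z k) / (Suc n)\<^sup>2)\<^sup>2
      + ((\<Sum>k\<in>{(Suc n)\<^sup>2..<(Suc (Suc n))\<^sup>2}. \<bar>z k\<bar>) / (Suc n)\<^sup>2)\<^sup>2) \<longlonglongrightarrow> 0"
  shows "(\<lambda>n. (\<Sum>k<n. z k) / n) \<longlonglongrightarrow> 0"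
proof (rule LIMSEQ_I)
  fix e :: real assume e: "0 < e"
  let ?a = "\<lambda>n. (\<Sum>k<(Suc n)\<^sup>2. z k) / (Suc n)\<^sup>2"
  let ?b = "\<lambda>n. (\<Sum>k\<in>{(Suc n)\<^sup>2..<(Suc (Suc n))\<^sup>2}. \<bar>z k\<bar>) / (Suc n)\<^sup>2"
  have "0 < (e / 2)\<^sup>2" using e by simp
  from LIMSEQ_D [OF U this] obtain m0 where
    m0: "\<And>n. n \<ge> m0 \<Longrightarrow> \<bar>(?a n)\<^sup>2 + (?b n)\<^sup>2\<bar> < (e / 2)\<^sup>2" by auto
  have ab: "\<bar>?a n\<bar> < e / 2" "\<bar>?b n\<bar> < e / 2" if "n \<ge> m0" for n
  proof -
    have "(?a n)\<^sup>2 < (e / 2)\<^sup>2" "(?b n)\<^sup>2 < (e / 2)\<^sup>2"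
      using m0 [OF that] zero_le_power2 [of "?a n"] zero_le_power2 [of "?b n"] by linarith+
    then show "\<bar>?a n\<bar> < e / 2" "\<bar>?b n\<bar> < e / 2"
      using e power2_less_imp_less [of "\<bar>?a n\<bar>" "e / 2"] power2_less_imp_less [of "\<bar>?b n\<bar>" "e / 2"]
      by (simp_all only: power2_abs)
  qed
  show "\<exists>no. \<forall>n\<ge>no. norm ((\<Sum>k<n. z k) / n - 0) < e"
  proof (intro exI allI impI)
    fix n assume n: "n \<ge> (Suc m0)\<^sup>2"
    obtain m where m: "m\<^sup>2 \<le> n" "n < (Suc m)\<^sup>2" using ex_square_bracket by blast
    have "(Suc m0)\<^sup>2 < (Suc m)\<^sup>2" using n m by linarith
    then have "Suc m0 \<le> m" using power_less_imp_less_base [of "Suc m0" 2 "Suc m"] by simp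
    then obtain m' where m': "m = Suc m'" "m' \<ge> m0" by (cases m) auto
    have "(\<Sum>k<n. z k) = (\<Sum>k<m\<^sup>2. z k) + (\<Sum>k\<in>{m\<^sup>2..<n}. z k)"
      using m(1) by (simp add: sum.atLeastLessThan_concat lessThan_atLeast0)
    moreover have "\<bar>\<Sum>k\<in>{m\<^sup>2..<n}. z k\<bar> \<le> (\<Sum>k\<in>{m\<^sup>2..<n}. \<bar>z k\<bar>)" by (rule sum_abs)
    moreover have "(\<Sum>k\<in>{m\<^sup>2..<n}. \<bar>z k\<bar>) \<le> (\<Sum>k\<in>{m\<^sup>2..<(Suc m)\<^sup>2}. \<bar>z k\<bar>)"
      using m(2) by (intro sum_mono2) auto
    ultimately have "\<bar>\<Sum>k<n. z k\<bar> \<le> \<bar>\<Sum>k<m\<^sup>2. z k\<bar> + (\<Sum>k\<in>{m\<^sup>2..<(Suc m)\<^sup>2}. \<bar>z k\<bar>)" by linarith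
    then have "\<bar>\<Sum>k<n. z k\<bar> / n \<le> (\<bar>\<Sum>k<m\<^sup>2. z k\<bar> + (\<Sum>k\<in>{m\<^sup>2..<(Suc m)\<^sup>2}. \<bar>z k\<bar>)) / n"
      by (rule divide_right_mono) simp
    also have "\<dots> \<le> (\<bar>\<Sum>k<m\<^sup>2. z k\<bar> + (\<Sum>k\<in>{m\<^sup>2..<(Suc m)\<^sup>2}. \<bar>z k\<bar>)) / m\<^sup>2"
    proof (rule divide_left_mono)
      show "real (m\<^sup>2) \<le> real n" using m(1) by (simp only: of_nat_le_iff)
      have "0 < m\<^sup>2" using m' by simp
      with m(1) have "0 < n" by linarith
      with \<open>0 < m\<^sup>2\<close> show "0 < real n * real (m\<^sup>2)" by simp
    qed (simp add: sum_nonneg)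
    also have "\<dots> = \<bar>?a m'\<bar> + ?b m'" by (simp add: m'(1) add_divide_distrib)
    also have "\<dots> < e" using ab [OF m'(2)] by linarith
    finally show "norm ((\<Sum>k<n. z k) / n - 0) < e" by simp
  qed
qed

text \<open>
  Along the squares the averages have summable second moments, hence tend to 0 almost surely.  Between \<open>n\<^sup>2\<close> and
  \<open>(n + 1)\<^sup>2\<close> there are only about \<open>2 n\<close> terms, and the sum of their absolute values divided by \<open>n\<^sup>2\<close> has summable second
  moments as well.
\<close>

lemma (in prob_space) slln_of_second_moments:
  fixes Z :: "nat \<Rightarrow> 'a \<Rightarrow> real"
  assumes meas [measurable]: "\<And>k. random_variable borel (Z k)"
    and int: "\<And>k. integrable M (\<lambda>\<omega>. (Z k \<omega>)\<^sup>2)"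
    and D: "\<And>k. expectation (\<lambda>\<omega>. (Z k \<omega>)\<^sup>2) \<le> D"
    and S: "\<And>n. expectation (\<lambda>\<omega>. (\<Sum>k<n. Z k \<omega>)\<^sup>2) \<le> D * real n"
  shows "AE \<omega> in M. (\<lambda>n. (\<Sum>k<n. Z k \<omega>) / n) \<longlonglongrightarrow> 0"
proof -
  have "0 \<le> expectation (\<lambda>\<omega>. (Z 0 \<omega>)\<^sup>2)" by (rule Bochner_Integration.integral_nonneg) simp
  then have D0: "0 \<le> D" using D [of 0] by linarith
  have intp: "integrable M (\<lambda>\<omega>. Z j \<omega> * Z k \<omega>)" for j k
  proof (rule Bochner_Integration.integrable_bound [OF Bochner_Integration.integrable_add [OF int [of j] int [of k]]])
    show "AE \<omega> in M. norm (Z j \<omega> * Z k \<omega>) \<le> norm ((Z j \<omega>)\<^sup>2 + (Z k \<omega>)\<^sup>2)"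
    proof (rule AE_I2)
      fix \<omega>
      have "0 \<le> (\<bar>Z j \<omega>\<bar> - \<bar>Z k \<omega>\<bar>)\<^sup>2" by simp
      then have "2 * (\<bar>Z j \<omega>\<bar> * \<bar>Z k \<omega>\<bar>) \<le> (Z j \<omega>)\<^sup>2 + (Z k \<omega>)\<^sup>2" by (simp add: power2_diff)
      moreover have "0 \<le> \<bar>Z j \<omega>\<bar> * \<bar>Z k \<omega>\<bar>" by simp
      ultimately have "\<bar>Z j \<omega>\<bar> * \<bar>Z k \<omega>\<bar> \<le> (Z j \<omega>)\<^sup>2 + (Z k \<omega>)\<^sup>2" by linarith
      then show "norm (Z j \<omega> * Z k \<omega>) \<le> norm ((Z j \<omega>)\<^sup>2 + (Z k \<omega>)\<^sup>2)" by (simp add: abs_mult)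
    qed
  qed measurable
  have intS: "integrable M (\<lambda>\<omega>. (\<Sum>k\<in>I. Z k \<omega>)\<^sup>2)" if "finite I" for I
    unfolding power2_eq_square sum_product by (intro Bochner_Integration.integrable_sum intp)
  have intB: "integrable M (\<lambda>\<omega>. (\<Sum>k\<in>I. \<bar>Z k \<omega>\<bar>)\<^sup>2)" if "finite I" for I
    unfolding power2_eq_square sum_product abs_mult [symmetric]
    by (intro Bochner_Integration.integrable_sum integrable_abs intp)
  have B: "expectation (\<lambda>\<omega>. (\<Sum>k\<in>I. \<bar>Z k \<omega>\<bar>)\<^sup>2) \<le> (real (card I))\<^sup>2 * D" if "finite I" for I
  proof -
    have "expectation (\<lambda>\<omega>. (\<Sum>k\<in>I. \<bar>Z k \<omega>\<bar>)\<^sup>2) \<le> expectation (\<lambda>\<omega>. (\<Sum>k\<in>I. (Z k \<omega>)\<^sup>2) * card I)"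
      using sum_squared_le_sum_of_squares [of "\<lambda>k. \<bar>Z k _\<bar>" I]
      by (intro integral_mono intB that integrable_mult_left Bochner_Integration.integrable_sum int) simp
    also have "\<dots> = (\<Sum>k\<in>I. expectation (\<lambda>\<omega>. (Z k \<omega>)\<^sup>2)) * card I"
      by (simp add: int)
    also have "\<dots> \<le> (\<Sum>k\<in>I. D) * card I" by (intro mult_right_mono sum_mono D) simp
    finally show ?thesis by (simp add: power2_eq_square mult_ac)
  qed
  define U where "U n \<omega> = ((\<Sum>k<(Suc n)\<^sup>2. Z k \<omega>) / (Suc n)\<^sup>2)\<^sup>2
      + ((\<Sum>k\<in>{(Suc n)\<^sup>2..<(Suc (Suc n))\<^sup>2}. \<bar>Z k \<omega>\<bar>) / (Suc n)\<^sup>2)\<^sup>2" for n \<omega>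
  have U0: "0 \<le> U n \<omega>" for n \<omega> by (simp add: U_def)
  have [measurable]: "U n \<in> borel_measurable M" for n unfolding U_def by measurable
  have intU: "integrable M (U n)" for n
    unfolding U_def power_divide
    by (intro Bochner_Integration.integrable_add integrable_divide intS intB) auto
  have EU: "expectation (U n) \<le> 10 * D * (1 / (real (Suc n))\<^sup>2)" for n
  proof -
    let ?q = "real (Suc n)"
    let ?I = "{(Suc n)\<^sup>2..<(Suc (Suc n))\<^sup>2}"
    have q: "1 \<le> ?q" by simp
    have card: "real (card ?I) \<le> 3 * ?q" by (simp add: power2_eq_square algebra_simps)
    have "expectation (U n) = expectation (\<lambda>\<omega>. (\<Sum>k<(Suc n)\<^sup>2. Z k \<omega>)\<^sup>2) / (?q\<^sup>2)\<^sup>2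
        + expectation (\<lambda>\<omega>. (\<Sum>k\<in>?I. \<bar>Z k \<omega>\<bar>)\<^sup>2) / (?q\<^sup>2)\<^sup>2"
      unfolding U_def power_divide
      by (subst Bochner_Integration.integral_add) (auto intro!: intS intB)
    also have "\<dots> \<le> (D * real ((Suc n)\<^sup>2)) / (?q\<^sup>2)\<^sup>2 + ((3 * ?q)\<^sup>2 * D) / (?q\<^sup>2)\<^sup>2"
    proof (intro add_mono divide_right_mono S)
      have "expectation (\<lambda>\<omega>. (\<Sum>k\<in>?I. \<bar>Z k \<omega>\<bar>)\<^sup>2) \<le> (real (card ?I))\<^sup>2 * D" by (rule B) simp
      also have "\<dots> \<le> (3 * ?q)\<^sup>2 * D" by (intro mult_right_mono power_mono card D0) simp
      finally show "expectation (\<lambda>\<omega>. (\<Sum>k\<in>?I. \<bar>Z k \<omega>\<bar>)\<^sup>2) \<le> (3 * ?q)\<^sup>2 * D" .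
    qed auto
    also have "\<dots> = 10 * D * (1 / ?q\<^sup>2)" by (simp add: power_mult_distrib field_simps del: of_nat_Suc)
    finally show ?thesis .
  qed
  have summ: "summable (\<lambda>n. 10 * D * (1 / (real (Suc n))\<^sup>2))"
    using summable_Suc_iff [THEN iffD2, OF inverse_power_summable [of 2, where 'a = real]]
    by (intro summable_mult) (simp add: inverse_eq_divide)
  have "(\<integral>\<^sup>+\<omega>. (\<Sum>n. ennreal (U n \<omega>)) \<partial>M) = (\<Sum>n. \<integral>\<^sup>+\<omega>. ennreal (U n \<omega>) \<partial>M)"
    by (rule nn_integral_suminf) measurable
  also have "\<dots> = (\<Sum>n. ennreal (expectation (U n)))"
    by (intro suminf_cong nn_integral_eq_integral intU AE_I2 U0)
  also have "\<dots> \<le> (\<Sum>n. ennreal (10 * D * (1 / (real (Suc n))\<^sup>2)))"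
    by (intro suminf_le ennreal_leI EU) auto
  also have "\<dots> < \<infinity>" using summ D0 by (simp add: suminf_ennreal2 less_top [symmetric])
  finally have "AE \<omega> in M. (\<Sum>n. ennreal (U n \<omega>)) \<noteq> \<infinity>"
    by (intro nn_integral_PInf_AE) auto
  then show ?thesis
  proof (rule AE_mp, intro AE_I2 impI)
    fix \<omega> assume "(\<Sum>n. ennreal (U n \<omega>)) \<noteq> \<infinity>"
    then have "summable (\<lambda>n. U n \<omega>)" by (intro summable_suminf_not_top U0) simp
    then have "(\<lambda>n. U n \<omega>) \<longlonglongrightarrow> 0" by (rule summable_LIMSEQ_zero)
    then show "(\<lambda>n. (\<Sum>k<n. Z k \<omega>) / n) \<longlonglongrightarrow> 0"
      unfolding U_def by (rule averages_tendsto_zero_along_squares)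
  qed
qed

text \<open>
  Each term is correlated with at most \<open>2 m + 1\<close> terms, so the variance of the partial sums grows linearly.
\<close>

lemma (in prob_space) slln_of_finite_range_dependence:
  fixes Z :: "nat \<Rightarrow> 'a \<Rightarrow> real"
  assumes meas [measurable]: "\<And>k. random_variable borel (Z k)"
    and int: "\<And>k. integrable M (\<lambda>\<omega>. (Z k \<omega>)\<^sup>2)"
    and D: "\<And>k. expectation (\<lambda>\<omega>. (Z k \<omega>)\<^sup>2) \<le> D"
    and uncor: "\<And>j k. j + m < k \<Longrightarrow> expectation (\<lambda>\<omega>. Z j \<omega> * Z k \<omega>) = 0"
  shows "AE \<omega> in M. (\<lambda>n. (\<Sum>k<n. Z k \<omega>) / n) \<longlonglongrightarrow> 0"
proof (rule slln_of_second_moments [OF meas int])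
  let ?D = "real (2 * m + 1) * D"
  have "0 \<le> expectation (\<lambda>\<omega>. (Z 0 \<omega>)\<^sup>2)" by (rule Bochner_Integration.integral_nonneg) simp
  then have D0: "0 \<le> D" using D [of 0] by linarith
  show "expectation (\<lambda>\<omega>. (Z k \<omega>)\<^sup>2) \<le> ?D" for k
    using D [of k] D0 mult_right_mono [of 1 "real (2 * m + 1)" D] by simp
  fix n
  have pw: "\<bar>Z j \<omega> * Z k \<omega>\<bar> \<le> ((Z j \<omega>)\<^sup>2 + (Z k \<omega>)\<^sup>2) / 2" for j k \<omega>
  proof -
    have "0 \<le> (\<bar>Z j \<omega>\<bar> - \<bar>Z k \<omega>\<bar>)\<^sup>2" by simp
    then show ?thesis by (simp add: power2_diff abs_mult)
  qed
  have intp: "integrable M (\<lambda>\<omega>. Z j \<omega> * Z k \<omega>)" for j k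
    by (rule Bochner_Integration.integrable_bound [where f = "\<lambda>\<omega>. ((Z j \<omega>)\<^sup>2 + (Z k \<omega>)\<^sup>2) / 2"])
      (use int pw in \<open>auto intro!: AE_I2\<close>)
  have cov: "expectation (\<lambda>\<omega>. Z j \<omega> * Z k \<omega>) \<le> (if k \<le> j + m \<and> j \<le> k + m then D else 0)" for j k
  proof (cases "k \<le> j + m \<and> j \<le> k + m")
    case True
    have "expectation (\<lambda>\<omega>. Z j \<omega> * Z k \<omega>) \<le> expectation (\<lambda>\<omega>. ((Z j \<omega>)\<^sup>2 + (Z k \<omega>)\<^sup>2) / 2)"
      using pw by (intro integral_mono intp integrable_divide Bochner_Integration.integrable_add int) (meson abs_ge_self order_trans)
    also have "\<dots> = (expectation (\<lambda>\<omega>. (Z j \<omega>)\<^sup>2) + expectation (\<lambda>\<omega>. (Z k \<omega>)\<^sup>2)) / 2" using int by simp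
    also have "\<dots> \<le> D" using D [of j] D [of k] by simp
    finally show ?thesis using True by simp
  next
    case False
    then have "expectation (\<lambda>\<omega>. Z j \<omega> * Z k \<omega>) = 0"
      using uncor [of j k] uncor [of k j] by (auto simp: mult.commute not_le)
    with D0 show ?thesis by simp
  qed
  have "expectation (\<lambda>\<omega>. (\<Sum>k<n. Z k \<omega>)\<^sup>2) = (\<Sum>j<n. \<Sum>k<n. expectation (\<lambda>\<omega>. Z j \<omega> * Z k \<omega>))"
    unfolding power2_eq_square sum_product
    by (simp add: intp)
  also have "\<dots> \<le> (\<Sum>j<n. \<Sum>k<n. if k \<le> j + m \<and> j \<le> k + m then D else 0)" by (intro sum_mono cov)
  also have "\<dots> \<le> (\<Sum>j<n. ?D)"
  proof (rule sum_mono)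
    fix j
    have "(\<Sum>k<n. if k \<le> j + m \<and> j \<le> k + m then D else 0) = real (card ({..<n} \<inter> {k. k \<le> j + m \<and> j \<le> k + m})) * D"
      by (simp add: sum.If_cases)
    also have "\<dots> \<le> real (card {j - m..j + m}) * D"
      using D0 by (intro mult_right_mono of_nat_mono card_mono) auto
    also have "\<dots> \<le> ?D" using D0 by (intro mult_right_mono) auto
    finally show "(\<Sum>k<n. if k \<le> j + m \<and> j \<le> k + m then D else 0) \<le> ?D" .
  qed
  finally show "expectation (\<lambda>\<omega>. (\<Sum>k<n. Z k \<omega>)\<^sup>2) \<le> ?D * real n" by (simp add: mult_ac)
qed

lemma sum5_power_le:
  fixes a b c d :: real
  assumes "0 \<le> a" "0 \<le> b" "0 \<le> c" "0 \<le> d"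
  shows "(1 + a + b + c + d) ^ p \<le> 5 ^ p * (1 + a ^ p + b ^ p + c ^ p + d ^ p)"
proof -
  define m where "m = Max {1, a, b, c, d}"
  have "m \<in> {1, a, b, c, d}" unfolding m_def by (rule Max_in) auto
  then have "m ^ p \<le> 1 + a ^ p + b ^ p + c ^ p + d ^ p"
    using assms by (auto simp: add_nonneg_nonneg)
  moreover have "1 \<le> m" "a \<le> m" "b \<le> m" "c \<le> m" "d \<le> m" by (auto simp: m_def)
  then have "(1 + a + b + c + d) ^ p \<le> (5 * m) ^ p" using assms by (intro power_mono) auto
  ultimately show ?thesis
    by (simp add: power_mult_distrib) (meson mult_left_mono order_trans zero_le_numeral zero_le_power)
qed

lemma convex_power_combination:
  fixes a b r :: real
  assumes "0 \<le> a" "0 \<le> b" "0 \<le> r" "r \<le> 1"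
  shows "(r * a + (1 - r) * b) ^ p \<le> r * a ^ p + (1 - r) * b ^ p"
proof -
  have "convex_on {0::real..} (\<lambda>x. x ^ p)"
    using convex_power_even [of p] convex_power_odd [of p]
    by (cases "even p") (auto intro: convex_on_subset)
  from convex_onD [OF this, of r b a] assms show ?thesis by (simp add: add.commute)
qed

section \<open>Contractive recursions\<close>

text \<open>
  The state recursion enters only through a Lyapunov function that is comparable to the squared norm: it controls the
  size of the state by the size of the noise, and it makes two trajectories with the same noise approach each other.
\<close>

locale contractive_recursion =
  fixes G :: "'x::euclidean_space \<Rightarrow> 'e::euclidean_space \<Rightarrow> 'x" and V :: "'x \<Rightarrow> real" and \<rho> c :: real
  assumes G_measurable: "case_prod G \<in> borel_measurable borel"
    and V_measurable: "V \<in> borel_measurable borel"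
    and \<rho>: "0 \<le> \<rho>" "\<rho> < 1" and c: "1 \<le> c"
    and V_ge: "\<And>x. (norm x)\<^sup>2 \<le> V x" and V_le: "\<And>x. V x \<le> c * (norm x)\<^sup>2"
    and V_step: "\<And>x e. V (G x e) \<le> \<rho> * V x + c * (norm e)\<^sup>2"
    and V_contract: "\<And>x y e. V (G x e - G y e) \<le> \<rho> * V (x - y)"
begin

lemma G_measurable' [measurable]:
  "f \<in> borel_measurable N \<Longrightarrow> g \<in> borel_measurable N \<Longrightarrow> (\<lambda>\<omega>. G (f \<omega>) (g \<omega>)) \<in> borel_measurable N"
  using measurable_compose [OF borel_measurable_Pair G_measurable, of f N g] by simp

declare V_measurable [measurable]

text \<open>
  \<open>traj e j x m\<close> is the state at time \<open>j + m\<close> of the trajectory that is in \<open>x\<close> at time \<open>j\<close>.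
\<close>

primrec traj :: "(nat \<Rightarrow> 'e) \<Rightarrow> nat \<Rightarrow> 'x \<Rightarrow> nat \<Rightarrow> 'x" where
  "traj e j x 0 = x"
| "traj e j x (Suc m) = G (traj e j x m) (e (j + m))"

lemma traj_add: "traj e i x (j + m) = traj e (i + j) (traj e i x j) m"
  by (induction m) (simp_all add: add.assoc)

lemma traj_cong: "(\<And>i. j \<le> i \<Longrightarrow> i < j + m \<Longrightarrow> e i = e' i) \<Longrightarrow> traj e j x m = traj e' j x m"
  by (induction m) simp_all

lemma traj_measurable [measurable (raw)]:
  assumes "\<And>i. j \<le> i \<Longrightarrow> i < j + m \<Longrightarrow> (\<lambda>\<omega>. e \<omega> i) \<in> borel_measurable N"
    and "f \<in> borel_measurable N"
  shows "(\<lambda>\<omega>. traj (e \<omega>) j (f \<omega>) m) \<in> borel_measurable N"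
  using assms(1)
proof (induction m)
  case (Suc m)
  then have "(\<lambda>\<omega>. traj (e \<omega>) j (f \<omega>) m) \<in> borel_measurable N" "(\<lambda>\<omega>. e \<omega> (j + m)) \<in> borel_measurable N" by auto
  then show ?case unfolding traj.simps by measurable
qed (use assms(2) in simp)

lemma V_nonneg: "0 \<le> V x" using V_ge [of x] zero_le_power2 order_trans by blast

lemma V_zero [simp]: "V 0 = 0" using V_le [of 0] V_nonneg [of 0] by simp

text \<open>
  The constant that the convexity of \<open>t \<mapsto> t ^ p\<close> produces when the drift inequality is raised to the power \<open>p\<close>.
\<close>

definition noise_const :: "nat \<Rightarrow> real" where "noise_const p = (1 - \<rho>) * (c / (1 - \<rho>)) ^ p"

lemma noise_const_nonneg: "0 \<le> noise_const p" using \<rho> c by (simp add: noise_const_def)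

lemma V_power_step: "V (G x e) ^ p \<le> \<rho> * V x ^ p + noise_const p * norm e ^ (2 * p)"
proof -
  have "V (G x e) ^ p \<le> (\<rho> * V x + (1 - \<rho>) * (c / (1 - \<rho>) * (norm e)\<^sup>2)) ^ p"
    using V_step [of x e] \<rho> by (intro power_mono V_nonneg) simp
  also have "\<dots> \<le> \<rho> * V x ^ p + (1 - \<rho>) * (c / (1 - \<rho>) * (norm e)\<^sup>2) ^ p"
    using \<rho> c V_nonneg by (intro convex_power_combination) auto
  also have "\<dots> = \<rho> * V x ^ p + noise_const p * norm e ^ (2 * p)"
    by (simp only: noise_const_def power_mult_distrib power_mult mult.assoc)
  finally show ?thesis .
qed

lemma norm_power_le_V: "norm x ^ (2 * p) \<le> V x ^ p"
  using power_mono [OF V_ge [of x], of p] by (simp add: power_mult)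

text \<open>
  Summing the drift inequality telescopes.  This bounds averages of powers of the state by averages of powers of the
  noise, for every single realization.
\<close>

lemma sum_V_power_le:
  "(1 - \<rho>) * (\<Sum>k<n. V (traj e j x k) ^ p) + V (traj e j x n) ^ p
     \<le> V x ^ p + noise_const p * (\<Sum>k<n. norm (e (j + k)) ^ (2 * p))"
proof (induction n)
  case (Suc n)
  have "V (traj e j x (Suc n)) ^ p \<le> \<rho> * V (traj e j x n) ^ p + noise_const p * norm (e (j + n)) ^ (2 * p)"
    unfolding traj.simps by (rule V_power_step)
  with Suc show ?case by (simp add: algebra_simps)
qed simp

lemma V_traj_diff: "V (traj e j x m - traj e j y m) \<le> \<rho> ^ m * V (x - y)"
proof (induction m)
  case (Suc m)
  have "V (traj e j x (Suc m) - traj e j y (Suc m)) \<le> \<rho> * V (traj e j x m - traj e j y m)"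
    unfolding traj.simps by (rule V_contract)
  also have "\<dots> \<le> \<rho> * (\<rho> ^ m * V (x - y))" by (intro mult_left_mono Suc \<rho>)
  finally show ?case by (simp add: mult_ac)
qed simp

lemma norm_traj_diff: "norm (traj e j x m - traj e j 0 m) \<le> sqrt \<rho> ^ m * (c * norm x)"
proof -
  have "(norm (traj e j x m - traj e j 0 m))\<^sup>2 \<le> \<rho> ^ m * (c * (norm x)\<^sup>2)"
    using V_ge [of "traj e j x m - traj e j 0 m"] V_traj_diff [of e j x m 0]
      mult_left_mono [OF V_le [of x], of "\<rho> ^ m"] \<rho> by simp
  also have "\<dots> \<le> \<rho> ^ m * (c\<^sup>2 * (norm x)\<^sup>2)"
    using c \<rho> self_le_power [of c 2] by (intro mult_left_mono mult_right_mono) auto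
  also have "\<dots> = (sqrt \<rho> ^ m * (c * norm x))\<^sup>2"
    using \<rho> by (simp add: power_mult_distrib real_sqrt_power [symmetric])
  finally show ?thesis by (rule power2_le_imp_le) (use \<rho> c in auto)
qed

end

text \<open>
  The local Lipschitz constant is allowed one degree less than the function itself, so that the product with a distance
  of states is again of degree four; the invariant distribution has no more than four moments at hand.
\<close>

locale growth_function =
  fixes g :: "'x::euclidean_space \<Rightarrow> 'e::euclidean_space \<Rightarrow> real" and Cg :: real
  assumes g_measurable: "case_prod g \<in> borel_measurable borel"
    and Cg: "0 \<le> Cg"
    and g_growth: "\<And>x e. \<bar>g x e\<bar> \<le> Cg * (1 + norm x + norm e) ^ 4"
    and g_lipschitz: "\<And>x y e. \<bar>g x e - g y e\<bar> \<le> Cg * norm (x - y) * (1 + norm x + norm y + norm e) ^ 3"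

locale contractive_growth = contractive_recursion G V \<rho> c + growth_function g Cg
  for G :: "'x::euclidean_space \<Rightarrow> 'e::euclidean_space \<Rightarrow> 'x" and V \<rho> c and g :: "'x \<Rightarrow> 'e \<Rightarrow> real" and Cg
begin

lemma g_measurable' [measurable]:
  "f \<in> borel_measurable N \<Longrightarrow> h \<in> borel_measurable N \<Longrightarrow> (\<lambda>\<omega>. g (f \<omega>) (h \<omega>)) \<in> borel_measurable N"
  using measurable_compose [OF borel_measurable_Pair g_measurable, of f N h] by simp

text \<open>
  Replacing the state \<open>m\<close> steps ago by 0 costs a factor that is geometric in \<open>m\<close>.
\<close>

lemma forgetting:
  "\<bar>g (traj e j x m) z - g (traj e j 0 m) z\<bar> \<le> sqrt \<rho> ^ m *
     (Cg * c * 5 ^ 4 * (1 + norm x ^ 4 + norm (traj e j x m) ^ 4 + norm (traj e j 0 m) ^ 4 + norm z ^ 4))"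
proof -
  let ?a = "norm x" and ?b = "norm (traj e j x m)" and ?d = "norm (traj e j 0 m)" and ?z = "norm z"
  let ?W = "1 + ?a + ?b + ?d + ?z"
  have "\<bar>g (traj e j x m) z - g (traj e j 0 m) z\<bar>
      \<le> Cg * norm (traj e j x m - traj e j 0 m) * (1 + ?b + ?d + ?z) ^ 3" by (rule g_lipschitz)
  also have "\<dots> \<le> Cg * (sqrt \<rho> ^ m * (c * ?W)) * ?W ^ 3"
  proof (intro mult_mono mult_left_mono power_mono)
    have "sqrt \<rho> ^ m * (c * ?a) \<le> sqrt \<rho> ^ m * (c * ?W)"
      using \<rho> c by (intro mult_left_mono) auto
    with norm_traj_diff [of e j x m] show "norm (traj e j x m - traj e j 0 m) \<le> sqrt \<rho> ^ m * (c * ?W)"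
      by (rule order_trans)
  qed (use Cg \<rho> c in auto)
  also have "\<dots> = sqrt \<rho> ^ m * (Cg * c * ?W ^ 4)"
    by (simp add: power4_eq_xxxx power3_eq_cube mult_ac)
  also have "\<dots> \<le> sqrt \<rho> ^ m * (Cg * c * (5 ^ 4 * (1 + ?a ^ 4 + ?b ^ 4 + ?d ^ 4 + ?z ^ 4)))"
    using Cg \<rho> c by (intro mult_left_mono sum5_power_le) auto
  finally show ?thesis by (simp only: mult.assoc)
qed

lemma g_square_le: "(g x e)\<^sup>2 \<le> Cg\<^sup>2 * 5 ^ 8 * (1 + norm x ^ 8 + norm e ^ 8)"
proof -
  have "(g x e)\<^sup>2 = \<bar>g x e\<bar>\<^sup>2" by simp
  also have "\<dots> \<le> (Cg * (1 + norm x + norm e) ^ 4)\<^sup>2" by (intro power_mono g_growth) simp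
  also have "\<dots> = Cg\<^sup>2 * (1 + norm x + norm e) ^ 8" by (simp add: power_mult_distrib flip: power_mult)
  also have "\<dots> \<le> Cg\<^sup>2 * (5 ^ 8 * (1 + norm x ^ 8 + norm e ^ 8))"
    using sum5_power_le [of "norm x" "norm e" 0 0 8] by (intro mult_left_mono) auto
  finally show ?thesis by (simp only: mult.assoc)
qed

end

section \<open>Time averages along a contractive recursion driven by independent noise\<close>

lemma power_le_one_add_power:
  fixes a :: real assumes "0 \<le> a" "p \<le> q" shows "a ^ p \<le> 1 + a ^ q"
proof (cases "a \<le> 1")
  case True
  then have "a ^ p \<le> 1" using assms by (simp add: power_le_one)
  with assms show ?thesis by (simp add: add_increasing2)
next
  case False
  then have "a ^ p \<le> a ^ q" using assms by (intro power_increasing) auto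
  then show ?thesis by simp
qed

lemma (in pair_prob_space) distr_snd: "distr (M1 \<Otimes>\<^sub>M M2) M2 snd = M2"
proof (rule measure_eqI)
  fix A assume "A \<in> sets (distr (M1 \<Otimes>\<^sub>M M2) M2 snd)"
  then have A: "A \<in> sets M2" by simp
  then have "snd -` A \<inter> space (M1 \<Otimes>\<^sub>M M2) = space M1 \<times> A"
    using sets.sets_into_space by (auto simp: space_pair_measure)
  with A show "emeasure (distr (M1 \<Otimes>\<^sub>M M2) M2 snd) A = emeasure M2 A"
    by (simp add: emeasure_distr M2.emeasure_pair_measure_Times M1.emeasure_space_1)
qed simp

lemma (in pair_prob_space) integral_comp_fst:
  fixes f :: "'a \<Rightarrow> real"
  assumes "integrable M1 f"
  shows "integrable (M1 \<Otimes>\<^sub>M M2) (\<lambda>z. f (fst z))" "(\<integral>z. f (fst z) \<partial>(M1 \<Otimes>\<^sub>M M2)) = (\<integral>x. f x \<partial>M1)"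
proof -
  have [measurable]: "f \<in> borel_measurable M1" using assms by auto
  have d: "distr (M1 \<Otimes>\<^sub>M M2) M1 fst = M1" by (rule M2.distr_pair_fst)
  show "integrable (M1 \<Otimes>\<^sub>M M2) (\<lambda>z. f (fst z))"
    using assms integrable_distr_eq [of fst "M1 \<Otimes>\<^sub>M M2" M1 f] by (simp add: d)
  show "(\<integral>z. f (fst z) \<partial>(M1 \<Otimes>\<^sub>M M2)) = (\<integral>x. f x \<partial>M1)"
    using integral_distr [of fst "M1 \<Otimes>\<^sub>M M2" M1 f] by (simp add: d)
qed

lemma (in pair_prob_space) integral_comp_snd:
  fixes f :: "'b \<Rightarrow> real"
  assumes "integrable M2 f"
  shows "integrable (M1 \<Otimes>\<^sub>M M2) (\<lambda>z. f (snd z))" "(\<integral>z. f (snd z) \<partial>(M1 \<Otimes>\<^sub>M M2)) = (\<integral>x. f x \<partial>M2)"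
proof -
  have [measurable]: "f \<in> borel_measurable M2" using assms by auto
  show "integrable (M1 \<Otimes>\<^sub>M M2) (\<lambda>z. f (snd z))"
    using assms integrable_distr_eq [of snd "M1 \<Otimes>\<^sub>M M2" M2 f] by (simp add: distr_snd)
  show "(\<integral>z. f (snd z) \<partial>(M1 \<Otimes>\<^sub>M M2)) = (\<integral>x. f x \<partial>M2)"
    using integral_distr [of snd "M1 \<Otimes>\<^sub>M M2" M2 f] by (simp add: distr_snd)
qed

locale driven_process = contractive_growth G V \<rho> c g Cg + prob_space M
  for G :: "'x::euclidean_space \<Rightarrow> 'e::euclidean_space \<Rightarrow> 'x" and V \<rho> c
    and g :: "'x \<Rightarrow> 'e \<Rightarrow> real" and Cg and M :: "'w measure" +
  fixes \<eta> :: "nat \<Rightarrow> 'w \<Rightarrow> 'e" and \<gamma> :: "'e measure" and \<mu> :: "'x measure" and x0 :: 'x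
  assumes indep: "indep_vars (\<lambda>_. borel) \<eta> UNIV"
    and law: "\<And>k. distr M borel (\<eta> k) = \<gamma>"
    and moment: "integrable \<gamma> (\<lambda>e. norm e ^ 8)"
    and \<mu>_prob: "prob_space \<mu>" and sets_\<mu> [measurable_cong]: "sets \<mu> = sets borel"
    and \<mu>_moment: "integrable \<mu> (\<lambda>x. norm x ^ 4)"
    and stationary: "\<And>h :: 'x \<Rightarrow> ennreal. h \<in> borel_measurable borel \<Longrightarrow>
        (\<integral>\<^sup>+x. h x \<partial>\<mu>) = (\<integral>\<^sup>+x. (\<integral>\<^sup>+e. h (G x e) \<partial>\<gamma>) \<partial>\<mu>)"
begin

lemma \<eta>_measurable [measurable]: "random_variable borel (\<eta> k)"
  using indep by (simp add: indep_vars_def)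

lemma sets_\<gamma> [measurable_cong]: "sets \<gamma> = sets borel"
  by (simp flip: law [of 0])

sublocale \<gamma>: prob_space \<gamma>
  using prob_space_distr [OF \<eta>_measurable [of 0]] by (simp only: law)

sublocale \<mu>: prob_space \<mu> by (rule \<mu>_prob)

sublocale \<mu>M: pair_prob_space \<mu> M ..

sublocale \<mu>\<gamma>: pair_prob_space \<mu> \<gamma> ..

abbreviation noise :: "'w \<Rightarrow> nat \<Rightarrow> 'e" where "noise \<omega> \<equiv> (\<lambda>i. \<eta> i \<omega>)"

lemma traj_noise_measurable [measurable]: "(\<lambda>\<omega>. traj (noise \<omega>) j x m) \<in> borel_measurable M"
  by (rule traj_measurable) measurable

lemma traj_noise_pair_measurable [measurable]:
  "(\<lambda>z. traj (noise (snd z)) j (fst z) m) \<in> borel_measurable (\<mu> \<Otimes>\<^sub>M M)"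
  by (rule traj_measurable) measurable

text \<open>
  Independence of two blocks of noise, written as a double integral over two copies of the probability space.
\<close>

lemma nn_integral_indep_blocks:
  assumes "A \<inter> B = {}"
    and h [measurable]: "h \<in> borel_measurable (PiM A (\<lambda>_. borel) \<Otimes>\<^sub>M PiM B (\<lambda>_. borel))"
  shows "(\<integral>\<^sup>+\<omega>. h (restrict (noise \<omega>) A, restrict (noise \<omega>) B) \<partial>M)
       = (\<integral>\<^sup>+\<omega>. (\<integral>\<^sup>+\<omega>'. h (restrict (noise \<omega>) A, restrict (noise \<omega>') B) \<partial>M) \<partial>M)"
proof -
  let ?PA = "PiM A (\<lambda>_. borel :: 'e measure)" and ?PB = "PiM B (\<lambda>_. borel :: 'e measure)"
  let ?fA = "\<lambda>\<omega>. restrict (noise \<omega>) A" and ?fB = "\<lambda>\<omega>. restrict (noise \<omega>) B"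
  have mA [measurable]: "?fA \<in> measurable M ?PA" and mB [measurable]: "?fB \<in> measurable M ?PB" by measurable
  have eq: "distr M ?PA ?fA \<Otimes>\<^sub>M distr M ?PB ?fB = distr M (?PA \<Otimes>\<^sub>M ?PB) (\<lambda>\<omega>. (?fA \<omega>, ?fB \<omega>))"
    using indep_var_restrict [OF indep assms(1)] by (simp add: indep_var_distribution_eq)
  interpret B: prob_space "distr M ?PB ?fB" by (rule prob_space_distr) measurable
  have "(\<integral>\<^sup>+\<omega>. h (?fA \<omega>, ?fB \<omega>) \<partial>M) = (\<integral>\<^sup>+z. h z \<partial>distr M (?PA \<Otimes>\<^sub>M ?PB) (\<lambda>\<omega>. (?fA \<omega>, ?fB \<omega>)))"
    by (simp add: nn_integral_distr)
  also have "\<dots> = (\<integral>\<^sup>+a. (\<integral>\<^sup>+b. h (a, b) \<partial>distr M ?PB ?fB) \<partial>distr M ?PA ?fA)"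
    unfolding eq [symmetric] using h by (subst B.nn_integral_fst) auto
  also have "\<dots> = (\<integral>\<^sup>+a. (\<integral>\<^sup>+\<omega>'. h (a, ?fB \<omega>') \<partial>M) \<partial>distr M ?PA ?fA)"
    by (simp add: nn_integral_distr)
  also have "\<dots> = (\<integral>\<^sup>+\<omega>. (\<integral>\<^sup>+\<omega>'. h (?fA \<omega>, ?fB \<omega>') \<partial>M) \<partial>M)"
    by (simp add: nn_integral_distr)
  finally show ?thesis .
qed

lemma nn_integral_fresh_noise:
  assumes h [measurable]: "case_prod h \<in> borel_measurable (borel \<Otimes>\<^sub>M borel)"
  shows "(\<integral>\<^sup>+\<omega>. h (traj (noise \<omega>) j x m) (\<eta> (j + m) \<omega>) \<partial>M)
       = (\<integral>\<^sup>+\<omega>. (\<integral>\<^sup>+e. h (traj (noise \<omega>) j x m) e \<partial>\<gamma>) \<partial>M)"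
proof -
  let ?A = "{j..<j + m}" and ?B = "{j + m}"
  have traj: "traj (restrict (noise \<omega>) ?A) j x m = traj (noise \<omega>) j x m" for \<omega>
    by (rule traj_cong) simp
  have [measurable]: "(\<lambda>e. traj e j x m) \<in> borel_measurable (PiM ?A (\<lambda>_. borel))"
    by (rule traj_measurable) measurable
  have "(\<integral>\<^sup>+\<omega>. h (traj (noise \<omega>) j x m) (\<eta> (j + m) \<omega>) \<partial>M)
      = (\<integral>\<^sup>+\<omega>. (\<integral>\<^sup>+\<omega>'. h (traj (noise \<omega>) j x m) (\<eta> (j + m) \<omega>') \<partial>M) \<partial>M)"
    using nn_integral_indep_blocks [of ?A ?B "\<lambda>(a, b). h (traj a j x m) (b (j + m))"] by (simp add: traj)
  also have "\<dots> = (\<integral>\<^sup>+\<omega>. (\<integral>\<^sup>+e. h (traj (noise \<omega>) j x m) e \<partial>\<gamma>) \<partial>M)"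
    unfolding law [of "j + m", symmetric]
    by (intro nn_integral_cong nn_integral_distr [symmetric]) measurable
  finally show ?thesis .
qed

text \<open>
  The transition operator of the Markov chain of states.  Iterating it shows at once that the law of a trajectory does
  not depend on its starting time and that \<open>\<mu>\<close> is preserved.
\<close>

definition transition :: "('x \<Rightarrow> ennreal) \<Rightarrow> 'x \<Rightarrow> ennreal" where
  "transition h x = (\<integral>\<^sup>+e. h (G x e) \<partial>\<gamma>)"

lemma transition_measurable [measurable]:
  assumes [measurable]: "h \<in> borel_measurable borel"
  shows "transition h \<in> borel_measurable borel"
  unfolding transition_def by measurable

lemma transition_pow_measurable [measurable]: "h \<in> borel_measurable borel \<Longrightarrow> (transition ^^ m) h \<in> borel_measurable borel"
  by (induction m) (auto intro: transition_measurable)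

lemma nn_integral_traj:
  assumes "h \<in> borel_measurable borel"
  shows "(\<integral>\<^sup>+\<omega>. h (traj (noise \<omega>) j x m) \<partial>M) = (transition ^^ m) h x"
  using assms
proof (induction m arbitrary: h)
  case 0 then show ?case by (simp add: emeasure_space_1)
next
  case (Suc m)
  note [measurable] = Suc.prems
  have "(\<integral>\<^sup>+\<omega>. h (traj (noise \<omega>) j x (Suc m)) \<partial>M)
      = (\<integral>\<^sup>+\<omega>. transition h (traj (noise \<omega>) j x m) \<partial>M)"
    unfolding traj.simps transition_def by (rule nn_integral_fresh_noise) measurable
  also have "\<dots> = (transition ^^ m) (transition h) x" by (rule Suc.IH) measurable
  finally show ?case by (simp add: funpow_swap1)
qed

lemma nn_integral_transition_pow:
  assumes "h \<in> borel_measurable borel"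
  shows "(\<integral>\<^sup>+x. (transition ^^ m) h x \<partial>\<mu>) = (\<integral>\<^sup>+x. h x \<partial>\<mu>)"
proof (induction m)
  case (Suc m)
  then show ?case
    using stationary [OF transition_pow_measurable [OF assms, of m]]
    by (simp only: funpow.simps o_def transition_def [of "(transition ^^ m) h"])
qed simp

lemma nn_integral_joint:
  assumes h [measurable]: "case_prod h \<in> borel_measurable (borel \<Otimes>\<^sub>M borel)"
  shows "(\<integral>\<^sup>+\<omega>. h (traj (noise \<omega>) j x m) (\<eta> (j + m) \<omega>) \<partial>M) = (transition ^^ m) (\<lambda>x. \<integral>\<^sup>+e. h x e \<partial>\<gamma>) x"
  unfolding nn_integral_fresh_noise [OF h] by (rule nn_integral_traj) measurable

lemma distr_joint:
  "distr M (borel \<Otimes>\<^sub>M borel) (\<lambda>\<omega>. (traj (noise \<omega>) j x m, \<eta> (j + m) \<omega>))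
     = distr M (borel \<Otimes>\<^sub>M borel) (\<lambda>\<omega>. (traj (noise \<omega>) 0 x m, \<eta> m \<omega>))" (is "?L = ?R")
proof (rule measure_eqI)
  fix A assume "A \<in> sets ?L"
  then have A [measurable]: "A \<in> sets (borel \<Otimes>\<^sub>M borel)" by simp
  have "emeasure ?L A = (\<integral>\<^sup>+\<omega>. indicator A (traj (noise \<omega>) j x m, \<eta> (j + m) \<omega>) \<partial>M)"
    by (subst nn_integral_indicator [symmetric], simp, subst nn_integral_distr) measurable
  also have "\<dots> = (\<integral>\<^sup>+\<omega>. indicator A (traj (noise \<omega>) 0 x m, \<eta> m \<omega>) \<partial>M)"
    using nn_integral_joint [of "\<lambda>a b. indicator A (a, b)" j x m]
      nn_integral_joint [of "\<lambda>a b. indicator A (a, b)" 0 x m] by simp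
  also have "\<dots> = emeasure ?R A"
    by (subst nn_integral_indicator [symmetric], simp, subst nn_integral_distr) measurable
  finally show "emeasure ?L A = emeasure ?R A" .
qed simp

lemma distr_stationary:
  "distr (\<mu> \<Otimes>\<^sub>M M) (borel \<Otimes>\<^sub>M borel) (\<lambda>z. (traj (noise (snd z)) 0 (fst z) m, \<eta> m (snd z))) = \<mu> \<Otimes>\<^sub>M \<gamma>" (is "?L = ?R")
proof (rule measure_eqI)
  show "sets ?L = sets ?R" by (simp add: sets_\<mu> sets_\<gamma> cong: sets_pair_measure_cong)
  fix A assume "A \<in> sets ?L"
  then have A [measurable]: "A \<in> sets (borel \<Otimes>\<^sub>M borel)" by simp
  have A' [measurable]: "A \<in> sets (\<mu> \<Otimes>\<^sub>M \<gamma>)"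
    using A by (simp add: sets_\<mu> sets_\<gamma> cong: sets_pair_measure_cong)
  have "emeasure ?L A = (\<integral>\<^sup>+z. indicator A (traj (noise (snd z)) 0 (fst z) m, \<eta> m (snd z)) \<partial>(\<mu> \<Otimes>\<^sub>M M))"
    by (subst nn_integral_indicator [symmetric], simp, subst nn_integral_distr) measurable
  also have "\<dots> = (\<integral>\<^sup>+x. \<integral>\<^sup>+\<omega>. indicator A (traj (noise \<omega>) 0 x m, \<eta> m \<omega>) \<partial>M \<partial>\<mu>)"
  proof (subst nn_integral_fst [symmetric])
    show "(\<lambda>z. indicator A (traj (noise (snd z)) 0 (fst z) m, \<eta> m (snd z)) :: ennreal)
        \<in> borel_measurable (\<mu> \<Otimes>\<^sub>M M)"
      by (rule measurable_compose [OF _ borel_measurable_indicator [OF A]]) measurable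
  qed simp
  also have "\<dots> = (\<integral>\<^sup>+x. (transition ^^ m) (\<lambda>x. \<integral>\<^sup>+e. indicator A (x, e) \<partial>\<gamma>) x \<partial>\<mu>)"
    using nn_integral_joint [of "\<lambda>a b. indicator A (a, b)" 0 _ m] by simp
  also have "\<dots> = (\<integral>\<^sup>+x. \<integral>\<^sup>+e. indicator A (x, e) \<partial>\<gamma> \<partial>\<mu>)"
    by (rule nn_integral_transition_pow) measurable
  also have "\<dots> = emeasure ?R A"
    by (subst \<gamma>.nn_integral_fst) (use A' in simp_all)
  finally show "emeasure ?L A = emeasure ?R A" .
qed

lemma integrable_\<gamma>_power: "p \<le> 8 \<Longrightarrow> integrable \<gamma> (\<lambda>e. norm e ^ p)"
  by (rule Bochner_Integration.integrable_bound [of \<gamma> "\<lambda>e. 1 + norm e ^ 8"])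
    (use moment power_le_one_add_power [of "norm _" p 8] in auto)

lemma integrable_noise_power: "p \<le> 8 \<Longrightarrow> integrable M (\<lambda>\<omega>. norm (\<eta> k \<omega>) ^ p)"
  using integrable_\<gamma>_power [of p] unfolding law [of k, symmetric] by (simp add: integrable_distr_eq)

lemma integral_noise_power: "expectation (\<lambda>\<omega>. norm (\<eta> k \<omega>) ^ p) = (\<integral>e. norm e ^ p \<partial>\<gamma>)"
  unfolding law [of k, symmetric] by (subst integral_distr) measurable

lemma V_moments:
  assumes p: "2 * p \<le> 8" "0 < p"
  shows "integrable M (\<lambda>\<omega>. V (traj (noise \<omega>) j 0 m) ^ p)"
    and "expectation (\<lambda>\<omega>. V (traj (noise \<omega>) j 0 m) ^ p) \<le> noise_const p * (\<integral>e. norm e ^ (2 * p) \<partial>\<gamma>) / (1 - \<rho>)"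
proof -
  let ?E = "noise_const p * (\<integral>e. norm e ^ (2 * p) \<partial>\<gamma>)"
  let ?V = "\<lambda>m \<omega>. V (traj (noise \<omega>) j 0 m) ^ p"
  have step: "?V (Suc m) \<omega> \<le> \<rho> * ?V m \<omega> + noise_const p * norm (\<eta> (j + m) \<omega>) ^ (2 * p)" for m \<omega>
    unfolding traj.simps by (rule V_power_step)
  have E0: "0 \<le> ?E" by (intro mult_nonneg_nonneg noise_const_nonneg integral_nonneg) simp
  have "integrable M (?V m) \<and> expectation (?V m) \<le> ?E / (1 - \<rho>)"
  proof (induction m)
    case 0 then show ?case using E0 \<rho> p(2) by (simp add: zero_power)
  next
    case (Suc m)
    have int: "integrable M (\<lambda>\<omega>. \<rho> * ?V m \<omega> + noise_const p * norm (\<eta> (j + m) \<omega>) ^ (2 * p))"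
      using Suc integrable_noise_power [OF p(1)] by auto
    have "integrable M (?V (Suc m))"
      by (rule Bochner_Integration.integrable_bound [OF int])
        (measurable, use step V_nonneg in \<open>auto intro!: AE_I2 order_trans [OF _ abs_ge_self]\<close>)
    moreover have "expectation (?V (Suc m)) \<le> expectation (\<lambda>\<omega>. \<rho> * ?V m \<omega> + noise_const p * norm (\<eta> (j + m) \<omega>) ^ (2 * p))"
      by (intro integral_mono calculation int step)
    moreover have "\<dots> = \<rho> * expectation (?V m) + ?E"
      using Suc integrable_noise_power [OF p(1)] by (subst Bochner_Integration.integral_add) (auto simp: integral_noise_power)
    moreover have "\<rho> * expectation (?V m) \<le> \<rho> * (?E / (1 - \<rho>))" using Suc \<rho> by (intro mult_left_mono) auto
    moreover have "\<rho> * (?E / (1 - \<rho>)) + ?E = ?E / (1 - \<rho>)" using \<rho> by (simp add: field_simps)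
    ultimately show ?case by linarith
  qed
  then show "integrable M (?V m)" "expectation (?V m) \<le> ?E / (1 - \<rho>)" by auto
qed

text \<open>
  The mean of \<open>g\<close> when the state was 0 exactly \<open>m\<close> steps earlier.
\<close>

definition mean_after :: "nat \<Rightarrow> real" where
  "mean_after m = expectation (\<lambda>\<omega>. g (traj (noise \<omega>) 0 0 m) (\<eta> m \<omega>))"

definition mean_stationary :: real where
  "mean_stationary = (\<integral>z. g (fst z) (snd z) \<partial>(\<mu> \<Otimes>\<^sub>M \<gamma>))"

lemma distr_joint_integral:
  assumes [measurable]: "case_prod f \<in> borel_measurable (borel \<Otimes>\<^sub>M borel)"
  shows "expectation (\<lambda>\<omega>. f (traj (noise \<omega>) j x m) (\<eta> (j + m) \<omega>)) = expectation (\<lambda>\<omega>. f (traj (noise \<omega>) 0 x m) (\<eta> m \<omega>) :: real)"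
proof -
  have "expectation (\<lambda>\<omega>. case_prod f (traj (noise \<omega>) j x m, \<eta> (j + m) \<omega>))
      = expectation (\<lambda>\<omega>. case_prod f (traj (noise \<omega>) 0 x m, \<eta> m \<omega>))"
    by (subst (1 2) integral_distr [symmetric, where N = "borel \<Otimes>\<^sub>M borel"])
      (simp_all add: distr_joint)
  then show ?thesis by simp
qed

lemma traj_power_moments:
  assumes "2 * p \<le> 8" "0 < p"
  shows "integrable M (\<lambda>\<omega>. norm (traj (noise \<omega>) j 0 m) ^ (2 * p))"
    and "expectation (\<lambda>\<omega>. norm (traj (noise \<omega>) j 0 m) ^ (2 * p)) \<le> noise_const p * (\<integral>e. norm e ^ (2 * p) \<partial>\<gamma>) / (1 - \<rho>)"
proof -
  show int: "integrable M (\<lambda>\<omega>. norm (traj (noise \<omega>) j 0 m) ^ (2 * p))"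
    by (rule Bochner_Integration.integrable_bound [OF V_moments(1) [OF assms, of j m]])
      (use norm_power_le_V V_nonneg in \<open>auto intro!: AE_I2\<close>)
  have "expectation (\<lambda>\<omega>. norm (traj (noise \<omega>) j 0 m) ^ (2 * p)) \<le> expectation (\<lambda>\<omega>. V (traj (noise \<omega>) j 0 m) ^ p)"
    by (intro integral_mono int V_moments assms norm_power_le_V)
  also note V_moments(2) [OF assms, of j m]
  finally show "expectation (\<lambda>\<omega>. norm (traj (noise \<omega>) j 0 m) ^ (2 * p)) \<le> noise_const p * (\<integral>e. norm e ^ (2 * p) \<partial>\<gamma>) / (1 - \<rho>)" .
qed

lemma integrable_growth:
  fixes X :: "'b \<Rightarrow> 'x" and Z :: "'b \<Rightarrow> 'e"
  assumes "finite_measure N" and [measurable]: "X \<in> borel_measurable N" "Z \<in> borel_measurable N"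
    and X: "integrable N (\<lambda>z. norm (X z) ^ 4)" and Z: "integrable N (\<lambda>z. norm (Z z) ^ 4)"
  shows "integrable N (\<lambda>z. g (X z) (Z z))"
proof (rule Bochner_Integration.integrable_bound)
  interpret finite_measure N by (rule assms(1))
  show "integrable N (\<lambda>z. Cg * 5 ^ 4 * (1 + norm (X z) ^ 4 + norm (Z z) ^ 4))"
    using X Z by auto
  show "AE z in N. norm (g (X z) (Z z)) \<le> norm (Cg * 5 ^ 4 * (1 + norm (X z) ^ 4 + norm (Z z) ^ 4))"
  proof (rule AE_I2)
    fix z
    have "\<bar>g (X z) (Z z)\<bar> \<le> Cg * (1 + norm (X z) + norm (Z z)) ^ 4" by (rule g_growth)
    also have "\<dots> \<le> Cg * (5 ^ 4 * (1 + norm (X z) ^ 4 + norm (Z z) ^ 4))"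
      using sum5_power_le [of "norm (X z)" "norm (Z z)" 0 0 4] Cg by (intro mult_left_mono) auto
    finally show "norm (g (X z) (Z z)) \<le> norm (Cg * 5 ^ 4 * (1 + norm (X z) ^ 4 + norm (Z z) ^ 4))"
      by (simp only: mult.assoc real_norm_def)
  qed
qed measurable

text \<open>
  Couple two trajectories through the same noise, one from 0 and one from a random state with law \<open>\<mu>\<close>; the latter stays
  stationary.
\<close>

lemma mean_after_close: "\<exists>C\<ge>0. \<forall>m. \<bar>mean_after m - mean_stationary\<bar> \<le> C * sqrt \<rho> ^ m"
proof -
  let ?P = "\<mu> \<Otimes>\<^sub>M M"
  let ?t = "\<lambda>m z. traj (noise (snd z)) 0 (fst z) m"
  let ?s = "\<lambda>m z. traj (noise (snd z)) 0 0 m"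
  define I where "I = (\<integral>x. norm x ^ 4 \<partial>\<mu>)"
  define N where "N = (\<integral>e. norm e ^ 4 \<partial>\<gamma>)"
  define K where "K = Cg * c * 5 ^ 4 * (1 + I + I + noise_const 2 * N / (1 - \<rho>) + N)"
  have fst4: "integrable ?P (\<lambda>z. norm (fst z) ^ 4)" "(\<integral>z. norm (fst z) ^ 4 \<partial>?P) = I"
    using \<mu>M.integral_comp_fst [OF \<mu>_moment] by (simp_all add: I_def)
  have t4: "integrable ?P (\<lambda>z. norm (?t m z) ^ 4)" "(\<integral>z. norm (?t m z) ^ 4 \<partial>?P) = I" for m
  proof -
    have "integrable (\<mu> \<Otimes>\<^sub>M \<gamma>) (\<lambda>z. norm (fst z) ^ 4)" "(\<integral>z. norm (fst z) ^ 4 \<partial>(\<mu> \<Otimes>\<^sub>M \<gamma>)) = I"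
      using \<mu>\<gamma>.integral_comp_fst [OF \<mu>_moment] by (simp_all add: I_def)
    then show "integrable ?P (\<lambda>z. norm (?t m z) ^ 4)" "(\<integral>z. norm (?t m z) ^ 4 \<partial>?P) = I"
      unfolding distr_stationary [of m, symmetric] by (simp_all add: integrable_distr_eq integral_distr)
  qed
  have int0: "integrable M (\<lambda>\<omega>. norm (traj (noise \<omega>) 0 0 m) ^ 4)"
    and E0: "expectation (\<lambda>\<omega>. norm (traj (noise \<omega>) 0 0 m) ^ 4) \<le> noise_const 2 * N / (1 - \<rho>)" for m
    using traj_power_moments [of 2 0 m] by (simp_all add: N_def)
  have inte: "integrable M (\<lambda>\<omega>. norm (\<eta> m \<omega>) ^ 4)" and Ee: "expectation (\<lambda>\<omega>. norm (\<eta> m \<omega>) ^ 4) = N" for m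
    using integrable_noise_power [of 4 m] integral_noise_power [of m 4] by (simp_all add: N_def)
  note t04 = \<mu>M.integral_comp_snd [OF int0] and e4 = \<mu>M.integral_comp_snd [OF inte]
  have "\<bar>mean_after m - mean_stationary\<bar> \<le> K * sqrt \<rho> ^ m" for m
  proof -
    have m1: "mean_stationary = (\<integral>z. g (?t m z) (\<eta> m (snd z)) \<partial>?P)"
      unfolding mean_stationary_def distr_stationary [of m, symmetric]
      by (subst integral_distr) (simp_all, measurable)
    have i1: "integrable ?P (\<lambda>z. g (?t m z) (\<eta> m (snd z)))"
      by (intro integrable_growth t4(1) e4(1) \<mu>M.finite_measure_axioms) measurable
    have i2: "integrable ?P (\<lambda>z. g (?s m z) (\<eta> m (snd z)))"
      by (intro integrable_growth t04(1) e4(1) \<mu>M.finite_measure_axioms) measurable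
    have i3: "integrable M (\<lambda>\<omega>. g (traj (noise \<omega>) 0 0 m) (\<eta> m \<omega>))"
      by (intro integrable_growth int0 inte finite_measure_axioms) measurable
    have m2: "mean_after m = (\<integral>z. g (?s m z) (\<eta> m (snd z)) \<partial>?P)"
      unfolding mean_after_def using \<mu>M.integral_comp_snd(2) [OF i3] by simp
    have "\<bar>mean_after m - mean_stationary\<bar> = \<bar>\<integral>z. g (?t m z) (\<eta> m (snd z)) - g (?s m z) (\<eta> m (snd z)) \<partial>?P\<bar>"
      unfolding m1 m2 by (subst Bochner_Integration.integral_diff [OF i1 i2]) simp
    also have "\<dots> \<le> (\<integral>z. \<bar>g (?t m z) (\<eta> m (snd z)) - g (?s m z) (\<eta> m (snd z))\<bar> \<partial>?P)"
      by (rule integral_abs_bound)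
    also have "\<dots> \<le> (\<integral>z. sqrt \<rho> ^ m * (Cg * c * 5 ^ 4 * (1 + norm (fst z) ^ 4 + norm (?t m z) ^ 4
        + norm (?s m z) ^ 4 + norm (\<eta> m (snd z)) ^ 4)) \<partial>?P)"
      by (intro integral_mono integrable_abs Bochner_Integration.integrable_diff i1 i2 integrable_mult_right
          Bochner_Integration.integrable_add fst4(1) t4(1) t04(1) e4(1) \<mu>M.integrable_const forgetting)
    also have "\<dots> = sqrt \<rho> ^ m * (Cg * c * 5 ^ 4 * (1 + I + I + expectation (\<lambda>\<omega>. norm (traj (noise \<omega>) 0 0 m) ^ 4) + N))"
      by (simp add: fst4 t4 t04 e4 Ee \<mu>M.prob_space)
    also have "\<dots> \<le> sqrt \<rho> ^ m * K"
      unfolding K_def using E0 [of m] Cg c \<rho> by (intro mult_left_mono add_mono) auto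
    finally show ?thesis by (simp add: mult.commute)
  qed
  moreover have "0 \<le> K" using Cg c \<rho> noise_const_nonneg [of 2] by (simp add: K_def I_def N_def)
  ultimately show ?thesis by blast
qed

lemma expectation_indep_blocks:
  fixes f h :: "(nat \<Rightarrow> 'e) \<Rightarrow> real"
  assumes AB: "A \<inter> B = {}"
    and f: "f \<in> borel_measurable (PiM A (\<lambda>_. borel))" and h: "h \<in> borel_measurable (PiM B (\<lambda>_. borel))"
    and int: "integrable M (\<lambda>\<omega>. f (restrict (noise \<omega>) A))" "integrable M (\<lambda>\<omega>. h (restrict (noise \<omega>) B))"
  shows "expectation (\<lambda>\<omega>. f (restrict (noise \<omega>) A) * h (restrict (noise \<omega>) B))
       = expectation (\<lambda>\<omega>. f (restrict (noise \<omega>) A)) * expectation (\<lambda>\<omega>. h (restrict (noise \<omega>) B))"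
  using indep_var_lebesgue_integral [OF indep_var_compose [OF indep_var_restrict [OF indep AB] f h]] int
  by (simp add: o_def)

text \<open>
  This makes the forgetting error uniform over long trajectories.
\<close>

lemma noise_average_bounded: "AE \<omega> in M. \<exists>A. \<forall>n. (\<Sum>k<n. norm (\<eta> k \<omega>) ^ 4) \<le> A * real n"
proof -
  define N where "N = (\<integral>e. norm e ^ 4 \<partial>\<gamma>)"
  define Z where "Z k = (\<lambda>\<omega>. norm (\<eta> k \<omega>) ^ 4 - N)" for k
  have int4: "integrable M (\<lambda>\<omega>. norm (\<eta> k \<omega>) ^ 4)" for k by (rule integrable_noise_power) simp
  have int8: "integrable M (\<lambda>\<omega>. norm (\<eta> k \<omega>) ^ 8)" for k by (rule integrable_noise_power) simp
  have EN: "expectation (\<lambda>\<omega>. norm (\<eta> k \<omega>) ^ 4) = N" for k by (simp add: integral_noise_power N_def)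
  have Z2: "(Z k \<omega>)\<^sup>2 = norm (\<eta> k \<omega>) ^ 8 - 2 * N * norm (\<eta> k \<omega>) ^ 4 + N\<^sup>2" for k \<omega>
    by (simp add: Z_def power2_diff flip: power_mult)
  have "AE \<omega> in M. (\<lambda>n. (\<Sum>k<n. Z k \<omega>) / n) \<longlonglongrightarrow> 0"
  proof (rule slln_of_finite_range_dependence [where m = 0 and D = "(\<integral>e. norm e ^ 8 \<partial>\<gamma>)"])
    show "random_variable borel (Z k)" for k unfolding Z_def by measurable
    show "integrable M (\<lambda>\<omega>. (Z k \<omega>)\<^sup>2)" for k unfolding Z2 using int4 int8 by auto
    have "expectation (\<lambda>\<omega>. (Z k \<omega>)\<^sup>2) = (\<integral>e. norm e ^ 8 \<partial>\<gamma>) - 2 * N * N + N\<^sup>2" for k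
      unfolding Z2 using int4 int8 by (simp add: EN integral_noise_power prob_space)
    then show "expectation (\<lambda>\<omega>. (Z k \<omega>)\<^sup>2) \<le> (\<integral>e. norm e ^ 8 \<partial>\<gamma>)" for k
      by (simp add: power2_eq_square)
    show "expectation (\<lambda>\<omega>. Z j \<omega> * Z k \<omega>) = 0" if "j + 0 < k" for j k
    proof -
      have "expectation (\<lambda>\<omega>. Z j \<omega> * Z k \<omega>) = expectation (Z j) * expectation (Z k)"
        using expectation_indep_blocks [of "{j}" "{k}" "\<lambda>e. norm (e j) ^ 4 - N" "\<lambda>e. norm (e k) ^ 4 - N"] that int4
        by (simp add: Z_def)
      also have "expectation (Z j) = 0" unfolding Z_def using int4 [of j] by (simp add: EN prob_space)
      finally show ?thesis by simp
    qed
  qed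
  then show ?thesis
  proof (rule AE_mp, intro AE_I2 impI)
    fix \<omega> assume "(\<lambda>n. (\<Sum>k<n. Z k \<omega>) / n) \<longlonglongrightarrow> 0"
    then have "Bseq (\<lambda>n. (\<Sum>k<n. Z k \<omega>) / n)" by (intro convergent_imp_Bseq convergentI)
    then obtain A where A: "\<And>n. \<bar>(\<Sum>k<n. Z k \<omega>) / real n\<bar> \<le> A" unfolding Bseq_def by auto
    show "\<exists>A. \<forall>n. (\<Sum>k<n. norm (\<eta> k \<omega>) ^ 4) \<le> A * real n"
    proof (intro exI allI)
      fix n
      show "(\<Sum>k<n. norm (\<eta> k \<omega>) ^ 4) \<le> (A + N) * real n"
      proof (cases "n = 0")
        case False
        then have "(\<Sum>k<n. Z k \<omega>) \<le> A * real n" using A [of n] by (simp add: abs_le_iff field_simps)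
        moreover have "(\<Sum>k<n. Z k \<omega>) = (\<Sum>k<n. norm (\<eta> k \<omega>) ^ 4) - real n * N"
          by (simp add: Z_def sum_subtractf)
        ultimately show ?thesis by (simp add: algebra_simps)
      qed simp
    qed
  qed
qed

lemma finite_memory_slln:
  "AE \<omega> in M. (\<lambda>n. (\<Sum>k<n. if k < m then 0 else g (traj (noise \<omega>) (k - m) 0 m) (\<eta> k \<omega>) - mean_after m) / n) \<longlonglongrightarrow> 0"
proof -
  define Y where "Y k = (\<lambda>\<omega>. g (traj (noise \<omega>) (k - m) 0 m) (\<eta> k \<omega>))" for k
  \<comment> \<open>The case \<open>k < m\<close> is excluded from the sums because \<open>k - m\<close> is
    truncated there.\<close>
  define Z where "Z k \<omega> = (if k < m then 0 else Y k \<omega> - mean_after m)" for k \<omega>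
  have [measurable]: "random_variable borel (Y k)" for k unfolding Y_def by measurable
  define E where "E = noise_const 4 * (\<integral>e. norm e ^ 8 \<partial>\<gamma>) / (1 - \<rho>)"
  define D where "D = Cg\<^sup>2 * 5 ^ 8 * (1 + E + (\<integral>e. norm e ^ 8 \<partial>\<gamma>))"
  let ?bound = "\<lambda>k \<omega>. Cg\<^sup>2 * 5 ^ 8 * (1 + norm (traj (noise \<omega>) (k - m) 0 m) ^ 8 + norm (\<eta> k \<omega>) ^ 8)"
  have int8: "integrable M (\<lambda>\<omega>. norm (\<eta> k \<omega>) ^ 8)" for k by (rule integrable_noise_power) simp
  have tr8: "integrable M (\<lambda>\<omega>. norm (traj (noise \<omega>) j 0 m) ^ 8)"
    "expectation (\<lambda>\<omega>. norm (traj (noise \<omega>) j 0 m) ^ 8) \<le> E" for j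
    using traj_power_moments [of 4 j m] by (simp_all add: E_def)
  have ib: "integrable M (?bound k)" for k using int8 tr8(1) by auto
  have intY2: "integrable M (\<lambda>\<omega>. (Y k \<omega>)\<^sup>2)" for k
    by (rule Bochner_Integration.integrable_bound [OF ib [of k]])
      (measurable, auto simp: Y_def intro!: AE_I2 order_trans [OF g_square_le])
  have EY2: "expectation (\<lambda>\<omega>. (Y k \<omega>)\<^sup>2) \<le> D" for k
  proof -
    have "expectation (\<lambda>\<omega>. (Y k \<omega>)\<^sup>2) \<le> expectation (?bound k)"
      by (intro integral_mono intY2 ib) (simp only: Y_def g_square_le)
    also have "\<dots> = Cg\<^sup>2 * 5 ^ 8 * (1 + expectation (\<lambda>\<omega>. norm (traj (noise \<omega>) (k - m) 0 m) ^ 8) + (\<integral>e. norm e ^ 8 \<partial>\<gamma>))"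
      using tr8(1) int8 by (simp add: integral_noise_power prob_space)
    also have "\<dots> \<le> D" unfolding D_def using tr8(2) by (intro mult_left_mono add_mono) auto
    finally show ?thesis .
  qed
  have D0: "0 \<le> D"
  proof -
    have "0 \<le> expectation (\<lambda>\<omega>. (Y 0 \<omega>)\<^sup>2)" by (rule Bochner_Integration.integral_nonneg) simp
    with EY2 [of 0] show ?thesis by linarith
  qed
  have intY: "integrable M (Y k)" for k
    by (rule square_integrable_imp_integrable [OF _ intY2]) measurable
  have EY: "expectation (Y k) = mean_after m" if "m \<le> k" for k
    using distr_joint_integral [of g "k - m" 0 m] that g_measurable
    by (simp add: Y_def mean_after_def borel_prod)
  have "AE \<omega> in M. (\<lambda>n. (\<Sum>k<n. Z k \<omega>) / n) \<longlonglongrightarrow> 0"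
  proof (rule slln_of_finite_range_dependence [where m = m and D = D])
    show "random_variable borel (Z k)" for k unfolding Z_def by measurable
    have Z2: "(Y k \<omega> - mean_after m)\<^sup>2 = (Y k \<omega>)\<^sup>2 - 2 * mean_after m * Y k \<omega> + (mean_after m)\<^sup>2" for k \<omega>
      by (simp add: power2_diff)
    have i2: "integrable M (\<lambda>\<omega>. (Y k \<omega> - mean_after m)\<^sup>2)" for k
      unfolding Z2 using intY intY2 by auto
    then show "integrable M (\<lambda>\<omega>. (Z k \<omega>)\<^sup>2)" for k by (cases "k < m") (simp_all add: Z_def)
    show "expectation (\<lambda>\<omega>. (Z k \<omega>)\<^sup>2) \<le> D" for k
    proof (cases "k < m")
      case True then show ?thesis using D0 by (simp add: Z_def)
    next
      case False
      then have "expectation (\<lambda>\<omega>. (Z k \<omega>)\<^sup>2) = expectation (\<lambda>\<omega>. (Y k \<omega>)\<^sup>2) - (mean_after m)\<^sup>2"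
        unfolding Z_def using Z2 intY intY2 EY [of k] by (simp add: prob_space power2_eq_square)
      then show ?thesis using EY2 [of k] zero_le_power2 [of "mean_after m"] by linarith
    qed
    fix j k assume jk: "j + m < k"
    show "expectation (\<lambda>\<omega>. Z j \<omega> * Z k \<omega>) = 0"
    proof (cases "j < m")
      case False
      let ?A = "{j - m..j}" and ?B = "{k - m..k}"
      let ?f = "\<lambda>i e. g (traj e (i - m) 0 m) (e i) - mean_after m"
      have meas: "?f i \<in> borel_measurable (PiM {i - m..i} (\<lambda>_. borel))" if "m \<le> i" for i
      proof -
        have [measurable]: "(\<lambda>e. traj e (i - m) 0 m) \<in> borel_measurable (PiM {i - m..i} (\<lambda>_. borel))"
          by (rule traj_measurable) (use that in \<open>auto intro!: measurable_component_singleton\<close>)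
        have [measurable]: "(\<lambda>e. e i) \<in> borel_measurable (PiM {i - m..i} (\<lambda>_. borel :: 'e measure))"
          by (rule measurable_component_singleton) simp
        show ?thesis by measurable
      qed
      have traj: "traj (restrict (noise \<omega>) {i - m..i}) (i - m) 0 m = traj (noise \<omega>) (i - m) 0 m" if "m \<le> i" for i \<omega>
        by (rule traj_cong) (use that in auto)
      have f_eq: "?f i (restrict (noise \<omega>) {i - m..i}) = Y i \<omega> - mean_after m" if "m \<le> i" for i \<omega>
        unfolding Y_def traj [OF that] by simp
      have mj: "m \<le> j" and mk: "m \<le> k" and disj: "?A \<inter> ?B = {}" using jk False by auto
      have "expectation (\<lambda>\<omega>. ?f j (restrict (noise \<omega>) ?A) * ?f k (restrict (noise \<omega>) ?B))
          = expectation (\<lambda>\<omega>. ?f j (restrict (noise \<omega>) ?A)) * expectation (\<lambda>\<omega>. ?f k (restrict (noise \<omega>) ?B))"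
      proof (rule expectation_indep_blocks [OF disj meas [OF mj] meas [OF mk]])
        show "integrable M (\<lambda>\<omega>. ?f j (restrict (noise \<omega>) ?A))"
          unfolding f_eq [OF mj] using intY [of j] by simp
        show "integrable M (\<lambda>\<omega>. ?f k (restrict (noise \<omega>) ?B))"
          unfolding f_eq [OF mk] using intY [of k] by simp
      qed
      then have "expectation (\<lambda>\<omega>. Z j \<omega> * Z k \<omega>) = expectation (\<lambda>\<omega>. Y j \<omega> - mean_after m) * expectation (\<lambda>\<omega>. Y k \<omega> - mean_after m)"
        unfolding f_eq [OF mj] f_eq [OF mk] using mj mk by (simp add: Z_def)
      also have "expectation (\<lambda>\<omega>. Y j \<omega> - mean_after m) = 0"
        using EY [of j] False intY [of j] by (simp add: prob_space)
      finally show ?thesis by simp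
    qed (simp add: Z_def)
  qed
  then show ?thesis unfolding Z_def Y_def .
qed

text \<open>
  For fixed \<open>m\<close> the time average differs from \<open>mean_after m\<close> by an average covered by \<open>finite_memory_slln\<close>, a
  contribution of the first \<open>m\<close> terms that vanishes in the limit, and a forgetting error of order \<open>r ^ m\<close>; and
  \<open>mean_after m\<close> is itself within order \<open>r ^ m\<close> of the stationary mean.  Then \<open>m\<close> is taken large.
\<close>

theorem averages_tendsto:
  "AE \<omega> in M. (\<lambda>n. (\<Sum>k<n. g (traj (noise \<omega>) 0 x0 k) (\<eta> k \<omega>)) / n) \<longlonglongrightarrow> mean_stationary"
proof -
  obtain C where C: "0 \<le> C" "\<And>m. \<bar>mean_after m - mean_stationary\<bar> \<le> C * sqrt \<rho> ^ m"
    using mean_after_close by blast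
  have "AE \<omega> in M. \<forall>m. (\<lambda>n. (\<Sum>k<n. if k < m then 0 else g (traj (noise \<omega>) (k - m) 0 m) (\<eta> k \<omega>) - mean_after m) / n) \<longlonglongrightarrow> 0"
    unfolding AE_all_countable using finite_memory_slln by blast
  then show ?thesis using noise_average_bounded
  proof (eventually_elim)
    case (elim \<omega>)
    define x where "x k = traj (noise \<omega>) 0 x0 k" for k
    define y where "y m k = traj (noise \<omega>) (k - m) 0 m" for m k
    define z where "z k = \<eta> k \<omega>" for k
    define r where "r = sqrt \<rho>"
    have r: "0 \<le> r" "r < 1" using \<rho> by (auto simp: r_def real_sqrt_lt_1_iff)
    obtain A where A: "\<And>n. (\<Sum>k<n. norm (z k) ^ 4) \<le> A * real n" using elim(2) unfolding z_def by blast
    have "0 \<le> norm (z 0) ^ 4" by simp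
    also have "\<dots> \<le> A" using A [of 1] by simp
    finally have A0: "0 \<le> A" .
    \<comment> \<open>\<open>A\<close> bounds the averages of the noise, and then \<open>B\<close> those of the
      state.\<close>
    define B where "B = (V x0 ^ 2 + noise_const 2 * A) / (1 - \<rho>)"
    have B: "(\<Sum>k<n. norm (x k) ^ 4) \<le> B * real n" if "0 < n" for n
    proof -
      have "(1 - \<rho>) * (\<Sum>k<n. norm (x k) ^ 4) \<le> (1 - \<rho>) * (\<Sum>k<n. V (x k) ^ 2)"
        using \<rho> norm_power_le_V [of _ 2] by (intro mult_left_mono sum_mono) auto
      also have "\<dots> \<le> V x0 ^ 2 + noise_const 2 * (\<Sum>k<n. norm (z k) ^ 4)"
        using sum_V_power_le [where e = "noise \<omega>" and j = 0 and x = x0 and n = n and p = 2]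
        by (simp add: x_def z_def) (use zero_le_power2 [of "V (traj (noise \<omega>) 0 x0 n)"] in linarith)
      also have "\<dots> \<le> V x0 ^ 2 * real n + noise_const 2 * (A * real n)"
        using that mult_left_mono [of 1 "real n" "V x0 ^ 2"] by (intro add_mono mult_left_mono A noise_const_nonneg) auto
      finally show ?thesis using \<rho> by (simp add: B_def field_simps)
    qed
    have B0: "0 \<le> B" using \<rho> A0 noise_const_nonneg by (simp add: B_def)
    define K where "K = Cg * c * 5 ^ 4 * (1 + 5 ^ 4 * c ^ 4)"
    have K0: "0 \<le> K" using Cg c by (simp add: K_def)
    have close: "\<bar>g (x k) (z k) - g (y m k) (z k)\<bar>
        \<le> r ^ m * (K * (1 + norm (x (k - m)) ^ 4 + norm (x k) ^ 4 + norm (z k) ^ 4))" if "m \<le> k" for m k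
    proof -
      let ?a = "norm (x (k - m))" and ?b = "norm (x k)" and ?e = "norm (z k)"
      have xk: "x k = traj (noise \<omega>) (k - m) (x (k - m)) m"
        using traj_add [of "noise \<omega>" 0 x0 "k - m" m] that by (simp add: x_def)
      have "norm (y m k) \<le> ?b + norm (x k - y m k)" using norm_triangle_sub [of "y m k" "x k"] by (simp add: norm_minus_commute)
      also have "norm (x k - y m k) \<le> r ^ m * (c * ?a)"
        unfolding xk y_def r_def by (rule norm_traj_diff)
      also have "r ^ m * (c * ?a) \<le> 1 * (c * ?a)"
        using r c by (intro mult_right_mono power_le_one) auto
      finally have "norm (y m k) ^ 4 \<le> (1 + ?b + c * ?a + 0 + 0) ^ 4" by (intro power_mono) auto
      also have "\<dots> \<le> 5 ^ 4 * (1 + ?b ^ 4 + (c * ?a) ^ 4 + 0 ^ 4 + 0 ^ 4)"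
        using c by (intro sum5_power_le) auto
      finally have y4: "norm (y m k) ^ 4 \<le> 5 ^ 4 * (1 + ?b ^ 4 + c ^ 4 * ?a ^ 4)" by (simp add: power_mult_distrib)
      have c4: "1 \<le> c ^ 4" using c by (rule one_le_power)
      have "1 + ?a ^ 4 + ?b ^ 4 + norm (y m k) ^ 4 + ?e ^ 4
          \<le> (1 + 5 ^ 4 * c ^ 4) * (1 + ?a ^ 4 + ?b ^ 4 + ?e ^ 4)"
      proof -
        have "1 + ?b ^ 4 \<le> c ^ 4 * (1 + ?b ^ 4 + ?e ^ 4)"
          using mult_mono [OF c4, of "1 + ?b ^ 4" "1 + ?b ^ 4 + ?e ^ 4"] by simp
        with y4 show ?thesis by (simp add: algebra_simps)
      qed
      then have "Cg * c * 5 ^ 4 * (1 + ?a ^ 4 + ?b ^ 4 + norm (y m k) ^ 4 + ?e ^ 4)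
          \<le> K * (1 + ?a ^ 4 + ?b ^ 4 + ?e ^ 4)"
        unfolding K_def mult.assoc [of "Cg * c * 5 ^ 4"] using Cg c by (intro mult_left_mono) auto
      then have "r ^ m * (Cg * c * 5 ^ 4 * (1 + ?a ^ 4 + ?b ^ 4 + norm (y m k) ^ 4 + ?e ^ 4))
          \<le> r ^ m * (K * (1 + ?a ^ 4 + ?b ^ 4 + ?e ^ 4))"
        using r by (intro mult_left_mono) auto
      moreover have "\<bar>g (x k) (z k) - g (y m k) (z k)\<bar>
          \<le> r ^ m * (Cg * c * 5 ^ 4 * (1 + ?a ^ 4 + ?b ^ 4 + norm (y m k) ^ 4 + ?e ^ 4))"
        using forgetting [of "noise \<omega>" "k - m" "x (k - m)" m "z k"] unfolding xk [symmetric] y_def r_def .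
      ultimately show ?thesis by linarith
    qed
    define L where "L = K * (1 + B + B + A) + C"
    have total: "\<bar>(\<Sum>k<n. g (x k) (z k)) / n - mean_stationary\<bar>
        \<le> \<bar>(\<Sum>k<n. if k < m then 0 else g (y m k) (z k) - mean_after m) / n\<bar>
          + (\<Sum>k<m. \<bar>g (x k) (z k) - mean_after m\<bar>) / n + r ^ m * L" if n: "0 < n" for n m
    proof -
      let ?Z = "\<lambda>k. if k < m then 0 else g (y m k) (z k) - mean_after m"
      let ?d = "\<lambda>k. g (x k) (z k) - mean_after m - ?Z k"
      let ?h = "\<lambda>k. if k < m then 0 else r ^ m * (K * (1 + norm (x (k - m)) ^ 4 + norm (x k) ^ 4 + norm (z k) ^ 4))"
      have "(\<Sum>k<n. \<bar>?d k\<bar>) \<le> (\<Sum>k<n. (if k < m then \<bar>g (x k) (z k) - mean_after m\<bar> else 0) + ?h k)"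
        using close by (intro sum_mono) auto
      also have "\<dots> = (\<Sum>k<n. if k < m then \<bar>g (x k) (z k) - mean_after m\<bar> else 0) + (\<Sum>k<n. ?h k)"
        by (rule sum.distrib)
      also have "(\<Sum>k<n. if k < m then \<bar>g (x k) (z k) - mean_after m\<bar> else 0) \<le> (\<Sum>k<m. \<bar>g (x k) (z k) - mean_after m\<bar>)"
        by (simp add: sum.If_cases) (intro sum_mono2, auto)
      also have "(\<Sum>k<n. ?h k) \<le> r ^ m * (K * ((1 + B + B + A) * real n))"
      proof -
        have "(\<Sum>k<n. ?h k) = (\<Sum>k\<in>{m..<n}. r ^ m * (K * (1 + norm (x (k - m)) ^ 4 + norm (x k) ^ 4 + norm (z k) ^ 4)))"
          by (rule sum.mono_neutral_cong_right) auto
        also have "\<dots> = r ^ m * (K * (real (n - m) + (\<Sum>k\<in>{m..<n}. norm (x (k - m)) ^ 4)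
            + (\<Sum>k\<in>{m..<n}. norm (x k) ^ 4) + (\<Sum>k\<in>{m..<n}. norm (z k) ^ 4)))"
          by (simp add: sum_distrib_left [symmetric] sum.distrib)
        also have "\<dots> \<le> r ^ m * (K * (real n + B * real n + B * real n + A * real n))"
        proof (intro mult_left_mono add_mono)
          have "(\<Sum>k\<in>{m..<n}. norm (x (k - m)) ^ 4) = (\<Sum>k<n - m. norm (x k) ^ 4)"
            by (rule sum.reindex_bij_witness [where i = "\<lambda>k. k + m" and j = "\<lambda>k. k - m"]) auto
          also have "\<dots> \<le> (\<Sum>k<n. norm (x k) ^ 4)" by (rule sum_mono2) auto
          finally show "(\<Sum>k\<in>{m..<n}. norm (x (k - m)) ^ 4) \<le> B * real n" using B [OF n] by linarith
          have "(\<Sum>k\<in>{m..<n}. norm (x k) ^ 4) \<le> (\<Sum>k<n. norm (x k) ^ 4)" by (rule sum_mono2) auto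
          then show "(\<Sum>k\<in>{m..<n}. norm (x k) ^ 4) \<le> B * real n" using B [OF n] by linarith
          have "(\<Sum>k\<in>{m..<n}. norm (z k) ^ 4) \<le> (\<Sum>k<n. norm (z k) ^ 4)" by (rule sum_mono2) auto
          then show "(\<Sum>k\<in>{m..<n}. norm (z k) ^ 4) \<le> A * real n" using A [of n] by linarith
        qed (use r K0 in auto)
        finally show ?thesis by (simp add: algebra_simps)
      qed
      finally have d: "(\<Sum>k<n. \<bar>?d k\<bar>) \<le> (\<Sum>k<m. \<bar>g (x k) (z k) - mean_after m\<bar>) + r ^ m * (K * ((1 + B + B + A) * real n))"
        by simp
      have "(\<Sum>k<n. g (x k) (z k)) = (\<Sum>k<n. mean_after m + (?Z k + ?d k))" by (intro sum.cong) auto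
      also have "\<dots> = real n * mean_after m + ((\<Sum>k<n. ?Z k) + (\<Sum>k<n. ?d k))"
        by (simp only: sum.distrib sum_constant card_lessThan)
      finally have "(\<Sum>k<n. g (x k) (z k)) / n - mean_after m = (\<Sum>k<n. ?Z k) / n + (\<Sum>k<n. ?d k) / n"
        using n by (simp add: field_simps)
      moreover have "\<bar>(\<Sum>k<n. ?d k) / n\<bar> \<le> (\<Sum>k<n. \<bar>?d k\<bar>) / n"
        using sum_abs [of ?d "{..<n}"] by (simp add: divide_right_mono)
      moreover have "(\<Sum>k<n. \<bar>?d k\<bar>) / n \<le> (\<Sum>k<m. \<bar>g (x k) (z k) - mean_after m\<bar>) / n + r ^ m * (K * (1 + B + B + A))"
        using divide_right_mono [OF d, of "real n"] n by (simp add: add_divide_distrib)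
      moreover have "r ^ m * L = r ^ m * (K * (1 + B + B + A)) + C * r ^ m" by (simp add: L_def algebra_simps)
      moreover have "\<bar>mean_after m - mean_stationary\<bar> \<le> C * r ^ m" unfolding r_def by (rule C(2))
      ultimately show ?thesis by linarith
    qed
    show "(\<lambda>n. (\<Sum>k<n. g (traj (noise \<omega>) 0 x0 k) (\<eta> k \<omega>)) / n) \<longlonglongrightarrow> mean_stationary"
      unfolding x_def [symmetric] unfolding z_def [symmetric]
    proof (rule LIMSEQ_I)
      fix e :: real assume e: "0 < e"
      have "(\<lambda>m. r ^ m * L) \<longlonglongrightarrow> 0 * L" using r by (intro tendsto_intros LIMSEQ_power_zero) auto
      then have "\<forall>\<^sub>F m in sequentially. r ^ m * L < e / 2" by (rule order_tendstoD) (use e in simp)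
      then obtain m where m: "r ^ m * L < e / 2" by (auto simp: eventually_sequentially)
      let ?u = "\<lambda>n. \<bar>(\<Sum>k<n. if k < m then 0 else g (y m k) (z k) - mean_after m) / n\<bar>
          + (\<Sum>k<m. \<bar>g (x k) (z k) - mean_after m\<bar>) / real n"
      have "?u \<longlonglongrightarrow> \<bar>0\<bar> + 0"
        using elim(1) unfolding y_def z_def
        by (intro tendsto_add tendsto_rabs lim_const_over_n) blast
      then have "\<forall>\<^sub>F n in sequentially. ?u n < e / 2" by (rule order_tendstoD) (use e in simp)
      then have "\<forall>\<^sub>F n in sequentially. norm ((\<Sum>k<n. g (x k) (z k)) / n - mean_stationary) < e"
        using eventually_gt_at_top [of 0]
      proof eventually_elim
        case (elim n)
        then show ?case using total [of n m] m unfolding real_norm_def by linarith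
      qed
      then show "\<exists>N. \<forall>n\<ge>N. norm ((\<Sum>k<n. g (x k) (z k)) / n - mean_stationary) < e"
        by (simp add: eventually_sequentially)
    qed
  qed
qed

end

section \<open>Moments of the Gaussian noise\<close>

lemma lborel_product_integral:
  fixes f :: "'a::euclidean_space \<Rightarrow> real \<Rightarrow> real"
  assumes f: "\<And>b. b \<in> Basis \<Longrightarrow> integrable lborel (f b)"
  shows "integrable lborel (\<lambda>x::'a. \<Prod>b\<in>Basis. f b (x \<bullet> b))"
    and "(\<integral>x. (\<Prod>b\<in>Basis. f b (x \<bullet> b)) \<partial>lborel) = (\<Prod>b\<in>Basis. \<integral>t. f b t \<partial>lborel)"
proof -
  interpret product_sigma_finite "\<lambda>_ :: 'a. lborel :: real measure" ..
  let ?P = "\<Pi>\<^sub>M b\<in>(Basis :: 'a set). (lborel :: real measure)"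
  let ?s = "\<lambda>z. \<Sum>b\<in>Basis. z b *\<^sub>R b :: 'a"
  have [measurable]: "f b \<in> borel_measurable borel" if "b \<in> Basis" for b
    using f [OF that] by (auto dest: borel_measurable_integrable)
  have comp: "(\<lambda>z. \<Prod>b\<in>Basis. f b (?s z \<bullet> b)) = (\<lambda>z. \<Prod>b\<in>Basis. f b (z b))"
    by (intro ext prod.cong) (auto simp: inner_sum_left inner_Basis if_distrib sum.delta cong: if_cong)
  have s: "?s \<in> measurable ?P borel" by measurable
  have m: "(\<lambda>x::'a. \<Prod>b\<in>Basis. f b (x \<bullet> b)) \<in> borel_measurable borel" by measurable
  show "integrable lborel (\<lambda>x::'a. \<Prod>b\<in>Basis. f b (x \<bullet> b))"
    unfolding lborel_eq [where 'a = 'a] integrable_distr_eq [OF s m] comp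
    by (rule product_integrable_prod) (auto intro: f)
  show "(\<integral>x. (\<Prod>b\<in>Basis. f b (x \<bullet> b)) \<partial>lborel) = (\<Prod>b\<in>Basis. \<integral>t. f b t \<partial>lborel)"
    unfolding lborel_eq [where 'a = 'a] integral_distr [OF s m] comp
    by (rule product_integral_prod) (auto intro: f)
qed

lemma prod_Basis_vec: "(\<Prod>b\<in>(Basis :: (real^'k) set). F b) = (\<Prod>i\<in>UNIV. F (axis i 1))"
proof -
  have B: "(Basis :: (real^'k) set) = (\<lambda>i. axis i 1) ` UNIV" by (auto simp: Basis_vec_def)
  have "inj (\<lambda>i :: 'k. axis i (1::real))" by (auto simp: inj_def axis_eq_axis)
  then show ?thesis unfolding B by (subst prod.reindex) (simp_all add: o_def)
qed

lemma gauss_vec_one: "gauss_vec 1 = density lborel (\<lambda>x :: real^'k. ennreal (\<Prod>i\<in>UNIV. std_normal_density (x $ i)))"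
proof -
  have "(\<lambda>x :: real^'k. 1 *\<^sub>R x) = (\<lambda>x. x)" by simp
  then show ?thesis unfolding gauss_vec_def by (simp only:) (rule distr_id2, simp)
qed

text \<open>
  All moments that are needed are expectations of monomials, which factorize over the coordinates.
\<close>

lemma gauss_vec_monomial:
  fixes e :: "'k::finite \<Rightarrow> nat"
  shows "integrable (gauss_vec 1) (\<lambda>x. \<Prod>i\<in>UNIV. (x $ i) ^ e i)"
    and "(\<integral>x. (\<Prod>i\<in>UNIV. (x $ i) ^ e i) \<partial>gauss_vec 1)
       = (\<Prod>i\<in>UNIV. \<integral>t. std_normal_density t * t ^ e i \<partial>lborel)"
proof -
  let ?d = "\<lambda>x :: real^'k. \<Prod>i\<in>UNIV. std_normal_density (x $ i)"
  define ix where "ix b = (THE i. b = axis i 1)" for b :: "real^'k"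
  have ix: "ix (axis i 1) = i" for i unfolding ix_def by (rule the_equality) (auto simp: axis_eq_axis)
  let ?f = "\<lambda>b t. std_normal_density t * t ^ e (ix b)"
  have prod: "(\<Prod>b\<in>Basis. ?f b (x \<bullet> b)) = ?d x *\<^sub>R (\<Prod>i\<in>UNIV. (x $ i) ^ e i)" for x
    unfolding prod_Basis_vec ix by (simp add: prod.distrib inner_axis)
  note L = lborel_product_integral [of ?f, OF integrable_std_normal_moment, unfolded prod prod_Basis_vec ix]
  have m: "(\<lambda>x :: real^'k. \<Prod>i\<in>UNIV. (x $ i) ^ e i) \<in> borel_measurable lborel" by measurable
  have d: "?d \<in> borel_measurable lborel" by measurable
  have nn: "AE x in lborel. 0 \<le> ?d x" by (simp add: prod_nonneg)
  show "integrable (gauss_vec 1) (\<lambda>x. \<Prod>i\<in>UNIV. (x $ i) ^ e i)"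
    unfolding gauss_vec_one integrable_density [OF m d nn] by (rule L(1))
  show "(\<integral>x. (\<Prod>i\<in>UNIV. (x $ i) ^ e i) \<partial>gauss_vec 1)
       = (\<Prod>i\<in>UNIV. \<integral>t. std_normal_density t * t ^ e i \<partial>lborel)"
    unfolding gauss_vec_one integral_density [OF m d nn] by (rule L(2))
qed

lemma std_normal_low_moments:
  "(\<integral>t. std_normal_density t * t ^ 0 \<partial>lborel) = 1"
  "(\<integral>t. std_normal_density t * t ^ 1 \<partial>lborel) = 0"
  "(\<integral>t. std_normal_density t * t ^ 2 \<partial>lborel) = 1"
  using integral_std_normal_moment_even [of 0] integral_std_normal_moment_odd [of 0]
    integral_std_normal_moment_even [of 1] by (simp_all add: fact_numeral)

lemma sets_gauss_vec [measurable_cong, simp]: "sets (gauss_vec \<sigma>) = sets borel"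
  by (simp add: gauss_vec_def)

lemma gauss_vec_scale: "gauss_vec \<sigma> = distr (gauss_vec 1) borel (\<lambda>x. \<sigma> *\<^sub>R x)"
  unfolding gauss_vec_one by (simp add: gauss_vec_def)

lemma gauss_vec_coordinate:
  "integrable (gauss_vec 1) (\<lambda>x. x $ a)" "(\<integral>x. x $ a \<partial>gauss_vec 1) = 0"
proof -
  have eq: "(\<Prod>i\<in>UNIV. (x $ i) ^ (if i = a then 1 else 0)) = x $ a" for x :: "real^'a"
    by (simp add: if_distrib prod.delta cong: if_cong)
  show "integrable (gauss_vec 1) (\<lambda>x. x $ a)"
    using gauss_vec_monomial(1) [of "\<lambda>i. if i = a then 1 else 0"] unfolding eq .
  have "(\<integral>x. x $ a \<partial>gauss_vec 1) = (\<Prod>i\<in>UNIV. if i = a then 0 else 1)"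
    using gauss_vec_monomial(2) [of "\<lambda>i. if i = a then 1 else 0"] unfolding eq
    by (auto intro!: prod.cong simp: std_normal_low_moments [simplified])
  then show "(\<integral>x. x $ a \<partial>gauss_vec 1) = 0" by (simp add: prod.delta)
qed

lemma gauss_vec_covariance:
  "integrable (gauss_vec 1) (\<lambda>x. x $ a * x $ b)"
  "(\<integral>x. x $ a * x $ b \<partial>gauss_vec 1) = (if a = b then 1 else 0)"
proof -
  define e where "e i = (if i = a then 1 else 0) + (if i = b then 1 else 0 :: nat)" for i
  have eq: "(\<Prod>i\<in>UNIV. (x $ i) ^ e i) = x $ a * x $ b" for x :: "real^'a"
    unfolding e_def power_add prod.distrib by (simp add: if_distrib prod.delta cong: if_cong)
  show "integrable (gauss_vec 1) (\<lambda>x. x $ a * x $ b)"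
    using gauss_vec_monomial(1) [of e] unfolding eq .
  have m: "(\<integral>x. x $ a * x $ b \<partial>gauss_vec 1) = (\<Prod>i\<in>UNIV. \<integral>t. std_normal_density t * t ^ e i \<partial>lborel)"
    using gauss_vec_monomial(2) [of e] unfolding eq .
  show "(\<integral>x. x $ a * x $ b \<partial>gauss_vec 1) = (if a = b then 1 else 0)"
  proof (cases "a = b")
    case True
    then have "(\<integral>t. std_normal_density t * t ^ e i \<partial>lborel) = 1" for i
      using std_normal_low_moments by (simp add: e_def numeral_2_eq_2)
    with True m show ?thesis by simp
  next
    case False
    then have "(\<integral>t. std_normal_density t * t ^ e a \<partial>lborel) = 0"
      using std_normal_low_moments by (simp add: e_def)
    then have "(\<Prod>i\<in>UNIV. \<integral>t. std_normal_density t * t ^ e i \<partial>lborel) = 0"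
      by (intro prod_zero) auto
    with False m show ?thesis by simp
  qed
qed

lemma sum_power_le:
  fixes f :: "'a \<Rightarrow> real"
  assumes "finite I" "\<And>i. i \<in> I \<Longrightarrow> 0 \<le> f i" "0 < p"
  shows "(\<Sum>i\<in>I. f i) ^ p \<le> real (card I) ^ p * (\<Sum>i\<in>I. f i ^ p)"
proof (cases "I = {}")
  case False
  define m where "m = Max (f ` I)"
  have "m \<in> f ` I" unfolding m_def using assms(1) False by (intro Max_in) auto
  then obtain j where j: "j \<in> I" "m = f j" by auto
  have "(\<Sum>i\<in>I. f i) \<le> real (card I) * m"
    unfolding m_def using assms(1) by (intro sum_bounded_above Max_ge) auto
  then have "(\<Sum>i\<in>I. f i) ^ p \<le> (real (card I) * m) ^ p"
    using assms(2) by (intro power_mono sum_nonneg) auto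
  also have "\<dots> = real (card I) ^ p * f j ^ p" by (simp add: power_mult_distrib j)
  also have "\<dots> \<le> real (card I) ^ p * (\<Sum>i\<in>I. f i ^ p)"
    using assms j by (intro mult_left_mono member_le_sum) auto
  finally show ?thesis .
qed (use assms(3) in \<open>simp add: zero_power\<close>)

lemma gauss_vec_eighth_moment: "integrable (gauss_vec \<sigma>) (\<lambda>x :: real^'k. norm x ^ 8)"
proof -
  have i8: "integrable (gauss_vec 1) (\<lambda>x :: real^'k. x $ a ^ 8)" for a
  proof -
    have eq: "(\<Prod>i\<in>UNIV. (x $ i) ^ (if i = a then 8 else 0)) = x $ a ^ 8" for x :: "real^'k"
      by (simp add: if_distrib prod.delta cong: if_cong)
    show ?thesis using gauss_vec_monomial(1) [of "\<lambda>i. if i = a then 8 else 0"] unfolding eq .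
  qed
  have int1: "integrable (gauss_vec 1) (\<lambda>x :: real^'k. norm x ^ 8)"
  proof (rule Bochner_Integration.integrable_bound)
    show "integrable (gauss_vec 1) (\<lambda>x :: real^'k. real CARD('k) ^ 8 * (\<Sum>i\<in>UNIV. x $ i ^ 8))"
      using i8 by auto
    show "AE x in gauss_vec 1. norm (norm x ^ 8) \<le> norm (real CARD('k) ^ 8 * (\<Sum>i\<in>UNIV. (x :: real^'k) $ i ^ 8))"
    proof (rule AE_I2)
      fix x :: "real^'k"
      have "norm x ^ 8 \<le> (\<Sum>i\<in>UNIV. \<bar>x $ i\<bar>) ^ 8" by (intro power_mono norm_le_l1_cart) simp
      also have "\<dots> \<le> real CARD('k) ^ 8 * (\<Sum>i\<in>UNIV. \<bar>x $ i\<bar> ^ 8)" by (rule sum_power_le) auto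
      finally show "norm (norm x ^ 8) \<le> norm (real CARD('k) ^ 8 * (\<Sum>i\<in>UNIV. x $ i ^ 8))"
        by (simp add: power_even_abs sum_nonneg)
    qed
  qed measurable
  have "integrable (gauss_vec 1) (\<lambda>x :: real^'k. norm (\<sigma> *\<^sub>R x) ^ 8)"
    using int1 by (simp add: power_mult_distrib)
  then show ?thesis unfolding gauss_vec_scale [of \<sigma>] by (subst integrable_distr_eq) measurable
qed

section \<open>Independent sequences of pairs\<close>

lemma borel_pair_generated:
  "sets (borel :: ('a::second_countable_topology \<times> 'b::second_countable_topology) measure)
     = sigma_sets UNIV {A \<times> B | A B. A \<in> sets borel \<and> B \<in> sets borel}"
  unfolding borel_prod [symmetric] sets_pair_measure by simp

text \<open>
  The rectangles are an intersection-stable generator of the sigma-algebra of pairs, and on rectangles the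
  probabilities factorize, first into the two sequences and then over the indices.
\<close>

lemma (in prob_space) indep_vars_Pair:
  fixes X :: "nat \<Rightarrow> 'a \<Rightarrow> 'x::second_countable_topology" and Y :: "nat \<Rightarrow> 'a \<Rightarrow> 'y::second_countable_topology"
  assumes X: "indep_vars (\<lambda>_. borel) X UNIV" and Y: "indep_vars (\<lambda>_. borel) Y UNIV"
    and XY: "\<And>J A B. finite J \<Longrightarrow> J \<noteq> {} \<Longrightarrow> (\<And>j. A j \<in> sets borel) \<Longrightarrow> (\<And>j. B j \<in> sets borel) \<Longrightarrow>
      prob ((\<Inter>j\<in>J. X j -` A j \<inter> space M) \<inter> (\<Inter>j\<in>J. Y j -` B j \<inter> space M))
        = prob (\<Inter>j\<in>J. X j -` A j \<inter> space M) * prob (\<Inter>j\<in>J. Y j -` B j \<inter> space M)"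
  shows "indep_vars (\<lambda>_. borel) (\<lambda>k \<omega>. (X k \<omega>, Y k \<omega>)) UNIV"
    and "distr M borel (\<lambda>\<omega>. (X k \<omega>, Y k \<omega>)) = distr M borel (X k) \<Otimes>\<^sub>M distr M borel (Y k)"
proof -
  let ?Z = "\<lambda>k \<omega>. (X k \<omega>, Y k \<omega>)"
  let ?R = "{A \<times> B | A B. A \<in> sets (borel :: 'x measure) \<and> B \<in> sets (borel :: 'y measure)}"
  have mX [measurable]: "random_variable borel (X k)" and mY [measurable]: "random_variable borel (Y k)" for k
    using X Y by (simp_all add: indep_vars_def)
  have pX: "prob (\<Inter>j\<in>J. X j -` A j \<inter> space M) = (\<Prod>j\<in>J. prob (X j -` A j \<inter> space M))"
    if "finite J" "J \<noteq> {}" "\<And>j. A j \<in> sets borel" for J and A :: "nat \<Rightarrow> 'x set"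
    using X that unfolding indep_vars_def2 by (intro indep_setsD) auto
  have pY: "prob (\<Inter>j\<in>J. Y j -` A j \<inter> space M) = (\<Prod>j\<in>J. prob (Y j -` A j \<inter> space M))"
    if "finite J" "J \<noteq> {}" "\<And>j. A j \<in> sets borel" for J and A :: "nat \<Rightarrow> 'y set"
    using Y that unfolding indep_vars_def2 by (intro indep_setsD) auto
  have one: "prob (?Z k -` (A \<times> B) \<inter> space M) = prob (X k -` A \<inter> space M) * prob (Y k -` B \<inter> space M)"
    if "A \<in> sets borel" "B \<in> sets borel" for A B k
  proof -
    have "?Z k -` (A \<times> B) \<inter> space M = (X k -` A \<inter> space M) \<inter> (Y k -` B \<inter> space M)" by auto
    then show ?thesis using XY [of "{k}" "\<lambda>_. A" "\<lambda>_. B"] that by simp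
  qed
  have "indep_sets (\<lambda>k. sigma_sets (space M) {?Z k -` D \<inter> space M | D. D \<in> ?R}) UNIV"
  proof (rule indep_sets_sigma)
    show "Int_stable {?Z k -` D \<inter> space M | D. D \<in> ?R}" for k
    proof (rule Int_stableI)
      fix a b assume "a \<in> {?Z k -` D \<inter> space M | D. D \<in> ?R}" "b \<in> {?Z k -` D \<inter> space M | D. D \<in> ?R}"
      then obtain A B A' B' where "a = ?Z k -` (A \<times> B) \<inter> space M" "b = ?Z k -` (A' \<times> B') \<inter> space M"
        and s: "A \<in> sets borel" "B \<in> sets borel" "A' \<in> sets borel" "B' \<in> sets borel" by blast
      then have "a \<inter> b = ?Z k -` ((A \<inter> A') \<times> (B \<inter> B')) \<inter> space M" by auto
      moreover have "(A \<inter> A') \<times> (B \<inter> B') \<in> ?R" using s by blast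
      ultimately show "a \<inter> b \<in> {?Z k -` D \<inter> space M | D. D \<in> ?R}" by blast
    qed
    show "indep_sets (\<lambda>k. {?Z k -` D \<inter> space M | D. D \<in> ?R}) UNIV"
    proof (rule indep_setsI)
      fix k
      show "{?Z k -` D \<inter> space M | D. D \<in> ?R} \<subseteq> events"
      proof safe
        fix A :: "'x set" and B :: "'y set" assume [measurable]: "A \<in> sets borel" "B \<in> sets borel"
        have "?Z k -` (A \<times> B) \<inter> space M = (X k -` A \<inter> space M) \<inter> (Y k -` B \<inter> space M)" by auto
        then show "?Z k -` (A \<times> B) \<inter> space M \<in> events" by simp
      qed
    next
      fix E J assume J: "J \<noteq> {}" "finite J" and E: "\<forall>j\<in>J. E j \<in> {?Z j -` D \<inter> space M | D. D \<in> ?R}"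
      have "\<exists>AB. E j = ?Z j -` (fst AB \<times> snd AB) \<inter> space M \<and> fst AB \<in> sets borel \<and> snd AB \<in> sets borel"
        if "j \<in> J" for j
      proof -
        from E that have "E j \<in> {?Z j -` D \<inter> space M | D. D \<in> ?R}" by (rule bspec)
        then obtain A B where "E j = ?Z j -` (A \<times> B) \<inter> space M" "A \<in> sets borel" "B \<in> sets borel"
          by auto
        then show ?thesis by (intro exI [of _ "(A, B)"]) simp
      qed
      then have "\<forall>j\<in>J. \<exists>AB. E j = ?Z j -` (fst AB \<times> snd AB) \<inter> space M
          \<and> fst AB \<in> sets borel \<and> snd AB \<in> sets borel"
        by (intro ballI)
      from bchoice [OF this] obtain AB where AB0: "\<forall>j\<in>J. E j = ?Z j -` (fst (AB j) \<times> snd (AB j)) \<inter> space M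
          \<and> fst (AB j) \<in> sets borel \<and> snd (AB j) \<in> sets borel"
        by (rule exE)
      define A where "A j = (if j \<in> J then fst (AB j) else {})" for j
      define B where "B j = (if j \<in> J then snd (AB j) else {})" for j
      have AB: "A j \<in> sets borel" "B j \<in> sets borel" for j using AB0 by (auto simp: A_def B_def)
      have EJ: "E j = ?Z j -` (A j \<times> B j) \<inter> space M" if "j \<in> J" for j using AB0 that by (simp add: A_def B_def)
      have "(\<Inter>j\<in>J. E j) = (\<Inter>j\<in>J. X j -` A j \<inter> space M) \<inter> (\<Inter>j\<in>J. Y j -` B j \<inter> space M)"
        using EJ J(1) by auto
      then have "prob (\<Inter>j\<in>J. E j) = (\<Prod>j\<in>J. prob (X j -` A j \<inter> space M)) * (\<Prod>j\<in>J. prob (Y j -` B j \<inter> space M))"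
        using XY [OF J(2,1) AB] pX [OF J(2,1) AB(1)] pY [OF J(2,1) AB(2)] by simp
      also have "\<dots> = (\<Prod>j\<in>J. prob (E j))"
        unfolding prod.distrib [symmetric] by (intro prod.cong) (simp_all add: EJ one AB)
      finally show "prob (\<Inter>j\<in>J. E j) = (\<Prod>j\<in>J. prob (E j))" .
    qed
  qed
  moreover have "sigma_sets (space M) {?Z k -` D \<inter> space M | D. D \<in> ?R}
      = {?Z k -` D \<inter> space M | D. D \<in> sets borel}" for k
    unfolding borel_pair_generated by (rule sigma_sets_vimage_commute [symmetric]) simp
  ultimately show "indep_vars (\<lambda>_. borel) ?Z UNIV"
    unfolding indep_vars_def2 by (auto intro!: borel_measurable_Pair)
  interpret X: prob_space "distr M borel (X k)" by (rule prob_space_distr) measurable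
  interpret Y: prob_space "distr M borel (Y k)" by (rule prob_space_distr) measurable
  show "distr M borel (?Z k) = distr M borel (X k) \<Otimes>\<^sub>M distr M borel (Y k)"
  proof (rule pair_measure_eqI [symmetric])
    show "sets (distr M borel (X k) \<Otimes>\<^sub>M distr M borel (Y k)) = sets (distr M borel (?Z k))"
      by (subst sets_pair_measure_cong [OF sets_distr sets_distr], subst borel_prod, simp)
    fix A B assume "A \<in> sets (distr M borel (X k))" "B \<in> sets (distr M borel (Y k))"
    then have [measurable]: "A \<in> sets borel" "B \<in> sets borel" by simp_all
    have "A \<times> B \<in> {A \<times> B | A B. A \<in> sets borel \<and> B \<in> sets borel}"
      using \<open>A \<in> sets borel\<close> \<open>B \<in> sets borel\<close> by blast
    then have "A \<times> B \<in> sets borel" unfolding borel_pair_generated by (rule sigma_sets.Basic)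
    then show "emeasure (distr M borel (X k)) A * emeasure (distr M borel (Y k)) B = emeasure (distr M borel (?Z k)) (A \<times> B)"
      using one [of A B k] by (simp add: emeasure_distr emeasure_eq_measure ennreal_mult [symmetric] borel_measurable_Pair)
  qed (unfold_locales)
qed

lemma indep_processes_pairs:
  fixes w :: "nat \<Rightarrow> 'w \<Rightarrow> real^'q" and v :: "nat \<Rightarrow> 'w \<Rightarrow> real^'m"
  assumes "prob_space \<Omega>" and w: "iid_gauss \<Omega> 1 w" and v: "iid_gauss \<Omega> \<sigma> v" and wv: "indep_processes \<Omega> w v"
  shows "prob_space.indep_vars \<Omega> (\<lambda>_. borel) (\<lambda>k \<omega>. (v k \<omega>, w k \<omega>)) UNIV"
    and "distr \<Omega> borel (\<lambda>\<omega>. (v k \<omega>, w k \<omega>)) = gauss_vec \<sigma> \<Otimes>\<^sub>M gauss_vec 1"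
proof -
  interpret prob_space \<Omega> by (rule assms(1))
  have iv: "indep_vars (\<lambda>_. borel) v UNIV" and iw: "indep_vars (\<lambda>_. borel) w UNIV"
    and dv: "distr \<Omega> borel (v k) = gauss_vec \<sigma>" and dw: "distr \<Omega> borel (w k) = gauss_vec 1" for k
    using w v by (simp_all add: iid_gauss_def)
  have gen: "(\<Inter>j\<in>J. X j -` A j \<inter> space \<Omega>) \<in> sets (vimage_algebra (space \<Omega>) (\<lambda>\<omega> k. X k \<omega>) (\<Pi>\<^sub>M k\<in>UNIV. borel))"
    if J: "finite J" "J \<noteq> {}" and A: "\<And>j. A j \<in> sets borel"
    for J :: "nat set" and X :: "nat \<Rightarrow> 'w \<Rightarrow> real^'b" and A
  proof -
    let ?D = "{f \<in> space (\<Pi>\<^sub>M k\<in>(UNIV :: nat set). (borel :: (real^'b) measure)). \<forall>j\<in>J. f j \<in> A j}"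
    have "?D \<in> sets (\<Pi>\<^sub>M k\<in>UNIV. borel)" using J A by measurable
    moreover have "(\<Inter>j\<in>J. X j -` A j \<inter> space \<Omega>) = (\<lambda>\<omega> k. X k \<omega>) -` ?D \<inter> space \<Omega>"
      using J(2) by (auto simp: space_PiM)
    ultimately show ?thesis by (simp only: in_vimage_algebra)
  qed
  have cross: "prob ((\<Inter>j\<in>J. v j -` A j \<inter> space \<Omega>) \<inter> (\<Inter>j\<in>J. w j -` B j \<inter> space \<Omega>))
        = prob (\<Inter>j\<in>J. v j -` A j \<inter> space \<Omega>) * prob (\<Inter>j\<in>J. w j -` B j \<inter> space \<Omega>)"
    if "finite J" "J \<noteq> {}" "\<And>j. A j \<in> sets borel" "\<And>j. B j \<in> sets borel" for J A B
    using indep_setD [OF wv [unfolded indep_processes_def] gen [OF that(1,2,4)] gen [OF that(1,2,3)]]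
    by (simp add: Int_commute mult.commute)
  show "indep_vars (\<lambda>_. borel) (\<lambda>k \<omega>. (v k \<omega>, w k \<omega>)) UNIV"
  proof (rule indep_vars_Pair(1) [OF iv iw])
    fix J :: "nat set" and A :: "nat \<Rightarrow> (real^'m) set" and B :: "nat \<Rightarrow> (real^'q) set"
    assume "finite J" "J \<noteq> {}" "\<And>j. A j \<in> sets borel" "\<And>j. B j \<in> sets borel"
    then show "prob ((\<Inter>j\<in>J. v j -` A j \<inter> space \<Omega>) \<inter> (\<Inter>j\<in>J. w j -` B j \<inter> space \<Omega>))
        = prob (\<Inter>j\<in>J. v j -` A j \<inter> space \<Omega>) * prob (\<Inter>j\<in>J. w j -` B j \<inter> space \<Omega>)" by (rule cross)
  qed
  have "distr \<Omega> borel (\<lambda>\<omega>. (v k \<omega>, w k \<omega>)) = distr \<Omega> borel (v k) \<Otimes>\<^sub>M distr \<Omega> borel (w k)"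
  proof (rule indep_vars_Pair(2) [OF iv iw])
    fix J :: "nat set" and A :: "nat \<Rightarrow> (real^'m) set" and B :: "nat \<Rightarrow> (real^'q) set"
    assume "finite J" "J \<noteq> {}" "\<And>j. A j \<in> sets borel" "\<And>j. B j \<in> sets borel"
    then show "prob ((\<Inter>j\<in>J. v j -` A j \<inter> space \<Omega>) \<inter> (\<Inter>j\<in>J. w j -` B j \<inter> space \<Omega>))
        = prob (\<Inter>j\<in>J. v j -` A j \<inter> space \<Omega>) * prob (\<Inter>j\<in>J. w j -` B j \<inter> space \<Omega>)" by (rule cross)
  qed
  then show "distr \<Omega> borel (\<lambda>\<omega>. (v k \<omega>, w k \<omega>)) = gauss_vec \<sigma> \<Otimes>\<^sub>M gauss_vec 1"
    by (simp only: dv dw)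
qed

section \<open>Functions of polynomial growth\<close>

text \<open>
  The weight in the second condition replaces a growth exponent \<open>d - 1\<close>, which would be truncated at \<open>d = 0\<close>.
\<close>

definition poly_growth :: "nat \<Rightarrow> ('x::euclidean_space \<Rightarrow> 'e::euclidean_space \<Rightarrow> real) \<Rightarrow> bool" where
  "poly_growth d f \<longleftrightarrow> case_prod f \<in> borel_measurable borel \<and>
     (\<exists>C\<ge>0. (\<forall>x e. \<bar>f x e\<bar> \<le> C * (1 + norm x + norm e) ^ d) \<and>
       (\<forall>x y e. \<bar>f x e - f y e\<bar> * (1 + norm x + norm y + norm e)
          \<le> C * norm (x - y) * (1 + norm x + norm y + norm e) ^ d))"

lemma poly_growthI:
  assumes "case_prod f \<in> borel_measurable borel" "0 \<le> C" "\<And>x e. \<bar>f x e\<bar> \<le> C * (1 + norm x + norm e) ^ d"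
    "\<And>x y e. \<bar>f x e - f y e\<bar> * (1 + norm x + norm y + norm e) \<le> C * norm (x - y) * (1 + norm x + norm y + norm e) ^ d"
  shows "poly_growth d f"
  using assms unfolding poly_growth_def by blast

lemma poly_growth_const: "poly_growth 0 (\<lambda>_ _. a)"
  by (rule poly_growthI [where C = "\<bar>a\<bar>"]) (auto simp: case_prod_beta)

lemma poly_growth_linear:
  fixes l :: "'x::euclidean_space \<times> 'e::euclidean_space \<Rightarrow> real"
  assumes "linear l" shows "poly_growth 1 (\<lambda>x e. l (x, e))"
proof -
  interpret l: bounded_linear l using assms by (simp add: linear_conv_bounded_linear)
  obtain K where K: "0 \<le> K" "\<And>z. norm (l z) \<le> norm z * K" using l.nonneg_bounded by blast
  show ?thesis
  proof (rule poly_growthI [OF _ K(1)])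
    show "(\<lambda>(x, e). l (x, e)) \<in> borel_measurable borel"
      using borel_measurable_continuous_onI [OF linear_continuous_on [OF l.bounded_linear_axioms]]
      by (simp add: case_prod_beta)
    show "\<bar>l (x, e)\<bar> \<le> K * (1 + norm x + norm e) ^ 1" for x e
    proof -
      have "\<bar>l (x, e)\<bar> \<le> norm (x, e) * K" using K(2) [of "(x, e)"] by simp
      also have "\<dots> \<le> (1 + norm x + norm e) * K"
        using norm_Pair_le [of x e] K(1) by (intro mult_right_mono) auto
      finally show ?thesis by (simp add: mult.commute)
    qed
    show "\<bar>l (x, e) - l (y, e)\<bar> * (1 + norm x + norm y + norm e) \<le> K * norm (x - y) * (1 + norm x + norm y + norm e) ^ 1" for x y e
    proof -
      have "l (x, e) - l (y, e) = l (x - y, 0)" by (simp add: l.diff [symmetric])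
      then have "\<bar>l (x, e) - l (y, e)\<bar> \<le> K * norm (x - y)"
        using K(2) [of "(x - y, 0)"] by (simp add: mult.commute)
      then show ?thesis by (simp add: mult_right_mono)
    qed
  qed
qed

lemma poly_growth_mono:
  assumes "poly_growth d f" "d \<le> d'" shows "poly_growth d' f"
proof -
  obtain C where C: "0 \<le> C" "\<And>x e. \<bar>f x e\<bar> \<le> C * (1 + norm x + norm e) ^ d"
    "\<And>x y e. \<bar>f x e - f y e\<bar> * (1 + norm x + norm y + norm e) \<le> C * norm (x - y) * (1 + norm x + norm y + norm e) ^ d"
    using assms(1) unfolding poly_growth_def by blast
  show ?thesis
  proof (rule poly_growthI [OF _ C(1)])
    show "case_prod f \<in> borel_measurable borel" using assms(1) by (simp add: poly_growth_def)
    show "\<bar>f x e\<bar> \<le> C * (1 + norm x + norm e) ^ d'" for x e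
      using C(1) by (rule order_trans [OF C(2) mult_left_mono [OF power_increasing [OF assms(2)]], rotated]) auto
    show "\<bar>f x e - f y e\<bar> * (1 + norm x + norm y + norm e) \<le> C * norm (x - y) * (1 + norm x + norm y + norm e) ^ d'" for x y e
      using C(1) by (intro order_trans [OF C(3) mult_left_mono [OF power_increasing [OF assms(2)]]]) auto
  qed
qed

lemma poly_growth_add:
  assumes "poly_growth d f" "poly_growth d g" shows "poly_growth d (\<lambda>x e. f x e + g x e)"
proof -
  obtain C where C: "0 \<le> C" "\<And>x e. \<bar>f x e\<bar> \<le> C * (1 + norm x + norm e) ^ d"
    "\<And>x y e. \<bar>f x e - f y e\<bar> * (1 + norm x + norm y + norm e) \<le> C * norm (x - y) * (1 + norm x + norm y + norm e) ^ d"
    using assms(1) unfolding poly_growth_def by blast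
  obtain D where D: "0 \<le> D" "\<And>x e. \<bar>g x e\<bar> \<le> D * (1 + norm x + norm e) ^ d"
    "\<And>x y e. \<bar>g x e - g y e\<bar> * (1 + norm x + norm y + norm e) \<le> D * norm (x - y) * (1 + norm x + norm y + norm e) ^ d"
    using assms(2) unfolding poly_growth_def by blast
  show ?thesis
  proof (rule poly_growthI)
    show "(\<lambda>(x, e). f x e + g x e) \<in> borel_measurable borel"
      using assms borel_measurable_add [of "case_prod f" borel "case_prod g"] by (simp add: poly_growth_def case_prod_beta)
    show "0 \<le> C + D" using C D by simp
    show "\<bar>f x e + g x e\<bar> \<le> (C + D) * (1 + norm x + norm e) ^ d" for x e
      using C(2) [of x e] D(2) [of x e] abs_triangle_ineq [of "f x e" "g x e"] unfolding distrib_right by linarith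
    show "\<bar>f x e + g x e - (f y e + g y e)\<bar> * (1 + norm x + norm y + norm e)
        \<le> (C + D) * norm (x - y) * (1 + norm x + norm y + norm e) ^ d" for x y e
    proof -
      let ?W = "1 + norm x + norm y + norm e"
      have "\<bar>f x e + g x e - (f y e + g y e)\<bar> * ?W \<le> (\<bar>f x e - f y e\<bar> + \<bar>g x e - g y e\<bar>) * ?W"
        by (intro mult_right_mono) auto
      with C(3) [of x e y] D(3) [of x e y] show ?thesis unfolding distrib_right by linarith
    qed
  qed
qed

lemma poly_growth_mult:
  assumes "poly_growth d f" "poly_growth d' g" shows "poly_growth (d + d') (\<lambda>x e. f x e * g x e)"
proof -
  obtain C where C: "0 \<le> C" "\<And>x e. \<bar>f x e\<bar> \<le> C * (1 + norm x + norm e) ^ d"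
    "\<And>x y e. \<bar>f x e - f y e\<bar> * (1 + norm x + norm y + norm e) \<le> C * norm (x - y) * (1 + norm x + norm y + norm e) ^ d"
    using assms(1) unfolding poly_growth_def by blast
  obtain D where D: "0 \<le> D" "\<And>x e. \<bar>g x e\<bar> \<le> D * (1 + norm x + norm e) ^ d'"
    "\<And>x y e. \<bar>g x e - g y e\<bar> * (1 + norm x + norm y + norm e) \<le> D * norm (x - y) * (1 + norm x + norm y + norm e) ^ d'"
    using assms(2) unfolding poly_growth_def by blast
  show ?thesis
  proof (rule poly_growthI)
    show "(\<lambda>(x, e). f x e * g x e) \<in> borel_measurable borel"
      using assms borel_measurable_times [of "case_prod f" borel "case_prod g"] by (simp add: poly_growth_def case_prod_beta)
    show "0 \<le> 2 * (C * D)" using C D by simp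
    show "\<bar>f x e * g x e\<bar> \<le> 2 * (C * D) * (1 + norm x + norm e) ^ (d + d')" for x e
    proof -
      let ?W = "1 + norm x + norm e"
      have "\<bar>f x e * g x e\<bar> \<le> (C * ?W ^ d) * (D * ?W ^ d')"
        unfolding abs_mult using C D by (intro mult_mono) auto
      also have "\<dots> = 1 * (C * D * ?W ^ (d + d'))" by (simp add: power_add mult_ac)
      also have "\<dots> \<le> 2 * (C * D * ?W ^ (d + d'))" using C D by (intro mult_right_mono) auto
      finally show ?thesis by (simp add: mult_ac)
    qed
    show "\<bar>f x e * g x e - f y e * g y e\<bar> * (1 + norm x + norm y + norm e)
        \<le> 2 * (C * D) * norm (x - y) * (1 + norm x + norm y + norm e) ^ (d + d')" for x y e
    proof -
      let ?W = "1 + norm x + norm y + norm e"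
      have "f x e * g x e - f y e * g y e = f x e * (g x e - g y e) + g y e * (f x e - f y e)"
        by (simp add: algebra_simps)
      then have "\<bar>f x e * g x e - f y e * g y e\<bar> \<le> \<bar>f x e\<bar> * \<bar>g x e - g y e\<bar> + \<bar>g y e\<bar> * \<bar>f x e - f y e\<bar>"
        by (metis abs_mult abs_triangle_ineq)
      then have "\<bar>f x e * g x e - f y e * g y e\<bar> * ?W \<le> (\<bar>f x e\<bar> * \<bar>g x e - g y e\<bar> + \<bar>g y e\<bar> * \<bar>f x e - f y e\<bar>) * ?W"
        by (intro mult_right_mono) auto
      also have "\<dots> = \<bar>f x e\<bar> * (\<bar>g x e - g y e\<bar> * ?W) + \<bar>g y e\<bar> * (\<bar>f x e - f y e\<bar> * ?W)"
        by (simp add: algebra_simps)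
      also have "\<dots> \<le> (C * ?W ^ d) * (D * norm (x - y) * ?W ^ d') + (D * ?W ^ d') * (C * norm (x - y) * ?W ^ d)"
      proof -
        have f: "\<bar>f x e\<bar> \<le> C * ?W ^ d"
          using C(1) by (intro order_trans [OF C(2)] mult_left_mono power_mono) auto
        have g: "\<bar>g y e\<bar> \<le> D * ?W ^ d'"
          using D(1) by (intro order_trans [OF D(2)] mult_left_mono power_mono) auto
        show ?thesis
          by (rule add_mono; rule mult_mono) (use f g C D in auto)
      qed
      also have "\<dots> = 2 * (C * D) * norm (x - y) * ?W ^ (d + d')" by (simp add: power_add mult_ac)
      finally show ?thesis .
    qed
  qed
qed

lemma poly_growth_growth_function:
  assumes "poly_growth 4 f" shows "\<exists>C. growth_function f C"
proof -
  obtain C where C: "0 \<le> C" "\<And>x e. \<bar>f x e\<bar> \<le> C * (1 + norm x + norm e) ^ 4"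
    "\<And>x y e. \<bar>f x e - f y e\<bar> * (1 + norm x + norm y + norm e) \<le> C * norm (x - y) * (1 + norm x + norm y + norm e) ^ 4"
    using assms unfolding poly_growth_def by blast
  have "\<bar>f x e - f y e\<bar> \<le> C * norm (x - y) * (1 + norm x + norm y + norm e) ^ 3" for x y e
  proof -
    let ?W = "1 + norm x + norm y + norm e"
    have "\<bar>f x e - f y e\<bar> * ?W \<le> (C * norm (x - y) * ?W ^ 3) * ?W"
      using C(3) [of x e y] by (simp add: power4_eq_xxxx power3_eq_cube mult_ac)
    moreover have "0 < ?W" by (simp add: add_pos_nonneg)
    ultimately show ?thesis by (rule mult_right_le_imp_le)
  qed
  with C assms have "growth_function f C" by unfold_locales (auto simp: poly_growth_def)
  then show ?thesis by blast
qed

section \<open>The closed loop under the behaviour policy\<close>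

text \<open>
  The form \<open>W\<close> with \<open>W = F\<^sup>T W F + I\<close> decreases by the factor \<open>1 - 1 / n\<close> along \<open>F\<close>.  Young's inequality with weight
  \<open>1 / (2 * n)\<close> absorbs the perturbation \<open>d\<close> and still leaves the factor \<open>1 - 1 / (2 * n)\<close>.
\<close>

lemma lyapunov_drift:
  fixes F :: "real^'n^'n"
  assumes "decaying F"
  shows "\<exists>V c \<rho>. V \<in> borel_measurable borel \<and> 0 \<le> \<rho> \<and> \<rho> < 1 \<and> 1 \<le> c \<and>
    (\<forall>x. (norm x)\<^sup>2 \<le> V x) \<and> (\<forall>x. V x \<le> c * (norm x)\<^sup>2) \<and>
    (\<forall>x d. V (F *v x + d) \<le> \<rho> * V x + c * (norm d)\<^sup>2)"
proof -
  obtain W where W: "sym_mat W" "\<And>x. qf W x = qf W (F *v x) + qf (mat 1) x"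
    using lyapunov_solution [OF assms sym_mat_simps(2)] by blast
  have one: "qf (mat 1) x = (norm x)\<^sup>2" for x :: "real^'n" by (simp add: qf_def dot_square_norm)
  have nn: "0 \<le> qf W x" for x
  proof (rule superharmonic_qf_nonneg [OF assms])
    show "qf W (F *v x) \<le> qf W x" for x using W(2) [of x] one [of x] zero_le_power2 [of "norm x"] by linarith
  qed
  define n where "n = max 1 (norm W)"
  have n1: "1 \<le> n" by (simp add: n_def)
  have up: "qf W x \<le> n * (norm x)\<^sup>2" for x
    using abs_qf_le [of W x] mult_right_mono [of "norm W" n "(norm x)\<^sup>2"] by (simp add: n_def dot_square_norm)
  define r where "r = 1 - 1 / (2 * n)"
  define c where "c = (1 + 2 * n) * n"
  have young: "qf W (x + y) \<le> (1 + 1 / (2 * n)) * qf W x + (1 + 2 * n) * qf W y" for x y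
  proof -
    \<comment> \<open>These scalars distribute the weight between \<open>x\<close> and \<open>y\<close>.\<close>
    let ?a = "1 / sqrt (2 * n)" and ?b = "sqrt (2 * n)"
    have "0 \<le> qf W (?a *\<^sub>R x - ?b *\<^sub>R y)" by (rule nn)
    also have "\<dots> = (1 / (2 * n)) * qf W x - 2 * (x \<bullet> (W *v y)) + 2 * n * qf W y"
      using n1 by (simp add: qf_diff [OF W(1)] qf_scaleR_right matrix_vector_mult_scaleR power_divide)
    finally show ?thesis by (simp add: qf_add [OF W(1)] algebra_simps)
  qed
  have drift: "qf W (F *v x + d) \<le> r * qf W x + c * (norm d)\<^sup>2" for x d
  proof -
    have "qf W (F *v x) \<le> (1 - 1 / n) * qf W x"
    proof -
      have "qf W x / n \<le> (norm x)\<^sup>2" using up [of x] n1 by (simp add: divide_le_eq mult.commute)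
      moreover have "(1 - 1 / n) * qf W x = qf W x - qf W x / n" by (simp add: left_diff_distrib)
      ultimately show ?thesis using W(2) [of x] one [of x] by linarith
    qed
    then have "(1 + 1 / (2 * n)) * qf W (F *v x) \<le> (1 + 1 / (2 * n)) * ((1 - 1 / n) * qf W x)"
      using n1 by (intro mult_left_mono) auto
    also have "\<dots> \<le> r * qf W x"
    proof -
      have "(1 + 1 / (2 * n)) * (1 - 1 / n) \<le> r" using n1 by (simp add: r_def field_simps)
      from mult_right_mono [OF this nn [of x]] show ?thesis by (simp only: mult.assoc)
    qed
    moreover have "(1 + 2 * n) * qf W d \<le> c * (norm d)\<^sup>2"
      using mult_left_mono [OF up [of d], of "1 + 2 * n"] n1 by (simp add: c_def mult.assoc)
    ultimately show ?thesis using young [of "F *v x" d] by linarith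
  qed
  have c: "n \<le> c" "1 \<le> c"
  proof -
    show "n \<le> c" using n1 by (simp add: c_def)
    with n1 show "1 \<le> c" by linarith
  qed
  show ?thesis
  proof (intro exI conjI allI)
    show "qf W \<in> borel_measurable borel" by (intro borel_measurable_continuous_onI continuous_qf)
    show "0 \<le> r" "r < 1" "1 \<le> c" using n1 c by (simp_all add: r_def field_simps)
    show "(norm x)\<^sup>2 \<le> qf W x" for x using W(2) [of x] one [of x] nn [of "F *v x"] by linarith
    show "qf W x \<le> c * (norm x)\<^sup>2" for x
      using up [of x] mult_right_mono [OF c(1), of "(norm x)\<^sup>2"] by simp
    show "qf W (F *v x + d) \<le> r * qf W x + c * (norm d)\<^sup>2" for x d by (rule drift)
  qed
qed

definition closed_loop :: "real^'n^'n \<Rightarrow> real^'m^'n \<Rightarrow> real^'q^'n \<Rightarrow> real^'n^'m \<Rightarrow> real^'n \<Rightarrow> (real^'m) \<times> (real^'q) \<Rightarrow> real^'n" where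
  "closed_loop A B C K x e = A *v x + B *v (- (K *v x) + fst e) + C *v snd e"

lemma closed_loop_eq: "closed_loop A B C K x e = (A - B ** K) *v x + (B *v fst e + C *v snd e)"
  unfolding closed_loop_def feedback_eq [symmetric] matrix_vector_right_distrib
  by (simp only: add.assoc)

lemma closed_loop_contractive:
  assumes "stabilizing A B K"
  shows "\<exists>V \<rho> c. contractive_recursion (closed_loop A B C K) V \<rho> c"
proof -
  obtain V c \<rho> where V: "V \<in> borel_measurable borel" "0 \<le> \<rho>" "\<rho> < 1" "1 \<le> c"
    "\<And>x. (norm x)\<^sup>2 \<le> V x" "\<And>x. V x \<le> c * (norm x)\<^sup>2"
    "\<And>x d. V ((A - B ** K) *v x + d) \<le> \<rho> * V x + c * (norm d)\<^sup>2"
    using lyapunov_drift assms unfolding stabilizing_iff by meson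
  define l where "l = (norm B + norm C + 1)\<^sup>2"
  have l1: "1 \<le> l" unfolding l_def by (rule one_le_power) simp
  have d: "(norm (B *v v + C *v w))\<^sup>2 \<le> l * (norm (v, w))\<^sup>2" for v w
  proof -
    have "norm (B *v v + C *v w) \<le> norm B * norm v + norm C * norm w"
      by (intro order_trans [OF norm_triangle_ineq] add_mono norm_matrix_vector_le)
    also have "\<dots> \<le> norm B * norm (v, w) + norm C * norm (v, w)"
      by (intro add_mono mult_left_mono) (simp_all add: norm_Pair real_le_rsqrt)
    also have "\<dots> \<le> (norm B + norm C + 1) * norm (v, w)" by (simp add: distrib_right)
    finally have "(norm (B *v v + C *v w))\<^sup>2 \<le> ((norm B + norm C + 1) * norm (v, w))\<^sup>2"
      by (rule power_mono) simp
    then show ?thesis by (simp add: l_def power_mult_distrib)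
  qed
  have cl: "c \<le> c * l" using V(4) l1 by simp
  have "contractive_recursion (closed_loop A B C K) V \<rho> (c * l)"
  proof
    have "continuous_on UNIV (case_prod (closed_loop A B C K))"
      unfolding closed_loop_def case_prod_beta
      by (intro continuous_intros bounded_linear.continuous_on [OF matrix_vector_mul_bounded_linear])
    then show "case_prod (closed_loop A B C K) \<in> borel_measurable borel"
      by (rule borel_measurable_continuous_onI)
    show "V \<in> borel_measurable borel" "0 \<le> \<rho>" "\<rho> < 1" by fact+
    show "1 \<le> c * l" using V(4) cl by linarith
    show "(norm x)\<^sup>2 \<le> V x" for x by fact
    show "V x \<le> c * l * (norm x)\<^sup>2" for x
      using V(6) [of x] mult_right_mono [OF cl, of "(norm x)\<^sup>2"] by simp
    show "V (closed_loop A B C K x e) \<le> \<rho> * V x + c * l * (norm e)\<^sup>2" for x e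
    proof -
      have "c * (norm (B *v fst e + C *v snd e))\<^sup>2 \<le> c * (l * (norm e)\<^sup>2)"
        using d [of "fst e" "snd e"] V(4) by (intro mult_left_mono) simp_all
      then show ?thesis
        using V(7) [of x "B *v fst e + C *v snd e"] unfolding closed_loop_eq mult.assoc by linarith
    qed
    show "V (closed_loop A B C K x e - closed_loop A B C K y e) \<le> \<rho> * V (x - y)" for x y e
      using V(7) [of "x - y" 0] by (simp add: closed_loop_eq matrix_vector_mult_diff_distrib)
  qed
  then show ?thesis by blast
qed

text \<open>
  The invariant distribution lives on pairs of state and input.  Its marginal on states, with fresh input noise, gives it
  back, so it suffices to follow the Markov chain of states.
\<close>

locale behavior_process =
  fixes A :: "real^'n^'n" and B :: "real^'m^'n" and C :: "real^'q^'n" and K :: "real^'n^'m"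
    and xini :: "real^'n" and \<sigma> :: real and \<Omega> :: "'w measure"
    and ws :: "nat \<Rightarrow> 'w \<Rightarrow> real^'q" and vs :: "nat \<Rightarrow> 'w \<Rightarrow> real^'m"
    and \<pi> :: "((real^'n) \<times> (real^'m)) measure"
  assumes \<Omega>: "prob_space \<Omega>" and ws: "iid_gauss \<Omega> 1 ws" and vs: "iid_gauss \<Omega> \<sigma> vs"
    and ws_vs: "indep_processes \<Omega> ws vs" and K: "stabilizing A B K"
    and \<pi>: "invariant_dist A B C K \<sigma> \<pi>" and second_moment: "invertible (second_moment \<pi>)"
begin

sublocale \<Omega>: prob_space \<Omega> by (rule \<Omega>)

sublocale \<gamma>w: prob_space "gauss_vec 1 :: (real^'q) measure"
proof -
  have "distr \<Omega> borel (ws 0) = gauss_vec 1" "\<Omega>.random_variable borel (ws 0)"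
    using ws by (simp_all add: iid_gauss_def \<Omega>.indep_vars_def)
  then show "prob_space (gauss_vec 1 :: (real^'q) measure)" using \<Omega>.prob_space_distr by metis
qed

sublocale \<gamma>v: prob_space "gauss_vec \<sigma> :: (real^'m) measure"
proof -
  have "distr \<Omega> borel (vs 0) = gauss_vec \<sigma>" "\<Omega>.random_variable borel (vs 0)"
    using vs by (simp_all add: iid_gauss_def \<Omega>.indep_vars_def)
  then show "prob_space (gauss_vec \<sigma> :: (real^'m) measure)" using \<Omega>.prob_space_distr by metis
qed

abbreviation \<gamma> :: "((real^'m) \<times> (real^'q)) measure" where "\<gamma> \<equiv> gauss_vec \<sigma> \<Otimes>\<^sub>M gauss_vec 1"

sublocale \<gamma>: pair_prob_space "gauss_vec \<sigma> :: (real^'m) measure" "gauss_vec 1 :: (real^'q) measure" ..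

lemma sets_\<gamma>: "sets \<gamma> = sets borel"
  by (subst sets_pair_measure_cong [OF sets_gauss_vec sets_gauss_vec], subst borel_prod, simp)

lemma sets_\<pi> [measurable_cong]: "sets \<pi> = sets borel"
  using \<pi> by (simp add: invariant_dist_def)

sublocale \<pi>: prob_space \<pi>
  using \<pi> by (simp add: invariant_dist_def)

definition \<mu> :: "(real^'n) measure" where "\<mu> = distr \<pi> borel fst"

lemma sets_\<mu> [measurable_cong]: "sets \<mu> = sets borel" by (simp add: \<mu>_def)

lemma fst_\<pi>_measurable [measurable]: "fst \<in> borel_measurable \<pi>" "snd \<in> borel_measurable \<pi>"
  by (simp_all add: measurable_cong_sets [OF sets_\<pi> refl] borel_measurable_continuous_onI continuous_intros)

sublocale \<mu>: prob_space \<mu>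
  unfolding \<mu>_def by (rule \<pi>.prob_space_distr) measurable

definition plant :: "(real^'n) \<times> (real^'m) \<Rightarrow> real^'q \<Rightarrow> real^'n" where
  "plant z w = A *v fst z + B *v snd z + C *v w"

lemma mat_vec_measurable [measurable (raw)]:
  fixes X :: "real^'a^'b"
  assumes "f \<in> borel_measurable N" shows "(\<lambda>z. X *v f z) \<in> borel_measurable N"
  by (rule measurable_compose [OF assms borel_measurable_continuous_onI])
    (intro bounded_linear.continuous_on [OF matrix_vector_mul_bounded_linear] continuous_intros)

text \<open>
  One closed-loop step preserves \<open>\<pi>\<close>, by definition of an invariant distribution.
\<close>

lemma nn_integral_\<pi>_step:
  assumes [measurable]: "h \<in> borel_measurable (borel \<Otimes>\<^sub>M borel)"
  shows "(\<integral>\<^sup>+z. h z \<partial>\<pi>)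
    = (\<integral>\<^sup>+z. \<integral>\<^sup>+w. \<integral>\<^sup>+v. h (plant z w, - (K *v plant z w) + v) \<partial>gauss_vec \<sigma> \<partial>gauss_vec 1 \<partial>\<pi>)"
proof -
  let ?N = "gauss_vec 1 \<Otimes>\<^sub>M gauss_vec \<sigma> :: ((real^'q) \<times> (real^'m)) measure"
  let ?T = "\<lambda>((x, u), (w, v)). let x' = A *v x + B *v u + C *v w in (x', - (K *v x') + v)"
  interpret N: pair_prob_space "gauss_vec 1 :: (real^'q) measure" "gauss_vec \<sigma> :: (real^'m) measure" ..
  have T: "?T = (\<lambda>z. (plant (fst z) (fst (snd z)), - (K *v plant (fst z) (fst (snd z))) + snd (snd z)))"
    by (auto simp: plant_def Let_def)
  have "(\<integral>\<^sup>+z. h z \<partial>\<pi>) = (\<integral>\<^sup>+z. h z \<partial>distr (\<pi> \<Otimes>\<^sub>M ?N) (borel \<Otimes>\<^sub>M borel) ?T)"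
    using \<pi> unfolding invariant_dist_def borel_prod by simp
  also have "\<dots> = (\<integral>\<^sup>+z. h (plant (fst z) (fst (snd z)), - (K *v plant (fst z) (fst (snd z))) + snd (snd z)) \<partial>(\<pi> \<Otimes>\<^sub>M ?N))"
    unfolding T by (subst nn_integral_distr) (simp_all add: plant_def)
  also have "\<dots> = (\<integral>\<^sup>+z. \<integral>\<^sup>+e. h (plant z (fst e), - (K *v plant z (fst e)) + snd e) \<partial>?N \<partial>\<pi>)"
    by (subst N.nn_integral_fst [symmetric]) (simp_all add: plant_def)
  also have "\<dots> = (\<integral>\<^sup>+z. \<integral>\<^sup>+w. \<integral>\<^sup>+v. h (plant z w, - (K *v plant z w) + v) \<partial>gauss_vec \<sigma> \<partial>gauss_vec 1 \<partial>\<pi>)"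
    by (intro nn_integral_cong, subst \<gamma>v.nn_integral_fst [symmetric]) (simp_all add: plant_def)
  finally show ?thesis .
qed

lemma nn_integral_\<mu>_step:
  assumes [measurable]: "k \<in> borel_measurable borel"
  shows "(\<integral>\<^sup>+x. k x \<partial>\<mu>) = (\<integral>\<^sup>+z. \<integral>\<^sup>+w. k (plant z w) \<partial>gauss_vec 1 \<partial>\<pi>)"
proof -
  have "(\<integral>\<^sup>+x. k x \<partial>\<mu>) = (\<integral>\<^sup>+z. k (fst z) \<partial>\<pi>)" unfolding \<mu>_def by (rule nn_integral_distr) measurable
  also have "\<dots> = (\<integral>\<^sup>+z. \<integral>\<^sup>+w. k (plant z w) \<partial>gauss_vec 1 \<partial>\<pi>)"
    by (subst nn_integral_\<pi>_step) (simp_all add: \<gamma>v.emeasure_space_1 [simplified])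
  finally show ?thesis .
qed

lemma nn_integral_\<pi>:
  assumes [measurable]: "h \<in> borel_measurable (borel \<Otimes>\<^sub>M borel)"
  shows "(\<integral>\<^sup>+z. h z \<partial>\<pi>) = (\<integral>\<^sup>+x. \<integral>\<^sup>+v. h (x, - (K *v x) + v) \<partial>gauss_vec \<sigma> \<partial>\<mu>)"
  by (subst nn_integral_\<mu>_step) (simp_all add: nn_integral_\<pi>_step)

lemma \<mu>_stationary:
  assumes [measurable]: "k \<in> borel_measurable borel"
  shows "(\<integral>\<^sup>+x. k x \<partial>\<mu>) = (\<integral>\<^sup>+x. \<integral>\<^sup>+e. k (closed_loop A B C K x e) \<partial>\<gamma> \<partial>\<mu>)"
proof -
  have "(\<integral>\<^sup>+x. k x \<partial>\<mu>) = (\<integral>\<^sup>+x. \<integral>\<^sup>+v. \<integral>\<^sup>+w. k (plant (x, - (K *v x) + v) w) \<partial>gauss_vec 1 \<partial>gauss_vec \<sigma> \<partial>\<mu>)"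
    unfolding nn_integral_\<mu>_step [OF assms] by (rule nn_integral_\<pi>) (simp add: plant_def)
  also have "\<dots> = (\<integral>\<^sup>+x. \<integral>\<^sup>+e. k (plant (x, - (K *v x) + fst e) (snd e)) \<partial>\<gamma> \<partial>\<mu>)"
    by (intro nn_integral_cong, subst \<gamma>w.nn_integral_fst [symmetric]) (simp_all add: plant_def)
  finally show ?thesis by (simp add: plant_def closed_loop_def)
qed

sublocale \<mu>\<gamma>: pair_prob_space \<mu> \<gamma> ..

text \<open>
  Under \<open>\<pi>\<close> the input noise is independent of the state, because it is drawn after it.
\<close>

lemma distr_\<mu>\<gamma>_\<pi>:
  "distr (\<mu> \<Otimes>\<^sub>M \<gamma>) (borel \<Otimes>\<^sub>M borel) (\<lambda>z. (fst z, - (K *v fst z) + fst (snd z))) = \<pi>" (is "?L = _")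
proof (rule measure_eqI)
  show "sets ?L = sets \<pi>" by (simp only: sets_distr sets_\<pi> borel_prod)
  fix D assume "D \<in> sets ?L"
  then have D [measurable]: "D \<in> sets (borel \<Otimes>\<^sub>M borel)" by simp
  then have D\<pi>: "D \<in> sets \<pi>" unfolding sets_\<pi> borel_prod .
  have "emeasure ?L D = (\<integral>\<^sup>+z. indicator D (fst z, - (K *v fst z) + fst (snd z)) \<partial>(\<mu> \<Otimes>\<^sub>M \<gamma>))"
    by (subst nn_integral_indicator [symmetric], simp, subst nn_integral_distr) simp_all
  also have "\<dots> = (\<integral>\<^sup>+x. \<integral>\<^sup>+e. indicator D (x, - (K *v x) + fst e) \<partial>\<gamma> \<partial>\<mu>)"
    by (subst \<gamma>.nn_integral_fst [symmetric]) simp_all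
  also have "\<dots> = (\<integral>\<^sup>+x. \<integral>\<^sup>+v. indicator D (x, - (K *v x) + v) \<partial>gauss_vec \<sigma> \<partial>\<mu>)"
    by (intro nn_integral_cong, subst \<gamma>w.nn_integral_fst [symmetric])
      (simp_all add: \<gamma>w.emeasure_space_1 [simplified])
  also have "\<dots> = (\<integral>\<^sup>+z. indicator D z \<partial>\<pi>)" by (rule nn_integral_\<pi> [symmetric]) simp
  also have "\<dots> = emeasure \<pi> D" using D\<pi> by simp
  finally show "emeasure ?L D = emeasure \<pi> D" .
qed

definition x_traj :: "'w \<Rightarrow> nat \<Rightarrow> real^'n" where
  "x_traj \<omega> = state A B C K xini (\<lambda>k. ws k \<omega>) (\<lambda>k. vs k \<omega>)"

definition u_traj :: "'w \<Rightarrow> nat \<Rightarrow> real^'m" where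
  "u_traj \<omega> = input A B C K xini (\<lambda>k. ws k \<omega>) (\<lambda>k. vs k \<omega>)"

lemma u_traj_eq: "u_traj \<omega> k = - (K *v x_traj \<omega> k) + vs k \<omega>"
  by (simp add: u_traj_def x_traj_def input_def)

lemma x_traj_Suc: "x_traj \<omega> (Suc k) = closed_loop A B C K (x_traj \<omega> k) (vs k \<omega>, ws k \<omega>)"
  by (simp add: x_traj_def closed_loop_def Let_def)

text \<open>
  A Bochner integral that does not exist has the value 0, which is not invertible.
\<close>

lemma integrable_outer_\<pi>:
  "integrable \<pi> (\<lambda>z. outer (vtilde (zvec (fst z) (snd z))) (vtilde (zvec (fst z) (snd z))))"
proof (rule ccontr)
  assume "\<not> ?thesis"
  then have "second_moment \<pi> = 0"
    unfolding second_moment_def case_prod_beta by (rule not_integrable_integral_eq)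
  with second_moment obtain X where "(0 :: real^((('n + 'm) + 1) uprod)^((('n + 'm) + 1) uprod)) ** X = mat 1"
    unfolding invertible_def by auto
  then have "(0 :: real^((('n + 'm) + 1) uprod)^((('n + 'm) + 1) uprod)) = mat 1"
    by (simp add: matrix_matrix_mult_def vec_eq_iff)
  from arg_cong [OF this, of "\<lambda>Z. Z $ i $ i" for i] show False by (simp add: mat_def)
qed

lemma bounded_linear_entry: "bounded_linear (\<lambda>Z :: real^'c^'r. Z $ i $ j)"
  by (rule bounded_linear_compose [OF bounded_linear_vec_nth bounded_linear_vec_nth])

lemma outer_entry_\<pi>:
  "integrable \<pi> (\<lambda>z. vtilde (zvec (fst z) (snd z)) $ p * vtilde (zvec (fst z) (snd z)) $ q)"
  "second_moment \<pi> $ p $ q = (\<integral>z. vtilde (zvec (fst z) (snd z)) $ p * vtilde (zvec (fst z) (snd z)) $ q \<partial>\<pi>)"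
proof -
  have e: "outer a b $ p $ q = a $ p * b $ q" for a b :: "real^((('n + 'm) + 1) uprod)" by (simp add: outer_def)
  show "integrable \<pi> (\<lambda>z. vtilde (zvec (fst z) (snd z)) $ p * vtilde (zvec (fst z) (snd z)) $ q)"
    using integrable_bounded_linear [OF bounded_linear_entry [of p q] integrable_outer_\<pi>] by (simp only: e)
  show "second_moment \<pi> $ p $ q = (\<integral>z. vtilde (zvec (fst z) (snd z)) $ p * vtilde (zvec (fst z) (snd z)) $ q \<partial>\<pi>)"
    using integral_bounded_linear [OF bounded_linear_entry [of p q] integrable_outer_\<pi>]
    by (simp only: e second_moment_def case_prod_beta')
qed

lemma \<mu>_fourth_moment: "integrable \<mu> (\<lambda>x. norm x ^ 4)"
proof -
  have i4: "integrable \<pi> (\<lambda>z. fst z $ i ^ 4)" for i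
  proof -
    let ?p = "Upair (Inl (Inl i)) (Inl (Inl i)) :: (('n + 'm) + 1) uprod"
    have "vtilde (zvec x u) $ ?p * vtilde (zvec x u) $ ?p = x $ i ^ 4" for x :: "real^'n" and u :: "real^'m"
      by (simp add: vtilde_Upair zvec_def power4_eq_xxxx)
    then show ?thesis using outer_entry_\<pi>(1) [of ?p ?p] by simp
  qed
  have "integrable \<pi> (\<lambda>z. norm (fst z) ^ 4)"
  proof (rule Bochner_Integration.integrable_bound)
    show "integrable \<pi> (\<lambda>z. real CARD('n) ^ 4 * (\<Sum>i\<in>UNIV. fst z $ i ^ 4))" using i4 by auto
    show "AE z in \<pi>. norm (norm (fst z) ^ 4) \<le> norm (real CARD('n) ^ 4 * (\<Sum>i\<in>UNIV. fst z $ i ^ 4))"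
    proof (rule AE_I2)
      fix z :: "(real^'n) \<times> (real^'m)"
      have "norm (fst z) ^ 4 \<le> (\<Sum>i\<in>UNIV. \<bar>fst z $ i\<bar>) ^ 4" by (intro power_mono norm_le_l1_cart) simp
      also have "\<dots> \<le> real CARD('n) ^ 4 * (\<Sum>i\<in>UNIV. \<bar>fst z $ i\<bar> ^ 4)" by (rule sum_power_le) auto
      finally show "norm (norm (fst z) ^ 4) \<le> norm (real CARD('n) ^ 4 * (\<Sum>i\<in>UNIV. fst z $ i ^ 4))"
        by (simp add: power_even_abs sum_nonneg)
    qed
  qed measurable
  then show ?thesis unfolding \<mu>_def by (subst integrable_distr_eq) measurable
qed

lemma \<gamma>_eighth_moment: "integrable \<gamma> (\<lambda>e. norm e ^ 8)"
proof (rule Bochner_Integration.integrable_bound)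
  show "integrable \<gamma> (\<lambda>e. 5 ^ 8 * (1 + norm (fst e) ^ 8 + norm (snd e) ^ 8))"
    using \<gamma>.integral_comp_fst [OF gauss_vec_eighth_moment] \<gamma>.integral_comp_snd [OF gauss_vec_eighth_moment]
    by auto
  show "AE e in \<gamma>. norm (norm e ^ 8) \<le> norm (5 ^ 8 * (1 + norm (fst e) ^ 8 + norm (snd e) ^ 8))"
  proof (rule AE_I2)
    fix e :: "(real^'m) \<times> (real^'q)"
    have "norm e \<le> norm (fst e) + norm (snd e)" using norm_Pair_le [of "fst e" "snd e"] by simp
    then have "norm e ^ 8 \<le> (1 + norm (fst e) + norm (snd e) + 0 + 0) ^ 8" by (intro power_mono) auto
    also have "\<dots> \<le> 5 ^ 8 * (1 + norm (fst e) ^ 8 + norm (snd e) ^ 8 + 0 ^ 8 + 0 ^ 8)"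
      by (rule sum5_power_le) auto
    finally show "norm (norm e ^ 8) \<le> norm (5 ^ 8 * (1 + norm (fst e) ^ 8 + norm (snd e) ^ 8))" by simp
  qed
  show "(\<lambda>e. norm e ^ 8) \<in> borel_measurable \<gamma>" unfolding measurable_cong_sets [OF sets_\<gamma> refl] by measurable
qed

lemma trajectory_averages:
  assumes "poly_growth 4 f"
  shows "AE \<omega> in \<Omega>. (\<lambda>n. (\<Sum>k<n. f (x_traj \<omega> k) (vs k \<omega>, ws k \<omega>)) / n)
      \<longlonglongrightarrow> (\<integral>z. f (fst z) (snd z) \<partial>(\<mu> \<Otimes>\<^sub>M \<gamma>))"
proof -
  obtain V \<rho> c where V: "contractive_recursion (closed_loop A B C K) V \<rho> c"
    using closed_loop_contractive [OF K] by blast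
  obtain Cf where f: "growth_function f Cf" using poly_growth_growth_function [OF assms] by blast
  let ?\<eta> = "\<lambda>k \<omega>. (vs k \<omega>, ws k \<omega>)"
  interpret contractive_recursion "closed_loop A B C K" V \<rho> c by (rule V)
  interpret growth_function f Cf by (rule f)
  interpret driven_process "closed_loop A B C K" V \<rho> c f Cf \<Omega> ?\<eta> \<gamma> \<mu> xini
  proof unfold_locales
    show "\<Omega>.indep_vars (\<lambda>_. borel) ?\<eta> UNIV" by (rule indep_processes_pairs(1) [OF \<Omega> ws vs ws_vs])
    show "distr \<Omega> borel (?\<eta> k) = \<gamma>" for k by (rule indep_processes_pairs(2) [OF \<Omega> ws vs ws_vs])
    show "integrable \<gamma> (\<lambda>e. norm e ^ 8)" by (rule \<gamma>_eighth_moment)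
    show "sets \<mu> = sets borel" by (rule sets_\<mu>)
    show "integrable \<mu> (\<lambda>x. norm x ^ 4)" by (rule \<mu>_fourth_moment)
    show "(\<integral>\<^sup>+x. h x \<partial>\<mu>) = (\<integral>\<^sup>+x. (\<integral>\<^sup>+e. h (closed_loop A B C K x e) \<partial>\<gamma>) \<partial>\<mu>)"
      if "h \<in> borel_measurable borel" for h :: "real^'n \<Rightarrow> ennreal" by (rule \<mu>_stationary [OF that])
  qed
  have "traj (\<lambda>i. (vs i \<omega>, ws i \<omega>)) 0 xini k = x_traj \<omega> k" for \<omega> k
  proof (induction k)
    case 0 show ?case by (simp add: x_traj_def)
  next
    case (Suc k) then show ?case by (simp only: traj.simps x_traj_Suc add_0)
  qed
  with averages_tendsto show ?thesis by (simp add: mean_stationary_def)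
qed

definition regressor :: "real^'n \<Rightarrow> (real^'m) \<times> (real^'q) \<Rightarrow> real^(('n + 'm) + 1)" where
  "regressor x e = zvec x (- (K *v x) + fst e)"

lemma poly_growth_regressor: "poly_growth 1 (\<lambda>x e. regressor x e $ a)"
proof (cases a)
  case (Inl b)
  show ?thesis
  proof (cases b)
    case (Inl i)
    have "linear (\<lambda>z :: (real^'n) \<times> ((real^'m) \<times> (real^'q)). fst z $ i)" by (rule linearI) simp_all
    from poly_growth_linear [OF this] show ?thesis by (simp add: regressor_def zvec_def Inl \<open>a = Inl b\<close>)
  next
    case (Inr i)
    have "linear (\<lambda>z :: (real^'n) \<times> ((real^'m) \<times> (real^'q)). (- (K *v fst z) + fst (snd z)) $ i)"
      by (rule linearI) (simp_all add: matrix_vector_right_distrib matrix_vector_mult_scaleR algebra_simps)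
    from poly_growth_linear [OF this] show ?thesis by (simp add: regressor_def zvec_def Inr \<open>a = Inl b\<close>)
  qed
next
  case (Inr c)
  then show ?thesis
    using poly_growth_mono [OF poly_growth_const [of 1], of 1] by (simp add: regressor_def zvec_def)
qed

lemma poly_growth_vtilde: "poly_growth 2 (\<lambda>x e. vtilde (regressor x e) $ p)"
proof (cases p)
  case (Upair a b)
  have "poly_growth (1 + 1) (\<lambda>x e. regressor x e $ a * regressor x e $ b)" by (intro poly_growth_mult poly_growth_regressor)
  then have ab: "poly_growth 2 (\<lambda>x e. regressor x e $ a * regressor x e $ b)" by (simp add: numeral_2_eq_2)
  then have "poly_growth 2 (\<lambda>x e. sqrt 2 * (regressor x e $ a * regressor x e $ b))"
    using poly_growth_mult [OF poly_growth_const [of "sqrt 2"] ab] by (simp only: add_0)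
  with ab show ?thesis by (cases "a = b") (simp_all add: Upair vtilde_Upair)
qed

text \<open>
  The summand of \<open>residual\<close> as a function of the state and the noise of the current step.
\<close>

definition residual_at :: "'n \<Rightarrow> 'n \<Rightarrow> real^'n \<Rightarrow> (real^'m) \<times> (real^'q) \<Rightarrow> real" where
  "residual_at i j x e = closed_loop A B C K x e $ i * closed_loop A B C K x e $ j
     - ((A *v x + B *v (- (K *v x) + fst e)) $ i * (A *v x + B *v (- (K *v x) + fst e)) $ j + (C ** transpose C) $ i $ j)"

lemma poly_growth_residual_at: "poly_growth 2 (residual_at i j)"
proof -
  let ?m = "\<lambda>x (e :: (real^'m) \<times> (real^'q)). A *v x + B *v (- (K *v x) + fst e)"
  have cl: "poly_growth 1 (\<lambda>x e. closed_loop A B C K x e $ i)" for i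
  proof -
    have "linear (\<lambda>z. closed_loop A B C K (fst z) (snd z) $ i)"
      by (rule linearI) (simp_all add: closed_loop_eq matrix_vector_right_distrib matrix_vector_mult_scaleR algebra_simps)
    from poly_growth_linear [OF this] show ?thesis by simp
  qed
  have m: "poly_growth 1 (\<lambda>x e. ?m x e $ i)" for i
  proof -
    have "linear (\<lambda>z :: (real^'n) \<times> ((real^'m) \<times> (real^'q)). ?m (fst z) (snd z) $ i)"
    proof -
      have eq: "?m (fst z) (snd z) = (A - B ** K) *v fst z + B *v fst (snd z)" for z :: "(real^'n) \<times> ((real^'m) \<times> (real^'q))"
        using closed_loop_eq [of A B 0 K "fst z" "snd z"] by (simp add: closed_loop_def)
      show ?thesis unfolding eq
        by (rule linearI) (simp_all add: matrix_vector_right_distrib matrix_vector_mult_scaleR algebra_simps)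
    qed
    from poly_growth_linear [OF this] show ?thesis by simp
  qed
  have 1: "poly_growth (1 + 1) (\<lambda>x e. closed_loop A B C K x e $ i * closed_loop A B C K x e $ j)"
    by (intro poly_growth_mult cl)
  have 2: "poly_growth (0 + (1 + 1)) (\<lambda>x e. (- 1) * (?m x e $ i * ?m x e $ j))"
    by (intro poly_growth_mult poly_growth_const m)
  have 3: "poly_growth 2 (\<lambda>x e. - ((C ** transpose C) $ i $ j))"
    by (rule poly_growth_mono [OF poly_growth_const]) simp
  have "poly_growth 2 (\<lambda>x e. closed_loop A B C K x e $ i * closed_loop A B C K x e $ j
      + ((- 1) * (?m x e $ i * ?m x e $ j) + - ((C ** transpose C) $ i $ j)))"
    using 1 2 3 by (intro poly_growth_add) (simp_all add: numeral_2_eq_2)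
  moreover have "residual_at i j = (\<lambda>x e. closed_loop A B C K x e $ i * closed_loop A B C K x e $ j
      + ((- 1) * (?m x e $ i * ?m x e $ j) + - ((C ** transpose C) $ i $ j)))"
    by (simp add: residual_at_def fun_eq_iff)
  ultimately show ?thesis by simp
qed

text \<open>
  With \<open>m = A x + B u\<close>, the residual is linear in \<open>C y\<close> plus the deviation of \<open>(C y) (C y)\<^sup>T\<close> from its mean \<open>C C\<^sup>T\<close>.
\<close>

lemma residual_at_mean_zero: "(\<integral>y. residual_at i j x (a, y) \<partial>gauss_vec 1) = 0"
proof -
  define m where "m = A *v x + B *v (- (K *v x) + a)"
  have Cy: "(C *v y) $ i = (\<Sum>b\<in>UNIV. C $ i $ b * y $ b)" for i y by (simp add: matrix_vector_mult_def)
  have i1: "integrable (gauss_vec 1) (\<lambda>y. (C *v y) $ i)" for i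
    unfolding Cy by (intro Bochner_Integration.integrable_sum integrable_mult_right gauss_vec_coordinate(1))
  have e1: "(\<integral>y. (C *v y) $ i \<partial>gauss_vec 1) = 0" for i
    unfolding Cy
    by (subst Bochner_Integration.integral_sum)
      (simp_all add: gauss_vec_coordinate integrable_mult_right)
  have CC: "(C *v y) $ i * (C *v y) $ j = (\<Sum>b\<in>UNIV. \<Sum>b'\<in>UNIV. (C $ i $ b * C $ j $ b') * (y $ b * y $ b'))" for y
    unfolding Cy sum_product by (intro sum.cong) auto
  have i2: "integrable (gauss_vec 1) (\<lambda>y. (C *v y) $ i * (C *v y) $ j)"
    unfolding CC by (intro Bochner_Integration.integrable_sum integrable_mult_right gauss_vec_covariance(1))
  have e2: "(\<integral>y. (C *v y) $ i * (C *v y) $ j \<partial>gauss_vec 1) = (C ** transpose C) $ i $ j"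
  proof -
    have "(\<integral>y. (C *v y) $ i * (C *v y) $ j \<partial>gauss_vec 1)
        = (\<Sum>b\<in>UNIV. \<Sum>b'\<in>UNIV. (C $ i $ b * C $ j $ b') * (if b = b' then 1 else 0))"
      unfolding CC by (simp add: gauss_vec_covariance integrable_mult_right)
    also have "\<dots> = (\<Sum>b\<in>UNIV. C $ i $ b * C $ j $ b)"
      by (simp add: if_distrib sum.delta' cong: if_cong)
    finally show ?thesis by (simp add: matrix_matrix_mult_def transpose_def)
  qed
  have "residual_at i j x (a, y) = m $ i * (C *v y) $ j + m $ j * (C *v y) $ i + (C *v y) $ i * (C *v y) $ j
      - (C ** transpose C) $ i $ j" for y
  proof -
    have "closed_loop A B C K x (a, y) = m + C *v y" by (simp add: closed_loop_def m_def)
    then have "residual_at i j x (a, y) = (m + C *v y) $ i * (m + C *v y) $ j - (m $ i * m $ j + (C ** transpose C) $ i $ j)"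
      by (simp only: residual_at_def fst_conv m_def [symmetric])
    then show ?thesis by (simp add: algebra_simps)
  qed
  then show ?thesis using i1 i2 e1 e2 by (simp add: \<gamma>w.prob_space [simplified])
qed

lemma weighted_residual_mean_zero:
  "(\<integral>z. residual_at i j (fst z) (snd z) * vtilde (regressor (fst z) (snd z)) $ p \<partial>(\<mu> \<Otimes>\<^sub>M \<gamma>)) = 0"
proof (cases "integrable (\<mu> \<Otimes>\<^sub>M \<gamma>) (\<lambda>z. residual_at i j (fst z) (snd z) * vtilde (regressor (fst z) (snd z)) $ p)")
  case True
  \<comment> \<open>If an integral below does not exist, its value is 0 anyway.\<close>
  have inner: "(\<integral>e. residual_at i j x e * vtilde (regressor x e) $ p \<partial>\<gamma>) = 0" for x
  proof (cases "integrable \<gamma> (\<lambda>e. residual_at i j x e * vtilde (regressor x e) $ p)")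
    case True
    have "(\<integral>e. residual_at i j x e * vtilde (regressor x e) $ p \<partial>\<gamma>)
        = (\<integral>a. \<integral>y. residual_at i j x (a, y) * vtilde (regressor x (a, y)) $ p \<partial>gauss_vec 1 \<partial>gauss_vec \<sigma>)"
      by (rule \<gamma>.integral_fst' [OF True, symmetric])
    also have "\<dots> = 0" by (simp add: regressor_def residual_at_mean_zero)
    finally show ?thesis .
  qed (rule not_integrable_integral_eq)
  have "(\<integral>z. residual_at i j (fst z) (snd z) * vtilde (regressor (fst z) (snd z)) $ p \<partial>(\<mu> \<Otimes>\<^sub>M \<gamma>))
      = (\<integral>x. \<integral>e. residual_at i j x e * vtilde (regressor x e) $ p \<partial>\<gamma> \<partial>\<mu>)"
    using \<mu>\<gamma>.integral_fst' [OF True] by simp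
  then show ?thesis by (simp add: inner)
qed (rule not_integrable_integral_eq)

lemma Phi_data_tendsto:
  "AE \<omega> in \<Omega>. Phi_data (x_traj \<omega>) (u_traj \<omega>) \<longlonglongrightarrow> second_moment \<pi>"
proof -
  have entry: "AE \<omega> in \<Omega>. (\<lambda>M. Phi_data (x_traj \<omega>) (u_traj \<omega>) M $ p $ q) \<longlonglongrightarrow> second_moment \<pi> $ p $ q" for p q
  proof -
    let ?f = "\<lambda>x e. vtilde (regressor x e) $ p * vtilde (regressor x e) $ q"
    have "poly_growth (2 + 2) ?f" by (intro poly_growth_mult poly_growth_vtilde)
    then have "AE \<omega> in \<Omega>. (\<lambda>n. (\<Sum>k<n. ?f (x_traj \<omega> k) (vs k \<omega>, ws k \<omega>)) / n)
        \<longlonglongrightarrow> (\<integral>z. ?f (fst z) (snd z) \<partial>(\<mu> \<Otimes>\<^sub>M \<gamma>))"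
      by (intro trajectory_averages) simp
    moreover have "(\<integral>z. ?f (fst z) (snd z) \<partial>(\<mu> \<Otimes>\<^sub>M \<gamma>)) = second_moment \<pi> $ p $ q"
    proof -
      let ?h = "\<lambda>z :: (real^'n) \<times> (real^'m). vtilde (zvec (fst z) (snd z)) $ p * vtilde (zvec (fst z) (snd z)) $ q"
      have "?h \<in> borel_measurable \<pi>" using outer_entry_\<pi>(1) by (rule borel_measurable_integrable)
      then have h: "?h \<in> borel_measurable (borel \<Otimes>\<^sub>M borel)"
        by (simp only: borel_prod measurable_cong_sets [OF sets_\<pi> refl])
      have "second_moment \<pi> $ p $ q = (\<integral>z. ?h z \<partial>distr (\<mu> \<Otimes>\<^sub>M \<gamma>) (borel \<Otimes>\<^sub>M borel) (\<lambda>z. (fst z, - (K *v fst z) + fst (snd z))))"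
        unfolding distr_\<mu>\<gamma>_\<pi> by (rule outer_entry_\<pi>(2))
      also have "\<dots> = (\<integral>z. ?f (fst z) (snd z) \<partial>(\<mu> \<Otimes>\<^sub>M \<gamma>))"
        by (subst integral_distr [OF _ h]) (simp_all add: regressor_def)
      finally show ?thesis by simp
    qed
    moreover have "(\<Sum>k<n. ?f (x_traj \<omega> k) (vs k \<omega>, ws k \<omega>)) / n = Phi_data (x_traj \<omega>) (u_traj \<omega>) n $ p $ q" for \<omega> n
      by (simp add: Phi_data_def outer_def regressor_def u_traj_eq)
    ultimately show ?thesis by simp
  qed
  have "AE \<omega> in \<Omega>. \<forall>p q. (\<lambda>M. Phi_data (x_traj \<omega>) (u_traj \<omega>) M $ p $ q) \<longlonglongrightarrow> second_moment \<pi> $ p $ q"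
    by (intro eventually_all_finite entry)
  then show ?thesis by eventually_elim (intro vec_tendstoI, blast)
qed

lemma Qhat_almost_surely_accurate:
  assumes "lq_problem S R"
  shows "AE \<omega> in \<Omega>. \<forall>\<delta>>0. \<forall>\<^sub>F M in sequentially. lq_problem.accurate A B S R \<delta>
     (Qhat (Phi_data (x_traj \<omega>) (u_traj \<omega>) M) (Psi_data (x_traj \<omega>) (u_traj \<omega>) M) (Xi_data S R (x_traj \<omega>) (u_traj \<omega>) M))"
proof -
  interpret lq_problem A B S R by (rule assms)
  have entry: "AE \<omega> in \<Omega>. (\<lambda>M. mean_residual C (x_traj \<omega>) (u_traj \<omega>) i j M $ p) \<longlonglongrightarrow> 0" for i j p
  proof -
    let ?f = "\<lambda>x e. residual_at i j x e * vtilde (regressor x e) $ p"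
    have "poly_growth (2 + 2) ?f" by (intro poly_growth_mult poly_growth_vtilde poly_growth_residual_at)
    then have "AE \<omega> in \<Omega>. (\<lambda>n. (\<Sum>k<n. ?f (x_traj \<omega> k) (vs k \<omega>, ws k \<omega>)) / n) \<longlonglongrightarrow> 0"
      unfolding weighted_residual_mean_zero [of i j p, symmetric] by (intro trajectory_averages) simp
    moreover have "residual_at i j (x_traj \<omega> k) (vs k \<omega>, ws k \<omega>) = residual C (x_traj \<omega>) (u_traj \<omega>) i j k" for \<omega> k
      by (simp add: residual_at_def residual_def x_traj_Suc u_traj_eq)
    ultimately show ?thesis by (simp add: mean_residual_entry regressor_def u_traj_eq)
  qed
  have "AE \<omega> in \<Omega>. \<forall>i j p. (\<lambda>M. mean_residual C (x_traj \<omega>) (u_traj \<omega>) i j M $ p) \<longlonglongrightarrow> 0"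
    by (intro eventually_all_finite entry)
  then have "AE \<omega> in \<Omega>. \<forall>i j. mean_residual C (x_traj \<omega>) (u_traj \<omega>) i j \<longlonglongrightarrow> 0"
    by eventually_elim (intro allI vec_tendstoI, simp)
  with Phi_data_tendsto show ?thesis
  proof eventually_elim
    case (elim \<omega>)
    then show ?case using Qhat_eventually_accurate [OF elim(1) second_moment, of C] by blast
  qed
qed

end

section \<open>Convergence of the gains\<close>

theorem theorem3:
  fixes A :: "real^'n^'n" and B :: "real^'m^'n" and C :: "real^'q^'n"
    and S :: "real^'n^'n" and R :: "real^'m^'m"
    and K\<^sub>1 :: "real^'n^'m" and xini :: "real^'n" and \<sigma> :: real
    and \<Omega> :: "'w measure"
    and w :: "nat \<Rightarrow> 'w \<Rightarrow> real^'q" and v :: "nat \<Rightarrow> 'w \<Rightarrow> real^'m"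
    and \<pi> :: "((real^'n) \<times> (real^'m)) measure"
  assumes "controllable A B"
    and "pos_def S" and "pos_def R"
    and "\<sigma> \<ge> 0"
    and "prob_space \<Omega>"
    and "iid_gauss \<Omega> 1 w" and "iid_gauss \<Omega> \<sigma> v" and "indep_processes \<Omega> w v"
    and "stabilizing A B K\<^sub>1"
    and "invariant_dist A B C K\<^sub>1 \<sigma> \<pi>"
    and "invertible (second_moment \<pi>)"
  shows "\<forall>\<epsilon>::real > 0. \<exists>T\<^sub>0::nat. AE \<omega> in \<Omega>. \<exists>M\<^sub>0::nat. \<forall>T\<ge>T\<^sub>0. \<forall>M\<ge>M\<^sub>0.
           (let K = olspi_gain A B C S R K\<^sub>1 xini (\<lambda>k. w k \<omega>) (\<lambda>k. v k \<omega>) T M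
            in limsup (\<lambda>N. ereal (norm (policy_cost A B S R (K N) - opt_cost A B S R))) < ereal \<epsilon> \<and>
               (\<forall>N\<ge>1. \<forall>i\<in>{1..N}. stabilizing A B (K i)))"
proof (intro allI impI)
  fix \<epsilon> :: real assume \<epsilon>: "\<epsilon> > 0"
  interpret lq_problem A B S R using assms by unfold_locales
  interpret behavior_process A B C K\<^sub>1 xini \<sigma> \<Omega> w v \<pi> by (intro behavior_process.intro assms)
  obtain T\<^sub>0 \<delta> where \<delta>: "\<delta> > 0" and robust: "\<And>Qh T. accurate \<delta> Qh \<Longrightarrow> T \<ge> T\<^sub>0 \<Longrightarrow>
      (\<forall>i. stabilizing A B ((improve_step Qh T ^^ i) K\<^sub>1)) \<and>
      (\<forall>\<^sub>F i in sequentially. norm (Pc ((improve_step Qh T ^^ i) K\<^sub>1) - opt_cost A B S R) \<le> \<epsilon> / 2)"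
    using robust_policy_iteration [OF assms(9) \<epsilon>] by blast
  show "\<exists>T\<^sub>0::nat. AE \<omega> in \<Omega>. \<exists>M\<^sub>0::nat. \<forall>T\<ge>T\<^sub>0. \<forall>M\<ge>M\<^sub>0.
           (let K = olspi_gain A B C S R K\<^sub>1 xini (\<lambda>k. w k \<omega>) (\<lambda>k. v k \<omega>) T M
            in limsup (\<lambda>N. ereal (norm (policy_cost A B S R (K N) - opt_cost A B S R))) < ereal \<epsilon> \<and>
               (\<forall>N\<ge>1. \<forall>i\<in>{1..N}. stabilizing A B (K i)))"
  proof (rule exI [of _ T\<^sub>0], use Qhat_almost_surely_accurate [OF lq_problem_axioms] in eventually_elim)
    case (elim \<omega>)
    let ?Qh = "\<lambda>M. Qhat (Phi_data (x_traj \<omega>) (u_traj \<omega>) M) (Psi_data (x_traj \<omega>) (u_traj \<omega>) M)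
      (Xi_data S R (x_traj \<omega>) (u_traj \<omega>) M)"
    obtain M\<^sub>0 where M\<^sub>0: "\<And>M. M \<ge> M\<^sub>0 \<Longrightarrow> accurate \<delta> (?Qh M)"
      using elim \<delta> unfolding eventually_sequentially by blast
    show ?case
    proof (intro exI [of _ M\<^sub>0] allI impI)
      fix T M assume "T \<ge> T\<^sub>0" "M \<ge> M\<^sub>0"
      define K where "K = olspi_gain A B C S R K\<^sub>1 xini (\<lambda>k. w k \<omega>) (\<lambda>k. v k \<omega>) T M"
      have K: "K i = (improve_step (?Qh M) T ^^ (i - 1)) K\<^sub>1" for i
        by (simp add: K_def olspi_gain_def Khat_def Let_def improve_eq_improve_step x_traj_def u_traj_def)
      note r = robust [OF M\<^sub>0 [OF \<open>M \<ge> M\<^sub>0\<close>] \<open>T \<ge> T\<^sub>0\<close>]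
      \<comment> \<open>The gains are numbered from 1, so \<open>K (Suc i)\<close> is the result of \<open>i\<close>
        improvement steps.\<close>
      have "\<forall>\<^sub>F i in sequentially. norm (Pc (K (Suc i)) - opt_cost A B S R) \<le> \<epsilon> / 2"
        using r by (simp add: K)
      then have "\<forall>\<^sub>F i in sequentially. norm (Pc (K i) - opt_cost A B S R) \<le> \<epsilon> / 2"
        by (simp only: eventually_sequentially_Suc [of "\<lambda>i. norm (Pc (K i) - opt_cost A B S R) \<le> \<epsilon> / 2"])
      then have "limsup (\<lambda>N. ereal (norm (Pc (K N) - opt_cost A B S R))) \<le> ereal (\<epsilon> / 2)"
        by (intro Limsup_bounded) (auto elim: eventually_mono)
      also have "\<dots> < ereal \<epsilon>" using \<epsilon> by simp
      finally have "limsup (\<lambda>N. ereal (norm (Pc (K N) - opt_cost A B S R))) < ereal \<epsilon>" .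
      moreover have "stabilizing A B (K i)" for i unfolding K using r by blast
      ultimately show "let K = olspi_gain A B C S R K\<^sub>1 xini (\<lambda>k. w k \<omega>) (\<lambda>k. v k \<omega>) T M
            in limsup (\<lambda>N. ereal (norm (policy_cost A B S R (K N) - opt_cost A B S R))) < ereal \<epsilon> \<and>
               (\<forall>N\<ge>1. \<forall>i\<in>{1..N}. stabilizing A B (K i))"
        unfolding K_def [symmetric] Let_def by blast
    qed
  qed
qed

end
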